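(* Let $N\ge1$, $1\le p<\infty$, $\omega\in C^+_{\mathrm{inc}}$, and $\Omega\in C_{\mathrm{inc}}$ such that $m_1t^p\le\Omega(t)\le m_2t^p$ for all $t\ge0$ and some constants $0<m_1\le m_2$. Let $(\rho_\varepsilon)_{\varepsilon>0}\subset L^1(\mathbb{R}^N)$ be a family of radial mollifiers of the form $\rho_\varepsilon(h)=\varepsilon^{-N}\rho(h/\varepsilon)$ for some $\rho\in L^1(\mathbb{R}^N)$. Then for $f\in L^p(\mathbb{R}^N)$ the following are equivalent: (i) $f\in W^{1,p}(\mathbb{R}^N)$ if $p>1$, resp. $f\in BV(\mathbb{R}^N)$ if $p=1$; (ii) $\displaystyle\limsup_{\varepsilon\downarrow0}\int_{\mathbb{R}^N}\rho_\varepsilon(h)\,\omega\!\left(\int_{\mathbb{R}^N}\Omega\!\left(\frac{|f(x+h)-f(x)|}{|h|}\right)\mathrm{d}x\right)\mathrm{d}h<\infty$. Moreover, there are constants $0<c\le C$ independent of $f$ such that \[c\,\omega\big(\|\nabla f\|^p_{L^p(\mathbb{R}^N)}\big)\le \limsup_{\varepsilon\downarrow0}\int_{\mathbb{R}^N}\rho_\varepsilon(h)\,\omega\!\left(\int_{\mathbb{R}^N}\Omega\!\left(\frac{|f(x+h)-f(x)|}{|h|}\right)\mathrm{d}x\right)\mathrm{d}h\le C\,\omega\big(\|\nabla f\|^p_{L^p(\mathbb{R}^N)}\big),\] where for $p=1$, $\|\nabla f\|_{L^1}$ denotes the total variation $[f]_{BV}$ of $f$ (taken to be $+\infty$ if $f\notin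 BV$, and similarly $\|\nabla f\|_{L^p}=+\infty$ if $f\notin W^{1,p}$).
   Context: Mollifiers: $\rho_\varepsilon\ge0$, $\int\rho_\varepsilon=1$, and $\lim_{\varepsilon\downarrow0}\int_{|z|\ge\delta}\rho_\varepsilon=0$ for all $\delta>0$. $C_{\mathrm{inc}}$ is the set of continuous increasing $\omega:[0,\infty)\to[0,\infty)$ with $\omega(0)=0$ and $\lim_{t\to\infty}\omega(t)=\infty$; $C^+_{\mathrm{inc}}$ is the set of $\omega\in C_{\mathrm{inc}}$ that are roughly subadditive: there is $A>0$ with $\omega(t_1+t_2)\le A(\omega(t_1)+\omega(t_2))$ for all $t_1,t_2\ge0$. Convention $\omega(+\infty)=+\infty$. $[f]_{BV}=\sup\{\int f\,\mathrm{div}\phi:\phi\in C^1_c(\mathbb{R}^N;\mathbb{R}^N),\|\phi\|_\infty\le1\}$. *)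

theory Defs
  imports "HOL-Analysis.Analysis"
begin

definition C_inc :: "(real \<Rightarrow> real) set" where
  "C_inc = {w. continuous_on {0..} w \<and> mono_on {0..} w \<and> (\<forall>t\<ge>0. w t \<ge> 0) \<and> w 0 = 0
              \<and> filterlim w at_top at_top}"

definition C_inc_plus :: "(real \<Rightarrow> real) set" where
  "C_inc_plus = {w \<in> C_inc. \<exists>A>0. \<forall>t1\<ge>0. \<forall>t2\<ge>0. w (t1 + t2) \<le> A * (w t1 + w t2)}"

definition omega_ext :: "(real \<Rightarrow> real) \<Rightarrow> ennreal \<Rightarrow> ennreal" where
  "omega_ext w x = (if x = top then top else ennreal (w (enn2real x)))"

definition Lp :: "real \<Rightarrow> ('a::euclidean_space \<Rightarrow> real) set" where
  "Lp p = {f. f \<in> borel_measurable lebesgue \<and> integrable lebesgue (\<lambda>x. \<bar>f x\<bar> powr p)}"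

definition C1c :: "('a::euclidean_space \<Rightarrow> 'b::euclidean_space) set" where
  "C1c = {\<phi>. (\<forall>x. \<phi> differentiable (at x))
            \<and> (\<forall>v. continuous_on UNIV (\<lambda>x. frechet_derivative \<phi> (at x) v))
            \<and> bounded {x. \<phi> x \<noteq> 0}}"

definition div_field :: "('a::euclidean_space \<Rightarrow> 'a) \<Rightarrow> 'a \<Rightarrow> real" where
  "div_field \<phi> x = (\<Sum>b\<in>Basis. frechet_derivative \<phi> (at x) b \<bullet> b)"

definition weak_grad :: "('a::euclidean_space \<Rightarrow> real) \<Rightarrow> ('a \<Rightarrow> 'a) \<Rightarrow> bool" where
  "weak_grad f g \<longleftrightarrow> g \<in> borel_measurable lebesgue \<and>
     (\<forall>\<psi>\<in>(C1c :: ('a \<Rightarrow> real) set). \<forall>b\<in>Basis.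
        (\<integral>x. f x * frechet_derivative \<psi> (at x) b \<partial>lebesgue) = - (\<integral>x. (g x \<bullet> b) * \<psi> x \<partial>lebesgue))"

definition W1p :: "real \<Rightarrow> ('a::euclidean_space \<Rightarrow> real) set" where
  "W1p p = {f. f \<in> Lp p \<and> (\<exists>g. weak_grad f g \<and> (\<forall>b\<in>Basis. (\<lambda>x. g x \<bullet> b) \<in> Lp p))}"

text \<open>Total variation [f]_BV (possibly +inf).  Since phi and -phi are both admissible,
  taking the positive part of each integral does not change the supremum.\<close>
definition BV_seminorm :: "('a::euclidean_space \<Rightarrow> real) \<Rightarrow> ennreal" where
  "BV_seminorm f = (SUP \<phi>\<in>{\<phi>\<in>(C1c :: ('a \<Rightarrow> 'a) set). \<forall>x. norm (\<phi> x) \<le> 1}.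
                      ennreal (\<integral>x. f x * div_field \<phi> x \<partial>lebesgue))"

definition BV :: "('a::euclidean_space \<Rightarrow> real) set" where
  "BV = {f. f \<in> Lp 1 \<and> BV_seminorm f < top}"

text \<open>||grad f||_p^p (total variation if p = 1), +inf if f has no weak gradient in L^p.
  Weak gradients are a.e. unique, so the infimum is over a set of equal values (or empty).\<close>
definition grad_pow :: "real \<Rightarrow> ('a::euclidean_space \<Rightarrow> real) \<Rightarrow> ennreal" where
  "grad_pow p f = (if p = 1 then BV_seminorm f
                   else (INF g\<in>{g. weak_grad f g}. \<integral>\<^sup>+x. ennreal (norm (g x) powr p) \<partial>lebesgue))"

definition rho_eps :: "('a::euclidean_space \<Rightarrow> real) \<Rightarrow> real \<Rightarrow> 'a \<Rightarrow> real" where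
  "rho_eps \<rho> \<epsilon> h = \<epsilon> powr (- real DIM('a)) * \<rho> (h /\<^sub>R \<epsilon>)"

definition nonlocal_energy ::
  "(real \<Rightarrow> real) \<Rightarrow> (real \<Rightarrow> real) \<Rightarrow> ('a::euclidean_space \<Rightarrow> real) \<Rightarrow> real \<Rightarrow> ('a \<Rightarrow> real) \<Rightarrow> ennreal" where
  "nonlocal_energy w W \<rho> \<epsilon> f =
     (\<integral>\<^sup>+h. ennreal (rho_eps \<rho> \<epsilon> h) *
        omega_ext w (\<integral>\<^sup>+x. ennreal (W (\<bar>f (x + h) - f x\<bar> / norm h)) \<partial>lebesgue) \<partial>lebesgue)"

end

theory Submission
  imports Defs
begin

text \<open>Write $E(h) = \int |f(x+h) - f(x)|^p dx$. Testing differences against $C^1_c$ functions gives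
  $E(h) \le |h|^p \|\nabla f\|_p^p$ (total variation if $p = 1$), which together with
  $\omega(a t) \le L_a \omega(t)$, a consequence of rough subadditivity, yields the upper bound.

  For the lower bound, suppose that for every basis vector $b$ there are $t \to 0$ with
  $E(t b) \le K t^p$. The difference quotients then converge weakly in $L^p$ (as measures if $p = 1$), so
  $\|\nabla f\|_p^p \le c K$. Hence, if $c K < \|\nabla f\|_p^p$, some $b$ satisfies $E(t b) > K t^p$ for
  all small $t$. If $h'$ is the mirror image of $h$ in the hyperplane orthogonal to $b$, then $h - h'$ is
  parallel to $b$ and $E(h - h') \le 2^p (E(h) + E(h'))$, so $E(h)/|h|^p$ or $E(h')/|h'|^p$ is at least a
  constant times $K$ as long as $h$ is not almost orthogonal to $b$. A radial mollifier weights $h$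
  and $h'$ equally and has half of its mass on such $h$. No convexity of $\omega$ is needed.\<close>

section \<open>Translations and test functions\<close>

text \<open>The function f is never smoothed. For the upper bound the mean value theorem is applied
  to s |-> integral of f(x) \<psi>(x - s h), and the norm of the difference is then recovered by
  duality with $C^1_c$ functions. For p > 1 the duality is stated with Young's inequality, so that
  only p-th powers of norms occur. In the lower bound, averaging over h inside \<omega> would need
  Jensen's inequality. Instead one of h, h' is shown to be good, pointwise in h, and \<omega> is
  evaluated there. Reflection is the right pairing because it preserves |h|, hence both the weight
  and the denominator. The cone of admissible h is chosen from \<rho> alone, the same for all basis
  vectors. What depends on f is the direction b and the range of t, and the latter only decides how
  small \<epsilon> must be. This makes the constants uniform in f, and the lower estimate holds for
  all small \<epsilon>. For p > 1 the pairings of the difference quotients with test functions are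
  known to converge beforehand; what has to be shown is that the limit functional is given by a
  function in $L^p$ with the right norm.\<close>

lemma lebesgue_diagonal_affine:
  fixes c :: "'a::euclidean_space \<Rightarrow> real" and t :: 'a and u :: "'a \<Rightarrow> ennreal"
  assumes c: "\<And>j. j \<in> Basis \<Longrightarrow> c j \<noteq> 0" and u: "u \<in> borel_measurable lebesgue"
  shows "(\<integral>\<^sup>+x. u x \<partial>lebesgue) =
    ennreal (\<Prod>j\<in>Basis. \<bar>c j\<bar>) * (\<integral>\<^sup>+x. u (t + (\<Sum>j\<in>Basis. (c j * (x \<bullet> j)) *\<^sub>R j)) \<partial>lebesgue)"
proof -
  define T :: "'a \<Rightarrow> 'a" where "T = (\<lambda>x. t + (\<Sum>j\<in>Basis. (c j * (x \<bullet> j)) *\<^sub>R j))"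
  have T: "T \<in> lebesgue \<rightarrow>\<^sub>M lebesgue"
    using lebesgue_affine_measurable[of c t] c unfolding T_def by auto
  have uT: "u \<in> borel_measurable (distr lebesgue lebesgue T)"
    using u by simp
  have "(\<integral>\<^sup>+x. u x \<partial>lebesgue) = (\<integral>\<^sup>+x. u x \<partial>density (distr lebesgue lebesgue T) (\<lambda>_. (\<Prod>j\<in>Basis. \<bar>c j\<bar>)))"
    using lebesgue_affine_euclidean[of c t] c unfolding T_def by auto
  also have "\<dots> = ennreal (\<Prod>j\<in>Basis. \<bar>c j\<bar>) * (\<integral>\<^sup>+x. u x \<partial>distr lebesgue lebesgue T)"
    using uT by (subst nn_integral_density) (auto simp: nn_integral_cmult)
  also have "(\<integral>\<^sup>+x. u x \<partial>distr lebesgue lebesgue T) = (\<integral>\<^sup>+x. u (T x) \<partial>lebesgue)"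
    using T u by (subst nn_integral_distr) auto
  finally show ?thesis unfolding T_def .
qed

lemma distr_lebesgue_translation:
  fixes t :: "'a::euclidean_space"
  shows measurable_lebesgue_translation: "(\<lambda>x. x + t) \<in> lebesgue \<rightarrow>\<^sub>M lebesgue"
    and "distr lebesgue lebesgue (\<lambda>x. x + t) = lebesgue"
proof -
  have T: "(\<lambda>x. t + (\<Sum>j\<in>Basis. (1 * (x \<bullet> j)) *\<^sub>R j)) = (\<lambda>x::'a. x + t)"
    by (simp add: euclidean_representation add.commute)
  show "(\<lambda>x. x + t) \<in> lebesgue \<rightarrow>\<^sub>M lebesgue"
    using lebesgue_affine_measurable[of "\<lambda>_. 1" t] unfolding T by simp
  have "lebesgue = density (distr lebesgue lebesgue (\<lambda>x. x + t)) (\<lambda>_. 1)"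
    using lebesgue_affine_euclidean[of "\<lambda>_. 1" t] unfolding T by simp
  then show "distr lebesgue lebesgue (\<lambda>x. x + t) = lebesgue"
    by (simp add: density_1)
qed

lemma lebesgue_translate:
  fixes h :: "'a::euclidean_space"
  shows measurable_translate: "u \<in> borel_measurable lebesgue \<Longrightarrow> (\<lambda>x. u (x + h)) \<in> borel_measurable lebesgue"
    and nn_integral_translate: "v \<in> borel_measurable lebesgue \<Longrightarrow>
      (\<integral>\<^sup>+x. v (x + h) \<partial>lebesgue) = (\<integral>\<^sup>+x. v x \<partial>lebesgue)"
    and integrable_translate: "w \<in> borel_measurable lebesgue \<Longrightarrow>
      integrable lebesgue (\<lambda>x. w (x + h)) \<longleftrightarrow> integrable lebesgue (w :: 'a \<Rightarrow> real)"
    and integral_translate: "w \<in> borel_measurable lebesgue \<Longrightarrow>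
      (\<integral>x. w (x + h) \<partial>lebesgue) = (\<integral>x. w x \<partial>lebesgue)"
    and AE_translate: "(AE x in lebesgue. P x) \<Longrightarrow> (AE x in lebesgue. P (x + h))"
proof -
  note T = measurable_lebesgue_translation[of h] and d = distr_lebesgue_translation(2)[of h]
  show "u \<in> borel_measurable lebesgue \<Longrightarrow> (\<lambda>x. u (x + h)) \<in> borel_measurable lebesgue"
    using T by (rule measurable_compose)
  show "v \<in> borel_measurable lebesgue \<Longrightarrow>
      (\<integral>\<^sup>+x. v (x + h) \<partial>lebesgue) = (\<integral>\<^sup>+x. v x \<partial>lebesgue)"
    using nn_integral_distr[OF T, of v] d by simp
  show "w \<in> borel_measurable lebesgue \<Longrightarrow>
      integrable lebesgue (\<lambda>x. w (x + h)) \<longleftrightarrow> integrable lebesgue w"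
    using integrable_distr_eq[OF T, of w] d by simp
  show "w \<in> borel_measurable lebesgue \<Longrightarrow>
      (\<integral>x. w (x + h) \<partial>lebesgue) = (\<integral>x. w x \<partial>lebesgue)"
    using integral_distr[OF T, of w] d by simp
  assume "AE x in lebesgue. P x"
  then show "AE x in lebesgue. P (x + h)"
    by (intro AE_distrD[OF T]) (subst d)
qed

section \<open>The spaces $L^p$, translations and local integrability\<close>

lemma powr_add_le:
  fixes a b p :: real
  assumes "0 \<le> p"
  shows "\<bar>a + b\<bar> powr p \<le> 2 powr p * (\<bar>a\<bar> powr p + \<bar>b\<bar> powr p)"
proof -
  have "\<bar>a + b\<bar> powr p \<le> (2 * max \<bar>a\<bar> \<bar>b\<bar>) powr p"
    using assms by (intro powr_mono2) auto
  also have "\<dots> = 2 powr p * max (\<bar>a\<bar> powr p) (\<bar>b\<bar> powr p)"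
    using assms by (auto simp: powr_mult max_def powr_mono2 intro!: antisym)
  also have "\<dots> \<le> 2 powr p * (\<bar>a\<bar> powr p + \<bar>b\<bar> powr p)"
    by (intro mult_left_mono) auto
  finally show ?thesis .
qed

lemma Lp_add:
  assumes "1 \<le> p" "f \<in> Lp p" "g \<in> Lp p"
  shows "(\<lambda>x. f x + g x) \<in> Lp p"
proof -
  have [measurable]: "f \<in> borel_measurable lebesgue" "g \<in> borel_measurable lebesgue"
    using assms by (auto simp: Lp_def)
  have "integrable lebesgue (\<lambda>x. 2 powr p * (\<bar>f x\<bar> powr p + \<bar>g x\<bar> powr p))"
    using assms by (auto simp: Lp_def)
  then have "integrable lebesgue (\<lambda>x. \<bar>f x + g x\<bar> powr p)"
    by (rule Bochner_Integration.integrable_bound) (use assms powr_add_le[of p] in auto)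
  then show ?thesis by (simp add: Lp_def)
qed

lemma Lp_cmult: "f \<in> Lp p \<Longrightarrow> (\<lambda>x. c * f x) \<in> Lp p"
  by (auto simp: Lp_def abs_mult powr_mult)

lemma Lp_translate: "f \<in> Lp p \<Longrightarrow> (\<lambda>x. f (x + h)) \<in> Lp p"
  unfolding Lp_def using integrable_translate[of "\<lambda>x. \<bar>f x\<bar> powr p" h]
  by (auto intro: measurable_translate)

lemma Lp_difference:
  assumes "1 \<le> p" "f \<in> Lp p"
  shows "(\<lambda>x. f (x + h) - f x) \<in> Lp p"
  using Lp_add[OF assms(1) Lp_translate[OF assms(2)] Lp_cmult[OF assms(2), of "-1"]] by simp

lemma powr_ge_self:
  fixes a p :: real
  assumes "1 \<le> p"
  shows "\<bar>a\<bar> \<le> 1 + \<bar>a\<bar> powr p"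
proof (cases "\<bar>a\<bar> \<le> 1")
  case False
  then have "\<bar>a\<bar> powr 1 \<le> \<bar>a\<bar> powr p"
    using assms by (intro powr_mono) auto
  then show ?thesis using False by auto
qed (smt (verit) powr_ge_zero)

text \<open>A substitute for Hoelder's inequality: |f| <= 1 + |f|^p on the ball that carries \<psi>,
  so B times the sum of the indicator of the ball and |f|^p is an integrable majorant.\<close>

lemma Lp_integrable_mult:
  fixes f \<psi> :: "'a::euclidean_space \<Rightarrow> real"
  assumes p: "1 \<le> p" and f: "f \<in> Lp p" and m: "\<psi> \<in> borel_measurable lebesgue"
    and B: "\<And>x. \<bar>\<psi> x\<bar> \<le> B" and R: "\<And>x. \<psi> x \<noteq> 0 \<Longrightarrow> norm x \<le> R"
  shows "integrable lebesgue (\<lambda>x. f x * \<psi> x)"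
proof -
  have [measurable]: "f \<in> borel_measurable lebesgue" using f by (auto simp: Lp_def)
  have "integrable lebesgue (indicator (cball 0 R) :: 'a \<Rightarrow> real)"
    using lmeasurable_cball[of 0 R] by (simp add: fmeasurable_def integrable_indicator_iff)
  then have "integrable lebesgue (\<lambda>x. B * (indicator (cball 0 R) x + \<bar>f x\<bar> powr p))"
    using f by (intro integrable_mult_right Bochner_Integration.integrable_add) (auto simp: Lp_def)
  then show ?thesis
  proof (rule Bochner_Integration.integrable_bound)
    show "AE x in lebesgue. norm (f x * \<psi> x) \<le> norm (B * (indicator (cball 0 R) x + \<bar>f x\<bar> powr p))"
    proof (rule AE_I2)
      fix x
      have "0 \<le> B" using B[of x] by linarith
      show "norm (f x * \<psi> x) \<le> norm (B * (indicator (cball 0 R) x + \<bar>f x\<bar> powr p))"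
      proof (cases "\<psi> x = 0")
        case False
        then have "indicator (cball 0 R) x = (1::real)" using R by auto
        moreover have "\<bar>f x\<bar> * \<bar>\<psi> x\<bar> \<le> (1 + \<bar>f x\<bar> powr p) * B"
          using powr_ge_self[OF p, of "f x"] B[of x] by (intro mult_mono) (auto simp: add_nonneg_nonneg)
        ultimately show ?thesis using \<open>0 \<le> B\<close> by (simp add: abs_mult mult.commute)
      qed auto
    qed
  qed (use m in measurable)
qed

section \<open>Calculus with $C^1_c$ test functions\<close>

lemma C1cI:
  assumes d: "\<And>x. (\<phi> has_derivative D x) (at x)"
    and c: "\<And>v. continuous_on UNIV (\<lambda>x. D x v)" and b: "bounded {x. \<phi> x \<noteq> 0}"
  shows "\<phi> \<in> C1c" "frechet_derivative \<phi> (at x) = D x"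
proof -
  have "frechet_derivative \<phi> (at x) = D x" for x
    using frechet_derivative_at[OF d] by simp
  then show "\<phi> \<in> C1c" "frechet_derivative \<phi> (at x) = D x"
    using assms by (auto simp: C1c_def differentiable_def)
qed

lemma C1c_has_derivative: "\<phi> \<in> C1c \<Longrightarrow> (\<phi> has_derivative frechet_derivative \<phi> (at x)) (at x)"
  by (simp add: C1c_def frechet_derivative_works)

lemma C1c_continuous: "\<phi> \<in> C1c \<Longrightarrow> continuous_on UNIV \<phi>"
  by (simp add: C1c_def continuous_on_eq_continuous_at differentiable_imp_continuous_within)

text \<open>The same radius serves the derivative: the complement of the closed ball is open, \<phi>
  vanishes on it, and derivatives are local.\<close>

lemma C1c_support:
  fixes \<phi> :: "'a::euclidean_space \<Rightarrow> 'b::euclidean_space"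
  assumes "\<phi> \<in> C1c"
  obtains R where "0 < R" "\<And>x. \<phi> x \<noteq> 0 \<Longrightarrow> norm x \<le> R"
    "\<And>x v. frechet_derivative \<phi> (at x) v \<noteq> 0 \<Longrightarrow> norm x \<le> R"
proof -
  obtain R where R: "0 < R" "\<And>x. \<phi> x \<noteq> 0 \<Longrightarrow> norm x \<le> R"
    using assms unfolding C1c_def bounded_pos by auto
  have "frechet_derivative \<phi> (at x) v = 0" if "\<not> norm x \<le> R" for x v
  proof -
    have "(\<phi> has_derivative (\<lambda>_. 0)) (at x)"
    proof (rule has_derivative_transform_within_open[where f = "\<lambda>_. 0" and s = "- cball 0 R"])
      show "x \<in> - cball 0 R" using that by auto
      show "0 = \<phi> y" if "y \<in> - cball 0 R" for y using R(2)[of y] that by auto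
    qed auto
    from frechet_derivative_at[OF this] show ?thesis by metis
  qed
  with R show thesis by (intro that) auto
qed

lemma continuous_support_bounded:
  fixes g :: "'a::euclidean_space \<Rightarrow> 'b::euclidean_space"
  assumes "continuous_on UNIV g" "\<And>x. g x \<noteq> 0 \<Longrightarrow> norm x \<le> R"
  obtains B where "0 < B" "\<And>x. norm (g x) \<le> B"
proof -
  have "compact (g ` cball 0 R)"
    using assms by (intro compact_continuous_image) (auto intro: continuous_on_subset)
  then obtain B where B: "0 < B" "\<And>x. x \<in> cball 0 R \<Longrightarrow> norm (g x) \<le> B"
    by (metis bounded_pos compact_imp_bounded imageI)
  have "norm (g x) \<le> B" for x
    using B assms(2)[of x] by (cases "g x = 0") auto
  with B show thesis using that by blast
qed

lemma C1c_bounded: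
  fixes \<phi> :: "'a::euclidean_space \<Rightarrow> 'b::euclidean_space"
  assumes "\<phi> \<in> C1c"
  obtains B where "0 < B" "\<And>x. norm (\<phi> x) \<le> B"
  using C1c_support[OF assms] continuous_support_bounded[OF C1c_continuous[OF assms]] by metis

lemma C1c_derivative_bounded:
  fixes \<phi> :: "'a::euclidean_space \<Rightarrow> 'b::euclidean_space"
  assumes "\<phi> \<in> C1c"
  obtains B where "0 < B" "\<And>x. norm (frechet_derivative \<phi> (at x) v) \<le> B"
proof -
  obtain R where "\<And>x v. frechet_derivative \<phi> (at x) v \<noteq> 0 \<Longrightarrow> norm x \<le> R"
    using C1c_support[OF assms] by metis
  with assms have "continuous_on UNIV (\<lambda>x. frechet_derivative \<phi> (at x) v)"
    "\<And>x. frechet_derivative \<phi> (at x) v \<noteq> 0 \<Longrightarrow> norm x \<le> R"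
    by (auto simp: C1c_def)
  then show thesis
    by (rule continuous_support_bounded[where g = "\<lambda>x. frechet_derivative \<phi> (at x) v"]) (use that in blast)+
qed

lemma C1c_measurable:
  fixes \<phi> :: "'a::euclidean_space \<Rightarrow> real"
  assumes "\<phi> \<in> C1c"
  shows "\<phi> \<in> borel_measurable lebesgue" "(\<lambda>x. frechet_derivative \<phi> (at x) v) \<in> borel_measurable lebesgue"
  using C1c_continuous[OF assms] assms
  by (auto simp: C1c_def intro!: measurable_completion borel_measurable_continuous_onI)

lemma C1c_integrable_mult:
  fixes f \<psi> :: "'a::euclidean_space \<Rightarrow> real"
  assumes p: "1 \<le> p" and f: "f \<in> Lp p" and \<psi>: "\<psi> \<in> C1c"
  shows "integrable lebesgue (\<lambda>x. f x * \<psi> x)"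
    "integrable lebesgue (\<lambda>x. f x * frechet_derivative \<psi> (at x) v)"
proof -
  obtain R where R: "\<And>x. \<psi> x \<noteq> 0 \<Longrightarrow> norm x \<le> R"
    "\<And>x v. frechet_derivative \<psi> (at x) v \<noteq> 0 \<Longrightarrow> norm x \<le> R"
    using C1c_support[OF \<psi>] by metis
  obtain B where B: "\<And>x. norm (\<psi> x) \<le> B" using C1c_bounded[OF \<psi>] by metis
  obtain B' where B': "\<And>x. norm (frechet_derivative \<psi> (at x) v) \<le> B'"
    using C1c_derivative_bounded[OF \<psi>] by metis
  show "integrable lebesgue (\<lambda>x. f x * \<psi> x)"
    by (rule Lp_integrable_mult[OF p f C1c_measurable(1)[OF \<psi>], where B = B and R = R]) (use R B in auto)
  show "integrable lebesgue (\<lambda>x. f x * frechet_derivative \<psi> (at x) v)"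
    by (rule Lp_integrable_mult[OF p f C1c_measurable(2)[OF \<psi>], where B = B' and R = R]) (use R B' in auto)
qed

lemma C1c_translate:
  fixes \<psi> :: "'a::euclidean_space \<Rightarrow> 'b::euclidean_space"
  assumes \<psi>: "\<psi> \<in> C1c"
  shows "(\<lambda>x. \<psi> (x - h)) \<in> C1c"
    "frechet_derivative (\<lambda>x. \<psi> (x - h)) (at x) = frechet_derivative \<psi> (at (x - h))"
proof -
  have d: "((\<lambda>x. \<psi> (x - h)) has_derivative frechet_derivative \<psi> (at (x - h))) (at x)" for x
    by (rule has_derivative_compose[where f = "\<lambda>x. x - h" and f' = "\<lambda>v. v" and g = \<psi>])
      (auto intro!: derivative_eq_intros C1c_has_derivative[OF \<psi>])
  have c: "continuous_on UNIV (\<lambda>x. frechet_derivative \<psi> (at (x - h)) v)" for v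
    using \<psi> unfolding C1c_def
    by (intro continuous_on_compose2[where g = "\<lambda>x. frechet_derivative \<psi> (at x) v" and f = "\<lambda>x. x - h"])
      (auto intro!: continuous_intros)
  obtain R where "\<And>x. \<psi> x \<noteq> 0 \<Longrightarrow> norm x \<le> R" using C1c_support[OF \<psi>] by metis
  then have "bounded {x. \<psi> (x - h) \<noteq> 0}"
    by (intro boundedI[where B = "R + norm h"]) (smt (verit) mem_Collect_eq norm_triangle_sub)
  from C1cI[OF d c this] show "(\<lambda>x. \<psi> (x - h)) \<in> C1c"
    "frechet_derivative (\<lambda>x. \<psi> (x - h)) (at x) = frechet_derivative \<psi> (at (x - h))" .
qed

lemma C1c_line_derivative:
  fixes \<psi> :: "'a::euclidean_space \<Rightarrow> real"
  assumes \<psi>: "\<psi> \<in> C1c"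
  shows "((\<lambda>t. \<psi> (x - t *\<^sub>R h)) has_real_derivative - frechet_derivative \<psi> (at (x - t *\<^sub>R h)) h) (at t)"
proof -
  have l: "linear (frechet_derivative \<psi> (at y))" for y
    using \<psi> by (simp add: C1c_def linear_frechet_derivative)
  have "((\<lambda>t. \<psi> (x - t *\<^sub>R h)) has_derivative (\<lambda>s. frechet_derivative \<psi> (at (x - t *\<^sub>R h)) (- (s *\<^sub>R h)))) (at t)"
    by (rule has_derivative_compose[where f = "\<lambda>t. x - t *\<^sub>R h" and f' = "\<lambda>s. - (s *\<^sub>R h)" and g = \<psi>])
      (auto intro!: derivative_eq_intros C1c_has_derivative[OF \<psi>])
  moreover have "(\<lambda>s. frechet_derivative \<psi> (at (x - t *\<^sub>R h)) (- (s *\<^sub>R h))) =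
      (*) (- frechet_derivative \<psi> (at (x - t *\<^sub>R h)) h)"
    by (simp add: fun_eq_iff linear_neg[OF l] linear_cmul[OF l])
  ultimately show ?thesis by (simp add: has_field_derivative_def)
qed

text \<open>The constant is uniform in \<open>x\<close>, which makes it a majorant for difference
  quotients of \<psi> under the integral.\<close>

lemma C1c_line_lipschitz:
  fixes \<psi> :: "'a::euclidean_space \<Rightarrow> real"
  assumes \<psi>: "\<psi> \<in> C1c"
  obtains B where "0 < B" "\<And>x t. \<bar>\<psi> (x - t *\<^sub>R h) - \<psi> x\<bar> \<le> B * \<bar>t\<bar>"
proof -
  obtain B where B: "0 < B" "\<And>x. norm (frechet_derivative \<psi> (at x) h) \<le> B"
    using C1c_derivative_bounded[OF \<psi>] by metis
  have "\<bar>\<psi> (x - t *\<^sub>R h) - \<psi> x\<bar> \<le> B * \<bar>t\<bar>" for x t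
    using field_differentiable_bound[OF convex_UNIV, where f = "\<lambda>t. \<psi> (x - t *\<^sub>R h)" and B = B and x = t and y = 0
      and f' = "\<lambda>t. - frechet_derivative \<psi> (at (x - t *\<^sub>R h)) h"] C1c_line_derivative[OF \<psi>] B
    by auto
  with B show thesis using that by blast
qed

text \<open>Dominated convergence, with all limits taken on the test function: its difference
  quotients are bounded by a Lipschitz constant and live in one common ball, on which f is
  integrable.\<close>

lemma difference_quotient_pairing:
  fixes f \<psi> :: "'a::euclidean_space \<Rightarrow> real"
  assumes p: "1 \<le> p" and f: "f \<in> Lp p" and \<psi>: "\<psi> \<in> C1c"
  shows "((\<lambda>t. \<integral>x. f x * ((\<psi> (x - t *\<^sub>R h) - \<psi> x) / t) \<partial>lebesgue)
    \<longlongrightarrow> - (\<integral>x. f x * frechet_derivative \<psi> (at x) h \<partial>lebesgue)) (at 0)"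
  unfolding tendsto_at_iff_sequentially comp_def
proof (intro allI impI)
  fix s :: "nat \<Rightarrow> real" assume s0: "\<forall>i. s i \<in> UNIV - {0}" and s: "s \<longlonglongrightarrow> 0"
  obtain S where S: "0 < S" "\<And>n. \<bar>s n\<bar> \<le> S"
    using s by (metis convergent_def convergent_imp_Bseq BseqE real_norm_def)
  obtain R where R: "0 < R" "\<And>x. \<psi> x \<noteq> 0 \<Longrightarrow> norm x \<le> R" using C1c_support[OF \<psi>] by metis
  obtain B where B: "0 < B" "\<And>x t. \<bar>\<psi> (x - t *\<^sub>R h) - \<psi> x\<bar> \<le> B * \<bar>t\<bar>"
    using C1c_line_lipschitz[OF \<psi>] by metis
  \<comment> \<open>The steps \<open>s n\<close> are bounded by \<open>S\<close>, so the ball of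
    radius \<open>Q\<close> contains the supports of \<psi> and of all its translates by
    \<open>s n *\<^sub>R h\<close>.\<close>
  define Q where "Q = R + S * norm h"
  have fm: "f \<in> borel_measurable lebesgue" using f by (auto simp: Lp_def)
  have "integrable lebesgue (\<lambda>x. f x * (B * indicator (cball 0 Q) x))"
  proof (rule Lp_integrable_mult[OF p f, where B = B and R = Q])
    show "(\<lambda>x. B * indicator (cball 0 Q) x) \<in> borel_measurable lebesgue"
      by (intro measurable_completion borel_measurable_times borel_measurable_indicator) auto
    show "\<bar>B * indicator (cball 0 Q) x\<bar> \<le> B" for x
      using B(1) by (cases "x \<in> cball 0 Q") auto
    show "norm x \<le> Q" if "B * indicator (cball 0 Q) x \<noteq> 0" for x
      using that by (cases "x \<in> cball 0 Q") auto
  qed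
  then have "integrable lebesgue (\<lambda>x. norm (f x * (B * indicator (cball 0 Q) x)))"
    by (rule integrable_norm)
  then have w: "integrable lebesgue (\<lambda>x. \<bar>f x\<bar> * (B * indicator (cball 0 Q) x))"
    using B(1) by (simp add: abs_mult)
  have "(\<lambda>n. \<integral>x. f x * ((\<psi> (x - s n *\<^sub>R h) - \<psi> x) / s n) \<partial>lebesgue)
      \<longlonglongrightarrow> (\<integral>x. f x * (- frechet_derivative \<psi> (at x) h) \<partial>lebesgue)"
  proof (rule integral_dominated_convergence[OF _ _ w])
    show "AE x in lebesgue. (\<lambda>n. f x * ((\<psi> (x - s n *\<^sub>R h) - \<psi> x) / s n)) \<longlonglongrightarrow> f x * (- frechet_derivative \<psi> (at x) h)"
    proof (rule AE_I2)
      fix x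
      have "((\<lambda>t. (\<psi> (x - t *\<^sub>R h) - \<psi> x) / t) \<longlongrightarrow> - frechet_derivative \<psi> (at x) h) (at 0)"
        using C1c_line_derivative[OF \<psi>, of x h 0] by (simp add: DERIV_def)
      moreover have "filterlim s (at 0) sequentially"
        using s s0 by (simp add: filterlim_at)
      ultimately have "(\<lambda>n. (\<psi> (x - s n *\<^sub>R h) - \<psi> x) / s n) \<longlonglongrightarrow> - frechet_derivative \<psi> (at x) h"
        by (rule filterlim_compose)
      then show "(\<lambda>n. f x * ((\<psi> (x - s n *\<^sub>R h) - \<psi> x) / s n)) \<longlonglongrightarrow> f x * (- frechet_derivative \<psi> (at x) h)"
        by (rule tendsto_mult_left)
    qed
    show "AE x in lebesgue. norm (f x * ((\<psi> (x - s n *\<^sub>R h) - \<psi> x) / s n)) \<le> \<bar>f x\<bar> * (B * indicator (cball 0 Q) x)" for n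
    proof (rule AE_I2)
      fix x
      have sn: "s n \<noteq> 0" using s0 by auto
      have q: "\<bar>(\<psi> (x - s n *\<^sub>R h) - \<psi> x) / s n\<bar> \<le> B"
        using B(2)[of x "s n"] sn by (simp add: abs_divide pos_divide_le_eq)
      have "(\<psi> (x - s n *\<^sub>R h) - \<psi> x) / s n = 0" if "x \<notin> cball 0 Q"
      proof -
        have sh: "norm (s n *\<^sub>R h) \<le> S * norm h" using S by (auto intro: mult_right_mono)
        have "norm x > R + S * norm h" using that by (simp add: Q_def)
        moreover have "norm x - norm (s n *\<^sub>R h) \<le> norm (x - s n *\<^sub>R h)" by (rule norm_triangle_ineq2)
        ultimately have "norm (x - s n *\<^sub>R h) > R" "norm x > R"
          using sh norm_ge_zero[of "s n *\<^sub>R h"] by linarith+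
        then have "\<psi> (x - s n *\<^sub>R h) = 0" "\<psi> x = 0" using R(2) by (meson not_le)+
        then show ?thesis by simp
      qed
      with q have "\<bar>(\<psi> (x - s n *\<^sub>R h) - \<psi> x) / s n\<bar> \<le> B * indicator (cball 0 Q) x"
        by (cases "x \<in> cball 0 Q") auto
      then show "norm (f x * ((\<psi> (x - s n *\<^sub>R h) - \<psi> x) / s n)) \<le> \<bar>f x\<bar> * (B * indicator (cball 0 Q) x)"
        unfolding real_norm_def abs_mult[of "f x"] by (intro mult_left_mono) auto
    qed
    show "(\<lambda>x. f x * (- frechet_derivative \<psi> (at x) h)) \<in> borel_measurable lebesgue"
      by (intro borel_measurable_times borel_measurable_uminus fm C1c_measurable[OF \<psi>])
    show "(\<lambda>x. f x * ((\<psi> (x - s n *\<^sub>R h) - \<psi> x) / s n)) \<in> borel_measurable lebesgue" for n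
      by (intro borel_measurable_times borel_measurable_divide borel_measurable_diff fm
          C1c_measurable(1)[OF \<psi>] C1c_measurable(1)[OF C1c_translate(1)[OF \<psi>]]) simp
  qed
  then show "(\<lambda>n. \<integral>x. f x * ((\<psi> (x - s n *\<^sub>R h) - \<psi> x) / s n) \<partial>lebesgue)
      \<longlonglongrightarrow> - (\<integral>x. f x * frechet_derivative \<psi> (at x) h \<partial>lebesgue)" by simp
qed

lemma translate_pairing:
  fixes f \<psi> :: "'a::euclidean_space \<Rightarrow> real"
  assumes f: "f \<in> Lp p" and \<psi>: "\<psi> \<in> C1c"
  shows "(\<integral>x. f (x + h) * \<psi> x \<partial>lebesgue) = (\<integral>x. f x * \<psi> (x - h) \<partial>lebesgue)"
proof -
  note [measurable] = C1c_measurable(1)[OF C1c_translate(1)[OF \<psi>]]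
  have [measurable]: "f \<in> borel_measurable lebesgue" using f by (auto simp: Lp_def)
  show ?thesis
    using integral_translate[of "\<lambda>x. f x * \<psi> (x - h)" h] by simp
qed

text \<open>The mean value theorem on [0,1] for F(s) = integral of f(x) \<psi>(x - s h). F is
  differentiable for every f in $L^p$ because \<open>s\<close> acts on \<psi> only. The intermediate
  point is unknown, hence the hypothesis for all \<open>s\<close>.\<close>

lemma translate_pairing_bound:
  fixes f \<psi> :: "'a::euclidean_space \<Rightarrow> real"
  assumes p: "1 \<le> p" and f: "f \<in> Lp p" and \<psi>: "\<psi> \<in> C1c"
    and B: "\<And>s. - (\<integral>x. f x * frechet_derivative \<psi> (at (x - s *\<^sub>R h)) h \<partial>lebesgue) \<le> B"
  shows "(\<integral>x. (f (x + h) - f x) * \<psi> x \<partial>lebesgue) \<le> B"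
proof -
  define F where "F s = (\<integral>x. f x * \<psi> (x - s *\<^sub>R h) \<partial>lebesgue)" for s
  have F: "(F has_real_derivative - (\<integral>x. f x * frechet_derivative \<psi> (at (x - s *\<^sub>R h)) h \<partial>lebesgue)) (at s)" for s
  proof -
    \<comment> \<open>Differentiability of F at \<open>s\<close> is differentiability at 0 for the
      test function already shifted by \<open>s *\<^sub>R h\<close>.\<close>
    note \<psi>s = C1c_translate(1)[OF \<psi>, of "s *\<^sub>R h"]
    have eq: "(F (s + t) - F s) / t = (\<integral>x. f x * ((\<psi> (x - t *\<^sub>R h - s *\<^sub>R h) - \<psi> (x - s *\<^sub>R h)) / t) \<partial>lebesgue)" for t
    proof -
      have "F (s + t) - F s = (\<integral>x. f x * \<psi> (x - (s + t) *\<^sub>R h) - f x * \<psi> (x - s *\<^sub>R h) \<partial>lebesgue)"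
        unfolding F_def
        by (rule Bochner_Integration.integral_diff[symmetric]; rule C1c_integrable_mult(1)[OF p f]; rule C1c_translate(1)[OF \<psi>])
      then have "(F (s + t) - F s) / t = (\<integral>x. (f x * \<psi> (x - (s + t) *\<^sub>R h) - f x * \<psi> (x - s *\<^sub>R h)) / t \<partial>lebesgue)"
        by simp
      also have "\<dots> = (\<integral>x. f x * ((\<psi> (x - t *\<^sub>R h - s *\<^sub>R h) - \<psi> (x - s *\<^sub>R h)) / t) \<partial>lebesgue)"
        by (intro Bochner_Integration.integral_cong) (auto simp: algebra_simps diff_divide_distrib)
      finally show ?thesis .
    qed
    show ?thesis
      unfolding DERIV_def eq
      using difference_quotient_pairing[OF p f \<psi>s, of h] by (simp add: C1c_translate(2)[OF \<psi>])
  qed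
  obtain z where "F 1 - F 0 = (1 - 0) * - (\<integral>x. f x * frechet_derivative \<psi> (at (x - z *\<^sub>R h)) h \<partial>lebesgue)"
    using MVT2[of 0 1 F "\<lambda>s. - (\<integral>x. f x * frechet_derivative \<psi> (at (x - s *\<^sub>R h)) h \<partial>lebesgue)"] F by auto
  then have "F 1 - F 0 \<le> B" using B[of z] by simp
  also have "F 1 - F 0 = (\<integral>x. f (x + h) * \<psi> x \<partial>lebesgue) - (\<integral>x. f x * \<psi> x \<partial>lebesgue)"
    unfolding translate_pairing[OF f \<psi>] by (simp add: F_def)
  also have "\<dots> = (\<integral>x. f (x + h) * \<psi> x - f x * \<psi> x \<partial>lebesgue)"
    using C1c_integrable_mult(1)[OF p f \<psi>] C1c_integrable_mult(1)[OF p Lp_translate[OF f] \<psi>]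
    by (intro Bochner_Integration.integral_diff[symmetric])
  finally show ?thesis by (simp add: left_diff_distrib)
qed

section \<open>Approximation by test functions and duality\<close>

text \<open>Unlike in \<open>C1c\<close> there is no support condition, so polynomials qualify and
  sums, products and compositions stay inside; compact support is restored by a cut-off. The
  derivative is existential so that each calculus rule can supply it.\<close>

definition C1 :: "('a::euclidean_space \<Rightarrow> real) \<Rightarrow> bool" where
  "C1 f \<longleftrightarrow> (\<exists>D. (\<forall>x. (f has_derivative D x) (at x)) \<and> (\<forall>v. continuous_on UNIV (\<lambda>x. D x v)))"

lemma C1_continuous: "C1 f \<Longrightarrow> continuous_on UNIV f"
  unfolding C1_def continuous_on_eq_continuous_at[OF open_UNIV] using has_derivative_continuous by blast

lemma C1_C1c: "C1 f \<Longrightarrow> bounded {x. f x \<noteq> 0} \<Longrightarrow> f \<in> C1c"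
  unfolding C1_def using C1cI(1) by blast

lemma C1_const: "C1 (\<lambda>x. c)"
  unfolding C1_def by (intro exI[of _ "\<lambda>_ _. 0"]) auto

lemma C1_bounded_linear: "bounded_linear f \<Longrightarrow> C1 f"
  unfolding C1_def by (intro exI[of _ "\<lambda>_. f"]) (auto intro: bounded_linear_imp_has_derivative)

lemma C1_add:
  assumes "C1 f" "C1 g"
  shows "C1 (\<lambda>x. f x + g x)"
proof -
  obtain F G where "\<And>x. (f has_derivative F x) (at x)" "\<And>v. continuous_on UNIV (\<lambda>x. F x v)"
    "\<And>x. (g has_derivative G x) (at x)" "\<And>v. continuous_on UNIV (\<lambda>x. G x v)"
    using assms unfolding C1_def by metis
  then show ?thesis unfolding C1_def
    by (intro exI[of _ "\<lambda>x v. F x v + G x v"]) (auto intro: continuous_on_add has_derivative_add)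
qed

lemma C1_mult:
  assumes "C1 f" "C1 g"
  shows "C1 (\<lambda>x. f x * g x)"
proof -
  obtain F G where "\<And>x. (f has_derivative F x) (at x)" "\<And>v. continuous_on UNIV (\<lambda>x. F x v)"
    "\<And>x. (g has_derivative G x) (at x)" "\<And>v. continuous_on UNIV (\<lambda>x. G x v)"
    using assms unfolding C1_def by metis
  note FG = this
  show ?thesis unfolding C1_def
    by (intro exI[of _ "\<lambda>x v. f x * G x v + F x v * g x"] conjI allI has_derivative_mult FG
        continuous_on_add continuous_on_mult C1_continuous[OF assms(1)] C1_continuous[OF assms(2)])
qed

lemma C1_compose:
  assumes f: "C1 f" and m: "\<And>y. (m has_real_derivative m' y) (at y)" "continuous_on UNIV m'"
  shows "C1 (\<lambda>x. m (f x))"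
proof -
  obtain F where F: "\<And>x. (f has_derivative F x) (at x)" "\<And>v. continuous_on UNIV (\<lambda>x. F x v)"
    using f unfolding C1_def by metis
  have "((\<lambda>x. m (f x)) has_derivative (\<lambda>v. m' (f x) * F x v)) (at x)" for x
    by (rule has_derivative_compose[OF F(1)]) (use m(1) in \<open>simp add: has_field_derivative_def\<close>)
  moreover have "continuous_on UNIV (\<lambda>x. m' (f x) * F x v)" for v
    by (intro continuous_on_mult F(2) continuous_on_compose2[OF m(2) C1_continuous[OF f]]) auto
  ultimately show ?thesis unfolding C1_def
    by (intro exI[of _ "\<lambda>x v. m' (f x) * F x v"]) auto
qed

lemma C1_real_polynomial_function:
  fixes P :: "'a::euclidean_space \<Rightarrow> real"
  shows "real_polynomial_function P \<Longrightarrow> C1 P"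
  by (induction rule: real_polynomial_function.induct)
    (auto intro: C1_const C1_bounded_linear C1_add C1_mult)

text \<open>The square of the positive part is a $C^1$ function that vanishes on a half-line; as
  test functions are only $C^1$, it can replace a smooth bump in building cut-offs.\<close>

lemma has_derivative_pos_part_square:
  "((\<lambda>s. (max 0 s)\<^sup>2) has_real_derivative 2 * max 0 s) (at s)"
proof -
  consider "0 < s" | "s < 0" | "s = 0" by linarith
  then show ?thesis
  proof cases
    case 1
    have "((\<lambda>s. s\<^sup>2) has_real_derivative 2 * max 0 s) (at s)"
      using 1 by (auto intro!: derivative_eq_intros)
    then show ?thesis
      by (rule has_field_derivative_transform_within_open[where S = "{0<..}"]) (use 1 in auto)
  next
    case 2
    have "((\<lambda>s. 0) has_real_derivative 2 * max 0 s) (at s)"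
      using 2 by (auto intro!: derivative_eq_intros)
    then show ?thesis
      by (rule has_field_derivative_transform_within_open[where S = "{..<0}"]) (use 2 in auto)
  next
    case 3
    have "(\<lambda>h. ((max 0 (0 + h))\<^sup>2 - (max 0 0)\<^sup>2) / h) = (\<lambda>h::real. max 0 h)"
      by (auto simp: fun_eq_iff max_def power2_eq_square)
    moreover have "((\<lambda>h::real. max 0 h) \<longlongrightarrow> max 0 0) (at 0)"
      by (intro tendsto_intros)
    ultimately show ?thesis using 3 unfolding DERIV_def by simp
  qed
qed

lemma C1_cutoff:
  fixes R :: real
  assumes R: "0 \<le> R"
  obtains \<zeta> :: "'a::euclidean_space \<Rightarrow> real" where "C1 \<zeta>" "\<And>x. 0 \<le> \<zeta> x" "\<And>x. \<zeta> x \<le> 1"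
    "\<And>x. norm x \<le> R \<Longrightarrow> \<zeta> x = 1" "\<And>x. \<zeta> x \<noteq> 0 \<Longrightarrow> norm x \<le> R + 1"
proof -
  define m :: "real \<Rightarrow> real" where "m s = (max 0 s)\<^sup>2" for s
  \<comment> \<open>With m the square of the positive part, this is m(1 - m(|x|^2 - R^2)). The inner
    m is 0 for |x| <= R, and it is at least 1 for |x| >= R + 1 because (R + 1)^2 - R^2 = 2 R + 1 >=
    1.\<close>
  define \<zeta> :: "'a \<Rightarrow> real" where "\<zeta> x = m (1 + (-1) * m (x \<bullet> x + - R\<^sup>2))" for x
  have m: "C1 f \<Longrightarrow> C1 (\<lambda>x. m (f x))" for f :: "'a \<Rightarrow> real"
    unfolding m_def by (rule C1_compose[where m' = "\<lambda>s. 2 * max 0 s"])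
      (auto intro!: has_derivative_pos_part_square continuous_intros)
  have "C1 (\<lambda>x::'a. x \<bullet> x)"
  proof -
    have "((\<lambda>x::'a. x \<bullet> x) has_derivative (\<lambda>v. x \<bullet> v + v \<bullet> x)) (at x)" for x
      by (auto intro!: derivative_eq_intros)
    then show ?thesis unfolding C1_def
      by (intro exI[of _ "\<lambda>x v. x \<bullet> v + v \<bullet> x"]) (auto intro!: continuous_intros)
  qed
  then have "C1 \<zeta>" unfolding \<zeta>_def by (intro m C1_add C1_mult C1_const)
  moreover have "0 \<le> \<zeta> x" for x by (simp add: \<zeta>_def m_def)
  moreover have "\<zeta> x \<le> 1" for x unfolding \<zeta>_def m_def
    by (auto simp: power_le_one max_def)
  moreover have "\<zeta> x = 1" if "norm x \<le> R" for x
  proof -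
    have "x \<bullet> x \<le> R\<^sup>2" using that by (simp add: dot_square_norm power_mono)
    then show ?thesis by (simp add: \<zeta>_def m_def)
  qed
  moreover have "norm x \<le> R + 1" if "\<zeta> x \<noteq> 0" for x
  proof (rule ccontr)
    assume "\<not> norm x \<le> R + 1"
    then have "(R + 1)\<^sup>2 \<le> x \<bullet> x" using R by (simp add: dot_square_norm power_mono)
    then have "1 \<le> x \<bullet> x - R\<^sup>2" using R by (simp add: power2_sum)
    then have "1 \<le> m (x \<bullet> x - R\<^sup>2)" by (simp add: m_def one_le_power)
    then have "\<zeta> x = 0" by (simp add: \<zeta>_def m_def[of "1 - _"])
    with that show False by simp
  qed
  ultimately show thesis by (rule that)
qed

text \<open>A measurable function is an a.e. limit of continuous ones; these are clipped to [-M, M],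
  replaced by Weierstrass polynomials on a ball and cut off. Keeping exactly the bound
  \<open>M\<close> matters, since total variation only admits test functions bounded by 1.\<close>

lemma C1c_approximation:
  fixes \<theta> :: "'a::euclidean_space \<Rightarrow> real"
  assumes \<theta>: "\<theta> \<in> borel_measurable lebesgue" and M: "0 < M" "\<And>x. \<bar>\<theta> x\<bar> \<le> M"
    and R: "0 \<le> R" "\<And>x. \<theta> x \<noteq> 0 \<Longrightarrow> norm x \<le> R"
  obtains \<psi> :: "nat \<Rightarrow> 'a \<Rightarrow> real" where "\<And>n. \<psi> n \<in> C1c" "\<And>n x. \<bar>\<psi> n x\<bar> \<le> M"
    "\<And>n x. \<psi> n x \<noteq> 0 \<Longrightarrow> norm x \<le> R + 1" "AE x in lebesgue. (\<lambda>n. \<psi> n x) \<longlonglongrightarrow> \<theta> x"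
proof -
  obtain \<zeta> :: "'a \<Rightarrow> real" where \<zeta>: "C1 \<zeta>" "\<And>x. 0 \<le> \<zeta> x" "\<And>x. \<zeta> x \<le> 1"
    "\<And>x. norm x \<le> R \<Longrightarrow> \<zeta> x = 1" "\<And>x. \<zeta> x \<noteq> 0 \<Longrightarrow> norm x \<le> R + 1"
    using C1_cutoff[OF R(1)] by metis
  have "\<theta> measurable_on UNIV" using \<theta> by (intro lebesgue_measurable_imp_measurable_on) auto
  then obtain N g where N: "negligible N" and g: "\<And>n. continuous_on UNIV (g n)"
    and lim: "\<And>x. x \<notin> N \<Longrightarrow> (\<lambda>n. g n x) \<longlonglongrightarrow> \<theta> x"
    unfolding measurable_on_def by auto
  define a where "a n = 1 / real (Suc n)" for n
  have a: "0 < a n" "a n \<le> 1" for n by (auto simp: a_def)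
  \<comment> \<open>Shrinking by 1 - \<open>a n\<close> leaves room for the polynomial error
    \<open>M * a n\<close>, so the approximants do not exceed \<open>M\<close>.\<close>
  define k where "k n x = (1 - a n) * max (- M) (min M (g n x))" for n x
  have "\<exists>P. real_polynomial_function P \<and> (\<forall>x\<in>cball 0 (R + 1). \<bar>k n x - P x\<bar> < M * a n)" for n
    by (rule Stone_Weierstrass_real_polynomial_function[of "cball 0 (R + 1)" "k n" "M * a n"])
      (use M a in \<open>auto simp: k_def intro!: continuous_intros continuous_on_subset[OF g]\<close>)
  then obtain P where P: "\<And>n. real_polynomial_function (P n)"
    "\<And>n x. norm x \<le> R + 1 \<Longrightarrow> \<bar>k n x - P n x\<bar> < M * a n"
    by (metis dist_0_norm mem_cball)
  have kM: "\<bar>k n x\<bar> \<le> M * (1 - a n)" for n x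
  proof -
    have "\<bar>max (- M) (min M (g n x))\<bar> \<le> M" using M(1) by auto
    then show ?thesis using a[of n] unfolding k_def abs_mult
      by (subst mult.commute) (intro mult_mono, auto)
  qed
  have close: "\<bar>\<zeta> x * P n x - \<zeta> x * k n x\<bar> \<le> M * a n" for n x
  proof (cases "\<zeta> x = 0")
    case True then show ?thesis using M a[of n] by simp
  next
    case False
    then have "\<bar>P n x - k n x\<bar> \<le> M * a n" using P(2)[of x n] \<zeta>(5) by fastforce
    then have "\<zeta> x * \<bar>P n x - k n x\<bar> \<le> 1 * (M * a n)" using \<zeta> by (intro mult_mono) auto
    then show ?thesis using \<zeta>(2)[of x] by (simp flip: right_diff_distrib add: abs_mult)
  qed
  show thesis
  proof
    fix n :: nat and x :: 'a
    have "{x. \<zeta> x * P n x \<noteq> 0} \<subseteq> cball 0 (R + 1)" using \<zeta>(5) by auto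
    then have "bounded {x. \<zeta> x * P n x \<noteq> 0}" by (rule bounded_subset[OF bounded_cball])
    then show "(\<lambda>x. \<zeta> x * P n x) \<in> C1c"
      by (intro C1_C1c C1_mult \<zeta> C1_real_polynomial_function P)
    show "\<zeta> x * P n x \<noteq> 0 \<Longrightarrow> norm x \<le> R + 1" using \<zeta>(5) by auto
    have "\<bar>\<zeta> x * k n x\<bar> \<le> 1 * (M * (1 - a n))"
      unfolding abs_mult using \<zeta>(2,3)[of x] kM[of n x] by (intro mult_mono) auto
    with close[of x n] show "\<bar>\<zeta> x * P n x\<bar> \<le> M" by (simp add: algebra_simps)
  next
    have "AE x in lebesgue. x \<notin> N"
      using N by (auto simp: negligible_iff_null_sets intro: AE_not_in)
    then show "AE x in lebesgue. (\<lambda>n. \<zeta> x * P n x) \<longlonglongrightarrow> \<theta> x"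
    proof (rule AE_mp, intro AE_I2 impI)
      fix x assume "x \<notin> N"
      have a0: "a \<longlonglongrightarrow> 0" unfolding a_def by (rule LIMSEQ_Suc[OF lim_1_over_n])
      have "(\<lambda>n. \<zeta> x * k n x) \<longlonglongrightarrow> \<zeta> x * ((1 - 0) * max (- M) (min M (\<theta> x)))"
        unfolding k_def by (intro tendsto_intros a0 lim \<open>x \<notin> N\<close>)
      moreover have "(\<lambda>n. \<zeta> x * P n x - \<zeta> x * k n x) \<longlonglongrightarrow> 0"
      proof (rule Lim_null_comparison)
        show "\<forall>\<^sub>F n in sequentially. norm (\<zeta> x * P n x - \<zeta> x * k n x) \<le> M * a n" using close by simp
        show "(\<lambda>n. M * a n) \<longlonglongrightarrow> 0" using tendsto_mult_left[OF a0, of M] by simp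
      qed
      ultimately have "(\<lambda>n. (\<zeta> x * P n x - \<zeta> x * k n x) + \<zeta> x * k n x)
          \<longlonglongrightarrow> 0 + \<zeta> x * ((1 - 0) * max (- M) (min M (\<theta> x)))"
        by (rule tendsto_add[rotated])
      moreover have "max (- M) (min M (\<theta> x)) = \<theta> x" using M(2)[of x] by auto
      moreover have "\<zeta> x * \<theta> x = \<theta> x" using R(2)[of x] \<zeta>(4)[of x] by (cases "\<theta> x = 0") auto
      ultimately show "(\<lambda>n. \<zeta> x * P n x) \<longlonglongrightarrow> \<theta> x" by simp
    qed
  qed
qed

text \<open>Bounded convergence a.e. on a common ball passes to both integrals that occur in testing
  inequalities: the pairing with \<open>u\<close> and the q-th power of the norm.\<close>

lemma C1c_approximation_pairing:
  fixes u \<theta> :: "'a::euclidean_space \<Rightarrow> real"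
  assumes p: "1 \<le> p" and u: "u \<in> Lp p" and q: "0 < q"
    and \<theta>: "\<theta> \<in> borel_measurable lebesgue" and M: "0 < M" "\<And>x. \<bar>\<theta> x\<bar> \<le> M"
    and R: "0 \<le> R" "\<And>x. \<theta> x \<noteq> 0 \<Longrightarrow> norm x \<le> R"
  obtains \<psi> :: "nat \<Rightarrow> 'a \<Rightarrow> real" where "\<And>n. \<psi> n \<in> C1c" "\<And>n x. \<bar>\<psi> n x\<bar> \<le> M"
    "(\<lambda>n. \<integral>x. u x * \<psi> n x \<partial>lebesgue) \<longlonglongrightarrow> (\<integral>x. u x * \<theta> x \<partial>lebesgue)"
    "(\<lambda>n. \<integral>x. \<bar>\<psi> n x\<bar> powr q \<partial>lebesgue) \<longlonglongrightarrow> (\<integral>x. \<bar>\<theta> x\<bar> powr q \<partial>lebesgue)"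
proof -
  obtain \<psi> :: "nat \<Rightarrow> 'a \<Rightarrow> real" where \<psi>: "\<And>n. \<psi> n \<in> C1c" "\<And>n x. \<bar>\<psi> n x\<bar> \<le> M"
    "\<And>n x. \<psi> n x \<noteq> 0 \<Longrightarrow> norm x \<le> R + 1" and ae: "AE x in lebesgue. (\<lambda>n. \<psi> n x) \<longlonglongrightarrow> \<theta> x"
    using C1c_approximation[OF \<theta> M R] by metis
  have um: "u \<in> borel_measurable lebesgue" using u by (auto simp: Lp_def)
  define I :: "'a \<Rightarrow> real" where "I = indicator (cball 0 (R + 1))"
  have Im: "I \<in> borel_measurable lebesgue"
    unfolding I_def by (intro measurable_completion borel_measurable_indicator) auto
  have \<psi>I: "\<bar>\<psi> n x\<bar> \<le> M * I x" for n x
    using \<psi>(2,3)[where n = n and x = x] by (cases "x \<in> cball 0 (R + 1)") (auto simp: I_def)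
  have "integrable lebesgue (\<lambda>x. u x * (M * I x))"
  proof (rule Lp_integrable_mult[OF p u, where B = M and R = "R + 1"])
    show "(\<lambda>x. M * I x) \<in> borel_measurable lebesgue" by (intro borel_measurable_times Im) simp
    show "\<bar>M * I x\<bar> \<le> M" for x using M(1) by (cases "x \<in> cball 0 (R + 1)") (auto simp: I_def)
    show "norm x \<le> R + 1" if "M * I x \<noteq> 0" for x
      using that by (cases "x \<in> cball 0 (R + 1)") (auto simp: I_def)
  qed
  then have w: "integrable lebesgue (\<lambda>x. norm (u x * (M * I x)))" by (rule integrable_norm)
  have "integrable lebesgue I"
    using lmeasurable_cball[of 0 "R + 1"] unfolding I_def by (simp add: fmeasurable_def integrable_indicator_iff)
  then have w2: "integrable lebesgue (\<lambda>x. M powr q * I x)" by simp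
  show thesis
  proof (rule that[OF \<psi>(1,2)])
    show "(\<lambda>n. \<integral>x. u x * \<psi> n x \<partial>lebesgue) \<longlonglongrightarrow> (\<integral>x. u x * \<theta> x \<partial>lebesgue)"
    proof (rule integral_dominated_convergence[OF _ _ w])
      show "AE x in lebesgue. (\<lambda>n. u x * \<psi> n x) \<longlonglongrightarrow> u x * \<theta> x"
        using ae by eventually_elim (rule tendsto_mult_left)
      show "AE x in lebesgue. norm (u x * \<psi> n x) \<le> norm (u x * (M * I x))" for n
      proof (rule AE_I2)
        fix x show "norm (u x * \<psi> n x) \<le> norm (u x * (M * I x))"
          unfolding real_norm_def abs_mult[of "u x"]
          by (intro mult_left_mono order_trans[OF \<psi>I abs_ge_self]) simp
      qed
    qed (intro borel_measurable_times um \<theta> C1c_measurable(1)[OF \<psi>(1)])+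
    show "(\<lambda>n. \<integral>x. \<bar>\<psi> n x\<bar> powr q \<partial>lebesgue) \<longlonglongrightarrow> (\<integral>x. \<bar>\<theta> x\<bar> powr q \<partial>lebesgue)"
    proof (rule integral_dominated_convergence[OF _ _ w2])
      show "AE x in lebesgue. (\<lambda>n. \<bar>\<psi> n x\<bar> powr q) \<longlonglongrightarrow> \<bar>\<theta> x\<bar> powr q"
        using ae
      proof eventually_elim
        case (elim x)
        show ?case
          by (rule tendsto_powr2[OF tendsto_rabs[OF elim] tendsto_const]) (use q in auto)
      qed
      show "AE x in lebesgue. norm (\<bar>\<psi> n x\<bar> powr q) \<le> M powr q * I x" for n
      proof (rule AE_I2)
        fix x
        show "norm (\<bar>\<psi> n x\<bar> powr q) \<le> M powr q * I x"
        proof (cases "x \<in> cball 0 (R + 1)")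
          case True
          then show ?thesis using \<psi>(2)[of n x] q by (auto simp: I_def intro: powr_mono2)
        next
          case False
          then have "\<psi> n x = 0" using \<psi>(3)[of n x] by auto
          then show ?thesis by (simp add: I_def)
        qed
      qed
    qed (intro powr_real_measurable borel_measurable_abs \<theta> C1c_measurable(1)[OF \<psi>(1)] borel_measurable_const)+
  qed
qed

section \<open>Dual description of $L^p$ norms\<close>

lemma nn_integral_eq_integral_abs_powr:
  assumes "u \<in> Lp p"
  shows "(\<integral>\<^sup>+x. ennreal (\<bar>u x\<bar> powr p) \<partial>lebesgue) = ennreal (\<integral>x. \<bar>u x\<bar> powr p \<partial>lebesgue)"
  using assms by (intro nn_integral_eq_integral) (auto simp: Lp_def)

text \<open>Cutting off both large values of \<open>u\<close> and large \<open>x\<close> makes the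
  extremal test functions below bounded and boundedly supported, as the approximation by $C^1_c$
  functions requires.\<close>

definition truncation :: "('a::euclidean_space \<Rightarrow> real) \<Rightarrow> nat \<Rightarrow> 'a \<Rightarrow> real" where
  "truncation u n x = indicator {x. \<bar>u x\<bar> \<le> real n \<and> norm x \<le> real n} x"

lemma truncation_measurable:
  assumes [measurable]: "u \<in> borel_measurable lebesgue"
  shows "truncation u n \<in> borel_measurable lebesgue"
proof -
  have "{x \<in> space lebesgue. \<bar>u x\<bar> \<le> real n} \<in> sets lebesgue" by measurable
  then have "{x. \<bar>u x\<bar> \<le> real n} \<in> sets lebesgue" by simp
  moreover have "cball 0 (real n) \<in> sets lebesgue" by simp
  ultimately have "{x. \<bar>u x\<bar> \<le> real n} \<inter> cball 0 (real n) \<in> sets lebesgue" by (rule sets.Int)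
  moreover have "{x. \<bar>u x\<bar> \<le> real n} \<inter> cball 0 (real n) = {x. \<bar>u x\<bar> \<le> real n \<and> norm x \<le> real n}" by auto
  ultimately show ?thesis unfolding truncation_def by simp
qed

lemma Lp_bound_by_truncation:
  assumes u: "u \<in> Lp p" and A: "\<And>n. (\<integral>x. \<bar>u x\<bar> powr p * truncation u n x \<partial>lebesgue) \<le> A"
  shows "(\<integral>x. \<bar>u x\<bar> powr p \<partial>lebesgue) \<le> A"
proof -
  have um: "u \<in> borel_measurable lebesgue" and ui: "integrable lebesgue (\<lambda>x. \<bar>u x\<bar> powr p)"
    using u by (auto simp: Lp_def)
  have upm: "(\<lambda>x. \<bar>u x\<bar> powr p) \<in> borel_measurable lebesgue" using ui by simp
  have "(\<lambda>n. \<integral>x. \<bar>u x\<bar> powr p * truncation u n x \<partial>lebesgue) \<longlonglongrightarrow> (\<integral>x. \<bar>u x\<bar> powr p \<partial>lebesgue)"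
  proof (rule integral_dominated_convergence[OF _ _ ui])
    show "(\<lambda>x. \<bar>u x\<bar> powr p * truncation u n x) \<in> borel_measurable lebesgue" for n
      by (intro borel_measurable_times upm truncation_measurable um)
    show "AE x in lebesgue. (\<lambda>n. \<bar>u x\<bar> powr p * truncation u n x) \<longlonglongrightarrow> \<bar>u x\<bar> powr p"
    proof (rule AE_I2)
      fix x
      have "\<forall>\<^sub>F n in sequentially. truncation u n x = 1"
      proof (rule eventually_sequentiallyI)
        fix n assume "nat \<lceil>max \<bar>u x\<bar> (norm x)\<rceil> \<le> n"
        then have "max \<bar>u x\<bar> (norm x) \<le> real n" by linarith
        then show "truncation u n x = 1" by (simp add: truncation_def)
      qed
      then show "(\<lambda>n. \<bar>u x\<bar> powr p * truncation u n x) \<longlonglongrightarrow> \<bar>u x\<bar> powr p"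
        by (intro tendsto_eventually) (auto elim: eventually_mono)
    qed
    show "AE x in lebesgue. norm (\<bar>u x\<bar> powr p * truncation u n x) \<le> \<bar>u x\<bar> powr p" for n
      by (rule AE_I2) (auto simp: truncation_def indicator_def)
  qed (rule upm)
  then show ?thesis by (rule LIMSEQ_le_const2) (use A in auto)
qed

text \<open>The extremal test function is the truncated sign of \<open>u\<close>; its $C^1_c$
  approximants are still bounded by 1.\<close>

lemma L1_norm_le_testing:
  fixes u :: "'a::euclidean_space \<Rightarrow> real"
  assumes u: "u \<in> Lp 1"
    and A: "\<And>\<psi>. \<psi> \<in> C1c \<Longrightarrow> (\<And>x. \<bar>\<psi> x\<bar> \<le> 1) \<Longrightarrow> (\<integral>x. u x * \<psi> x \<partial>lebesgue) \<le> A"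
  shows "(\<integral>x. \<bar>u x\<bar> powr 1 \<partial>lebesgue) \<le> A"
proof (rule Lp_bound_by_truncation[OF u])
  fix n
  have um: "u \<in> borel_measurable lebesgue" using u by (auto simp: Lp_def)
  define \<theta> where "\<theta> x = sgn (u x) * truncation u n x" for x
  have \<theta>m: "\<theta> \<in> borel_measurable lebesgue"
    unfolding \<theta>_def by (intro borel_measurable_times truncation_measurable um measurable_compose[OF um borel_measurable_sgn])
  obtain \<psi> :: "nat \<Rightarrow> 'a \<Rightarrow> real" where \<psi>: "\<And>n. \<psi> n \<in> C1c" "\<And>n x. \<bar>\<psi> n x\<bar> \<le> 1"
    "(\<lambda>n. \<integral>x. u x * \<psi> n x \<partial>lebesgue) \<longlonglongrightarrow> (\<integral>x. u x * \<theta> x \<partial>lebesgue)"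
  proof (rule C1c_approximation_pairing[OF order_refl u zero_less_one \<theta>m zero_less_one])
    show "\<bar>\<theta> x\<bar> \<le> 1" for x by (auto simp: \<theta>_def truncation_def indicator_def sgn_if)
    show "\<theta> x \<noteq> 0 \<Longrightarrow> norm x \<le> real n" for x by (auto simp: \<theta>_def truncation_def indicator_def split: if_splits)
  qed (use that in auto)
  have "(\<integral>x. u x * \<theta> x \<partial>lebesgue) \<le> A"
    by (rule LIMSEQ_le_const2[OF \<psi>(3)]) (use A \<psi> in auto)
  moreover have "u x * \<theta> x = \<bar>u x\<bar> powr 1 * truncation u n x" for x
    by (auto simp: \<theta>_def sgn_if)
  ultimately show "(\<integral>x. \<bar>u x\<bar> powr 1 * truncation u n x \<partial>lebesgue) \<le> A" by simp
qed

text \<open>Take for \<psi> the truncated sgn(u) |u|^(p-1). As (p - 1) q = p, pairing and penalty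
  are both the truncated integral X of |u|^p, so X <= A + X/q, that is X/p <= A. Test functions need
  not be normalised.\<close>

lemma Lp_norm_le_testing:
  fixes u :: "'a::euclidean_space \<Rightarrow> real"
  assumes pq: "1 < p" "1 < q" "1 / p + 1 / q = 1" and u: "u \<in> Lp p"
    and A: "\<And>\<psi>. \<psi> \<in> C1c \<Longrightarrow> (\<integral>x. u x * \<psi> x \<partial>lebesgue) \<le> A + (\<integral>x. \<bar>\<psi> x\<bar> powr q \<partial>lebesgue) / q"
  shows "(\<integral>x. \<bar>u x\<bar> powr p \<partial>lebesgue) \<le> p * A"
proof (rule Lp_bound_by_truncation[OF u])
  fix n
  have um: "u \<in> borel_measurable lebesgue" using u by (auto simp: Lp_def)
  have pq': "(p - 1) * q = p" using pq by (simp add: field_simps)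
  define \<theta> where "\<theta> x = sgn (u x) * \<bar>u x\<bar> powr (p - 1) * truncation u n x" for x
  have \<theta>m: "\<theta> \<in> borel_measurable lebesgue"
    unfolding \<theta>_def
    by (intro borel_measurable_times truncation_measurable um measurable_compose[OF um borel_measurable_sgn] powr_real_measurable
        borel_measurable_abs borel_measurable_const)
  obtain \<psi> :: "nat \<Rightarrow> 'a \<Rightarrow> real" where \<psi>: "\<And>n. \<psi> n \<in> C1c"
    "(\<lambda>n. \<integral>x. u x * \<psi> n x \<partial>lebesgue) \<longlonglongrightarrow> (\<integral>x. u x * \<theta> x \<partial>lebesgue)"
    "(\<lambda>n. \<integral>x. \<bar>\<psi> n x\<bar> powr q \<partial>lebesgue) \<longlonglongrightarrow> (\<integral>x. \<bar>\<theta> x\<bar> powr q \<partial>lebesgue)"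
  \<comment> \<open>The summand 1 keeps the bound positive for n = 0, where
    \<open>real n powr (p - 1)\<close> is 0.\<close>
  proof (rule C1c_approximation_pairing[OF _ u _ \<theta>m, of q "real n powr (p - 1) + 1" "real n"])
    show "\<bar>\<theta> x\<bar> \<le> real n powr (p - 1) + 1" for x
    proof (cases "\<bar>u x\<bar> \<le> real n \<and> norm x \<le> real n")
      case True
      then have "\<bar>u x\<bar> powr (p - 1) \<le> real n powr (p - 1)" using pq by (intro powr_mono2) auto
      then show ?thesis using True by (auto simp: \<theta>_def truncation_def sgn_if)
    qed (auto simp: \<theta>_def truncation_def add_nonneg_nonneg)
    show "0 < real n powr (p - 1) + 1" by (simp add: add_nonneg_pos)
    show "\<theta> x \<noteq> 0 \<Longrightarrow> norm x \<le> real n" for x by (auto simp: \<theta>_def truncation_def indicator_def split: if_splits)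
  qed (use pq that in auto)
  have "(\<integral>x. u x * \<theta> x \<partial>lebesgue) \<le> A + (\<integral>x. \<bar>\<theta> x\<bar> powr q \<partial>lebesgue) / q"
  proof (rule LIMSEQ_le[OF \<psi>(2)])
    show "(\<lambda>n. A + (\<integral>x. \<bar>\<psi> n x\<bar> powr q \<partial>lebesgue) / q) \<longlonglongrightarrow> A + (\<integral>x. \<bar>\<theta> x\<bar> powr q \<partial>lebesgue) / q"
      using pq by (intro tendsto_intros \<psi>(3)) auto
  qed (use A \<psi>(1) in auto)
  moreover have "u x * \<theta> x = \<bar>u x\<bar> powr p * truncation u n x" for x
  proof -
    have "\<bar>u x\<bar> * \<bar>u x\<bar> powr (p - 1) = \<bar>u x\<bar> powr p"
      using powr_mult_base[of "\<bar>u x\<bar>" "p - 1"] by simp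
    moreover have "u x * \<theta> x = \<bar>u x\<bar> * \<bar>u x\<bar> powr (p - 1) * truncation u n x"
      by (auto simp: \<theta>_def sgn_if)
    ultimately show ?thesis by simp
  qed
  moreover have "\<bar>\<theta> x\<bar> powr q = \<bar>u x\<bar> powr p * truncation u n x" for x
    using pq by (auto simp: \<theta>_def truncation_def indicator_def abs_mult sgn_if powr_powr pq')
  ultimately have *: "(\<integral>x. \<bar>u x\<bar> powr p * truncation u n x \<partial>lebesgue) \<le> A + (\<integral>x. \<bar>u x\<bar> powr p * truncation u n x \<partial>lebesgue) / q"
    by simp
  have q1: "1 / q = 1 - 1 / p" using pq by simp
  have "X \<le> A + X / q \<Longrightarrow> X \<le> p * A" for X
  proof -
    assume "X \<le> A + X / q"
    then have "X \<le> A + X * (1 - 1 / p)" using q1 by (simp add: divide_inverse)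
    then show "X \<le> p * A" using pq by (simp add: field_simps)
  qed
  from this[OF *] show "(\<integral>x. \<bar>u x\<bar> powr p * truncation u n x \<partial>lebesgue) \<le> p * A" .
qed

section \<open>Translation estimates\<close>

text \<open>\<open>weak_grad\<close> demands no integrability of \<open>g\<close>; it comes from the
  finite norm. A weak gradient of infinite norm contributes \<open>top\<close> to the infimum in
  \<open>grad_pow\<close> and does no harm.\<close>

lemma weak_grad_integrable_powr:
  assumes "weak_grad f g" "(\<integral>\<^sup>+x. ennreal (norm (g x) powr p) \<partial>lebesgue) < top" "1 \<le> p"
  shows "integrable lebesgue (\<lambda>x. norm (g x) powr p)" "(\<lambda>x. g x \<bullet> v) \<in> Lp p"
proof -
  have gm: "g \<in> borel_measurable lebesgue" using assms by (simp add: weak_grad_def)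
  have gim: "(\<lambda>x. g x \<bullet> v) \<in> borel_measurable lebesgue"
    by (intro borel_measurable_inner gm) simp
  show i: "integrable lebesgue (\<lambda>x. norm (g x) powr p)"
  proof (rule integrableI_bounded)
    show "(\<lambda>x. norm (g x) powr p) \<in> borel_measurable lebesgue"
      by (intro powr_real_measurable borel_measurable_const measurable_compose[OF gm borel_measurable_norm])
  qed (use assms in simp)
  have "integrable lebesgue (\<lambda>x. norm v powr p * norm (g x) powr p)" using i by simp
  then have "integrable lebesgue (\<lambda>x. \<bar>g x \<bullet> v\<bar> powr p)"
  proof (rule Bochner_Integration.integrable_bound)
    show "(\<lambda>x. \<bar>g x \<bullet> v\<bar> powr p) \<in> borel_measurable lebesgue"
      by (rule measurable_abs_powr[OF gim])
    show "AE x in lebesgue. norm (\<bar>g x \<bullet> v\<bar> powr p) \<le> norm (norm v powr p * norm (g x) powr p)"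
    proof (rule AE_I2)
      fix x
      have "\<bar>g x \<bullet> v\<bar> powr p \<le> (norm v * norm (g x)) powr p"
        using assms Cauchy_Schwarz_ineq2[of "g x" v] by (intro powr_mono2) (auto simp: mult.commute)
      then show "norm (\<bar>g x \<bullet> v\<bar> powr p) \<le> norm (norm v powr p * norm (g x) powr p)"
        by (simp add: powr_mult)
    qed
  qed
  then show "(\<lambda>x. g x \<bullet> v) \<in> Lp p" using gim by (simp add: Lp_def)
qed

text \<open>The defining identity is known for basis vectors only. Linearity in \<open>h\<close>
  extends it, and the finite norm makes each component integrable against \<psi>, so that sum and
  integral commute.\<close>

lemma weak_grad_direction:
  fixes f \<psi> :: "'a::euclidean_space \<Rightarrow> real"
  assumes p: "1 \<le> p" and f: "f \<in> Lp p" and g: "weak_grad f g"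
    and fin: "(\<integral>\<^sup>+x. ennreal (norm (g x) powr p) \<partial>lebesgue) < top" and \<psi>: "\<psi> \<in> C1c"
  shows "- (\<integral>x. f x * frechet_derivative \<psi> (at x) h \<partial>lebesgue) = (\<integral>x. (g x \<bullet> h) * \<psi> x \<partial>lebesgue)"
proof -
  have l: "linear (frechet_derivative \<psi> (at y))" for y
    using \<psi> by (simp add: C1c_def linear_frechet_derivative)
  have "f x * frechet_derivative \<psi> (at x) h = (\<Sum>b\<in>Basis. (h \<bullet> b) * (f x * frechet_derivative \<psi> (at x) b))" for x
  proof -
    have "frechet_derivative \<psi> (at x) h = frechet_derivative \<psi> (at x) (\<Sum>b\<in>Basis. (h \<bullet> b) *\<^sub>R b)"
      by (simp add: euclidean_representation)
    also have "\<dots> = (\<Sum>b\<in>Basis. (h \<bullet> b) * frechet_derivative \<psi> (at x) b)"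
      by (simp add: linear_sum[OF l] linear_cmul[OF l])
    finally show ?thesis by (simp add: sum_distrib_left mult_ac)
  qed
  then have "(\<integral>x. f x * frechet_derivative \<psi> (at x) h \<partial>lebesgue) =
      (\<Sum>b\<in>Basis. (h \<bullet> b) * (\<integral>x. f x * frechet_derivative \<psi> (at x) b \<partial>lebesgue))"
    using C1c_integrable_mult(2)[OF p f \<psi>] by (simp add: Bochner_Integration.integral_sum)
  also have "\<dots> = (\<Sum>b\<in>Basis. (h \<bullet> b) * - (\<integral>x. (g x \<bullet> b) * \<psi> x \<partial>lebesgue))"
    using g \<psi> by (auto simp: weak_grad_def intro!: sum.cong)
  also have "\<dots> = - (\<integral>x. (\<Sum>b\<in>Basis. (h \<bullet> b) * ((g x \<bullet> b) * \<psi> x)) \<partial>lebesgue)"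
    using C1c_integrable_mult(1)[OF p weak_grad_integrable_powr(2)[OF g fin p] \<psi>]
    by (simp add: Bochner_Integration.integral_sum sum_negf)
  also have "(\<lambda>x. \<Sum>b\<in>Basis. (h \<bullet> b) * ((g x \<bullet> b) * \<psi> x)) = (\<lambda>x. (g x \<bullet> h) * \<psi> x)"
    by (subst (2) euclidean_inner) (simp add: sum_distrib_left sum_distrib_right mult_ac)
  finally show ?thesis by simp
qed

lemma C1c_powr_integrable:
  fixes \<psi> :: "'a::euclidean_space \<Rightarrow> real"
  assumes \<psi>: "\<psi> \<in> C1c" and q: "0 < q"
  shows "integrable lebesgue (\<lambda>x. \<bar>\<psi> x\<bar> powr q)"
proof -
  obtain R where R: "\<And>x. \<psi> x \<noteq> 0 \<Longrightarrow> norm x \<le> R" using C1c_support[OF \<psi>] by metis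
  obtain B where B: "\<And>x. norm (\<psi> x) \<le> B" using C1c_bounded[OF \<psi>] by metis
  have "integrable lebesgue (indicator (cball 0 R) :: 'a \<Rightarrow> real)"
    using lmeasurable_cball[of 0 R] by (simp add: fmeasurable_def integrable_indicator_iff)
  then have "integrable lebesgue (\<lambda>x::'a. B powr q * indicator (cball 0 R) x)" by (intro integrable_mult_right)
  then show ?thesis
  proof (rule Bochner_Integration.integrable_bound)
    show "(\<lambda>x. \<bar>\<psi> x\<bar> powr q) \<in> borel_measurable lebesgue"
      by (rule measurable_abs_powr[OF C1c_measurable(1)[OF \<psi>]])
    show "AE x in lebesgue. norm (\<bar>\<psi> x\<bar> powr q) \<le> norm (B powr q * indicator (cball 0 R) x)"
    proof (rule AE_I2)
      fix x show "norm (\<bar>\<psi> x\<bar> powr q) \<le> norm (B powr q * indicator (cball 0 R) x)"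
      proof (cases "\<psi> x = 0")
        case False
        then have "norm x \<le> R" "\<bar>\<psi> x\<bar> powr q \<le> B powr q" using R B[of x] q by (auto intro: powr_mono2)
        then show ?thesis by simp
      qed simp
    qed
  qed
qed

text \<open>The mean value bound reduces the difference to pairings of the gradient in direction
  \<open>h\<close> with shifted test functions. Young's inequality brings these into the form that
  \<open>Lp_norm_le_testing\<close> accepts, with A = |h|^p G / p.\<close>

lemma weak_grad_translation_estimate:
  fixes f :: "'a::euclidean_space \<Rightarrow> real"
  assumes p: "1 < p" and f: "f \<in> Lp p" and g: "weak_grad f g"
  shows "(\<integral>\<^sup>+x. ennreal (\<bar>f (x + h) - f x\<bar> powr p) \<partial>lebesgue)
    \<le> ennreal (norm h powr p) * (\<integral>\<^sup>+x. ennreal (norm (g x) powr p) \<partial>lebesgue)"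
proof (cases "h = 0")
  case False
  show ?thesis
  proof (cases "(\<integral>\<^sup>+x. ennreal (norm (g x) powr p) \<partial>lebesgue) < top")
    case fin: True
    define q where "q = p / (p - 1)"
    have q: "1 < q" "1 / p + 1 / q = 1" using p by (auto simp: q_def field_simps)
    have p': "1 \<le> p" using p by simp
    note gi = weak_grad_integrable_powr[OF g fin p']
    define G where "G = (\<integral>x. norm (g x) powr p \<partial>lebesgue)"
    have G: "(\<integral>\<^sup>+x. ennreal (norm (g x) powr p) \<partial>lebesgue) = ennreal G"
      unfolding G_def by (rule nn_integral_eq_integral[OF gi(1)]) simp
    have "(\<integral>x. \<bar>f (x + h) - f x\<bar> powr p \<partial>lebesgue) \<le> p * (norm h powr p * G / p)"
    proof (rule Lp_norm_le_testing[OF p q Lp_difference[OF p' f]])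
      fix \<psi> :: "'a \<Rightarrow> real" assume \<psi>: "\<psi> \<in> C1c"
      show "(\<integral>x. (f (x + h) - f x) * \<psi> x \<partial>lebesgue) \<le> norm h powr p * G / p + (\<integral>x. \<bar>\<psi> x\<bar> powr q \<partial>lebesgue) / q"
      proof (rule translate_pairing_bound[OF p' f \<psi>])
        fix s :: real
        let ?\<psi> = "\<lambda>x. \<psi> (x - s *\<^sub>R h)"
        note \<psi>s = C1c_translate[OF \<psi>, of "s *\<^sub>R h"]
        note \<psi>i = C1c_powr_integrable[OF \<psi>s(1), of q]
        have "- (\<integral>x. f x * frechet_derivative \<psi> (at (x - s *\<^sub>R h)) h \<partial>lebesgue) = (\<integral>x. (g x \<bullet> h) * ?\<psi> x \<partial>lebesgue)"
          using weak_grad_direction[OF p' f g fin \<psi>s(1)] unfolding \<psi>s(2) .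
        also have "\<dots> \<le> (\<integral>x. norm h powr p * norm (g x) powr p / p + \<bar>?\<psi> x\<bar> powr q / q \<partial>lebesgue)"
        proof (rule integral_mono)
          show "integrable lebesgue (\<lambda>x. (g x \<bullet> h) * ?\<psi> x)"
            by (rule C1c_integrable_mult(1)[OF p' gi(2) \<psi>s(1)])
          show "integrable lebesgue (\<lambda>x. norm h powr p * norm (g x) powr p / p + \<bar>?\<psi> x\<bar> powr q / q)"
            using gi(1) \<psi>i q by simp
          fix x
          have "(g x \<bullet> h) * ?\<psi> x \<le> \<bar>g x \<bullet> h\<bar> * \<bar>?\<psi> x\<bar>"
            by (metis abs_ge_self abs_mult)
          also have "\<dots> \<le> (norm h * norm (g x)) * \<bar>?\<psi> x\<bar>"
            using Cauchy_Schwarz_ineq2[of "g x" h] by (intro mult_right_mono) (auto simp: mult.commute)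
          also have "\<dots> \<le> (norm h * norm (g x)) powr p / p + \<bar>?\<psi> x\<bar> powr q / q"
            by (rule Youngs_inequality[OF p q]) auto
          finally show "(g x \<bullet> h) * ?\<psi> x \<le> norm h powr p * norm (g x) powr p / p + \<bar>?\<psi> x\<bar> powr q / q"
            by (simp add: powr_mult)
        qed
        also have "\<dots> = norm h powr p * G / p + (\<integral>x. \<bar>?\<psi> x\<bar> powr q \<partial>lebesgue) / q"
          using gi(1) \<psi>i q by (simp add: G_def)
        \<comment> \<open>Translation invariance removes \<open>s\<close>, as
          \<open>translate_pairing_bound\<close> needs a bound uniform in \<open>s\<close>.\<close>
        also have "(\<integral>x. \<bar>?\<psi> x\<bar> powr q \<partial>lebesgue) = (\<integral>x. \<bar>\<psi> x\<bar> powr q \<partial>lebesgue)"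
          using integral_translate[of "\<lambda>x. \<bar>\<psi> x\<bar> powr q" "- (s *\<^sub>R h)"]
            measurable_abs_powr[OF C1c_measurable(1)[OF \<psi>]] by simp
        finally show "- (\<integral>x. f x * frechet_derivative \<psi> (at (x - s *\<^sub>R h)) h \<partial>lebesgue)
          \<le> norm h powr p * G / p + (\<integral>x. \<bar>\<psi> x\<bar> powr q \<partial>lebesgue) / q" .
      qed
    qed
    also have "p * (norm h powr p * G / p) = norm h powr p * G" using p by simp
    finally show ?thesis
      unfolding nn_integral_eq_integral_abs_powr[OF Lp_difference[OF p' f]] G
      by (simp flip: ennreal_mult' add: ennreal_leI)
  next
    case fin: False
    then have "(\<integral>\<^sup>+x. ennreal (norm (g x) powr p) \<partial>lebesgue) = top" using less_top by blast
    then show ?thesis using \<open>h \<noteq> 0\<close> by (simp add: ennreal_mult_top)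
  qed
qed simp

text \<open>Fields with a constant direction turn divergence into a directional derivative; they are
  the fields through which the total variation controls differences along one
  \<open>h\<close>.\<close>

lemma C1c_scaleR_direction:
  fixes \<psi> :: "'a::euclidean_space \<Rightarrow> real"
  assumes \<psi>: "\<psi> \<in> C1c"
  shows "(\<lambda>x. \<psi> x *\<^sub>R v) \<in> C1c" "div_field (\<lambda>x. \<psi> x *\<^sub>R v) x = frechet_derivative \<psi> (at x) v"
proof -
  have d: "((\<lambda>x. \<psi> x *\<^sub>R v) has_derivative (\<lambda>u. frechet_derivative \<psi> (at x) u *\<^sub>R v)) (at x)" for x
    by (intro has_derivative_scaleR_left C1c_has_derivative \<psi>)
  have c: "continuous_on UNIV (\<lambda>x. frechet_derivative \<psi> (at x) u *\<^sub>R v)" for u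
    using \<psi> by (intro continuous_on_scaleR) (auto simp: C1c_def)
  have "bounded {x. \<psi> x \<noteq> 0}" using \<psi> by (simp add: C1c_def)
  then have b: "bounded {x. \<psi> x *\<^sub>R v \<noteq> 0}" by (rule bounded_subset) auto
  show "(\<lambda>x. \<psi> x *\<^sub>R v) \<in> C1c" using C1cI(1)[OF d c b] .
  have l: "linear (frechet_derivative \<psi> (at x))"
    using \<psi> by (simp add: C1c_def linear_frechet_derivative)
  have "div_field (\<lambda>x. \<psi> x *\<^sub>R v) x = (\<Sum>b\<in>Basis. (v \<bullet> b) * frechet_derivative \<psi> (at x) b)"
    unfolding div_field_def C1cI(2)[OF d c b] by (simp add: mult.commute)
  also have "\<dots> = frechet_derivative \<psi> (at x) (\<Sum>b\<in>Basis. (v \<bullet> b) *\<^sub>R b)"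
    by (simp add: linear_sum[OF l] linear_cmul[OF l])
  finally show "div_field (\<lambda>x. \<psi> x *\<^sub>R v) x = frechet_derivative \<psi> (at x) v"
    by (simp add: euclidean_representation)
qed

lemma BV_translation_estimate:
  fixes f :: "'a::euclidean_space \<Rightarrow> real"
  assumes f: "f \<in> Lp 1"
  shows "(\<integral>\<^sup>+x. ennreal (\<bar>f (x + h) - f x\<bar> powr 1) \<partial>lebesgue) \<le> ennreal (norm h) * BV_seminorm f"
proof (cases "h = 0")
  case h: False
  show ?thesis
  proof (cases "BV_seminorm f")
    case (real V)
    have "(\<integral>x. \<bar>f (x + h) - f x\<bar> powr 1 \<partial>lebesgue) \<le> norm h * V"
    proof (rule L1_norm_le_testing[OF Lp_difference[OF order_refl f]])
      fix \<psi> :: "'a \<Rightarrow> real" assume \<psi>: "\<psi> \<in> C1c" and \<psi>1: "\<And>x. \<bar>\<psi> x\<bar> \<le> 1"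
      show "(\<integral>x. (f (x + h) - f x) * \<psi> x \<partial>lebesgue) \<le> norm h * V"
      proof (rule translate_pairing_bound[OF order_refl f \<psi>])
        fix s :: real
        note \<psi>s = C1c_translate[OF \<psi>, of "s *\<^sub>R h"]
        \<comment> \<open>A unit vector keeps the field admissible; the minus sign matches -integral
          of f times the derivative of \<psi> along \<open>h\<close>, which is what
          \<open>translate_pairing_bound\<close> asks for.\<close>
        define v where "v = (- 1 / norm h) *\<^sub>R h"
        have l: "linear (frechet_derivative \<psi> (at x))" for x
          using \<psi> by (simp add: C1c_def linear_frechet_derivative)
        have "(\<lambda>x. \<psi> (x - s *\<^sub>R h) *\<^sub>R v) \<in> {\<phi> \<in> C1c. \<forall>x. norm (\<phi> x) \<le> 1}"
          using C1c_scaleR_direction(1)[OF \<psi>s(1), of v] \<psi>1 h by (simp add: v_def)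
        then have "ennreal (\<integral>x. f x * div_field (\<lambda>x. \<psi> (x - s *\<^sub>R h) *\<^sub>R v) x \<partial>lebesgue) \<le> BV_seminorm f"
          unfolding BV_seminorm_def by (rule SUP_upper)
        also have "(\<integral>x. f x * div_field (\<lambda>x. \<psi> (x - s *\<^sub>R h) *\<^sub>R v) x \<partial>lebesgue) =
            (\<integral>x. (- 1 / norm h) * (f x * frechet_derivative \<psi> (at (x - s *\<^sub>R h)) h) \<partial>lebesgue)"
          unfolding C1c_scaleR_direction(2)[OF \<psi>s(1)] \<psi>s(2) v_def linear_cmul[OF l]
          by (intro Bochner_Integration.integral_cong) auto
        also have "\<dots> = (- 1 / norm h) * (\<integral>x. f x * frechet_derivative \<psi> (at (x - s *\<^sub>R h)) h \<partial>lebesgue)"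
          by (rule integral_mult_right_zero)
        finally have "(- 1 / norm h) * (\<integral>x. f x * frechet_derivative \<psi> (at (x - s *\<^sub>R h)) h \<partial>lebesgue) \<le> V"
          using real by (simp add: ennreal_le_iff)
        then show "- (\<integral>x. f x * frechet_derivative \<psi> (at (x - s *\<^sub>R h)) h \<partial>lebesgue) \<le> norm h * V"
          using h by (simp add: field_simps)
      qed
    qed
    then show ?thesis
      unfolding nn_integral_eq_integral_abs_powr[OF Lp_difference[OF order_refl f]] real(2)
      using real(1) by (simp flip: ennreal_mult add: ennreal_leI)
  next
    case top
    then show ?thesis using h by (simp add: ennreal_mult_top)
  qed
qed simp

lemma translation_estimate:
  fixes f :: "'a::euclidean_space \<Rightarrow> real"
  assumes p: "1 \<le> p" and f: "f \<in> Lp p"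
  shows "(\<integral>\<^sup>+x. ennreal (\<bar>f (x + h) - f x\<bar> powr p) \<partial>lebesgue) \<le> ennreal (norm h powr p) * grad_pow p f"
proof (cases "p = 1")
  case True
  then show ?thesis using BV_translation_estimate[of f h] f by (simp add: grad_pow_def)
next
  case p1: False
  show ?thesis
  proof (cases "h = 0")
    case h: False
    let ?L = "\<integral>\<^sup>+x. ennreal (\<bar>f (x + h) - f x\<bar> powr p) \<partial>lebesgue"
    \<comment> \<open>The factor |h|^p is moved to the left first, so that the right side is a bare
      infimum and can be bounded gradient by gradient.\<close>
    have r: "ennreal (1 / norm h powr p) * ennreal (norm h powr p) = 1"
      using h by (simp flip: ennreal_mult)
    have "ennreal (1 / norm h powr p) * ?L \<le> grad_pow p f"
      unfolding grad_pow_def using p1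
    proof (simp, intro INF_greatest)
      fix g assume "g \<in> {g. weak_grad f g}"
      then have "?L \<le> ennreal (norm h powr p) * (\<integral>\<^sup>+x. ennreal (norm (g x) powr p) \<partial>lebesgue)"
        using weak_grad_translation_estimate[of p f g h] p p1 f by auto
      then have "ennreal (1 / norm h powr p) * ?L \<le>
          ennreal (1 / norm h powr p) * (ennreal (norm h powr p) * (\<integral>\<^sup>+x. ennreal (norm (g x) powr p) \<partial>lebesgue))"
        by (intro mult_left_mono) auto
      then show "ennreal (1 / norm h powr p) * ?L \<le> (\<integral>\<^sup>+x. ennreal (norm (g x) powr p) \<partial>lebesgue)"
        using r by (simp flip: mult.assoc)
    qed
    then have "ennreal (norm h powr p) * (ennreal (1 / norm h powr p) * ?L) \<le> ennreal (norm h powr p) * grad_pow p f"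
      by (intro mult_left_mono) auto
    then show ?thesis using r by (simp flip: mult.assoc add: mult.commute)
  qed simp
qed

section \<open>Weak limits in Lebesgue spaces\<close>

text \<open>Strict convexity with one argument normalised to 1. For r >= 0 the mean slopes over the
  two halves of [r,1] are compared: they are derivatives at points of disjoint intervals, and the
  derivative is strictly increasing.\<close>

lemma powr_midpoint_less:
  fixes p r :: real
  assumes p: "1 < p" and r: "-1 \<le> r" "r < 1"
  shows "\<bar>(1 + r) / 2\<bar> powr p < (1 + \<bar>r\<bar> powr p) / 2"
proof -
  have convex: "((1 + r) / 2) powr p < (1 + r powr p) / 2" if r: "0 \<le> r" "r < 1" for r :: real
  proof -
    define s where "s = (1 + r) / 2"
    have s: "r < s" "s < 1" "0 < s" using r by (auto simp: s_def)
    have d: "((\<lambda>x. x powr p) has_real_derivative p * x powr (p - 1)) (at x)" if "0 < x" for x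
      using that by (auto intro!: derivative_eq_intros)
    have "\<exists>z. s < z \<and> z < 1 \<and> 1 powr p - s powr p = (1 - s) * (p * z powr (p - 1))"
      using s d by (intro MVT2) auto
    then obtain z1 where z1: "s < z1" "1 - s powr p = (1 - s) * (p * z1 powr (p - 1))" by auto
    have "\<exists>l z. r < z \<and> z < s \<and> DERIV (\<lambda>x. x powr p) z :> l \<and> s powr p - r powr p = (s - r) * l"
    proof (rule MVT)
      show "continuous_on {r..s} (\<lambda>x. x powr p)"
        using p r by (intro continuous_on_powr') (auto intro!: continuous_intros)
      show "(\<lambda>x. x powr p) differentiable (at x)" if "r < x" "x < s" for x
        using d[of x] that r real_differentiable_def by auto
    qed (use s in auto)
    then obtain l z2 where z2: "r < z2" "z2 < s" "DERIV (\<lambda>x. x powr p) z2 :> l" "s powr p - r powr p = (s - r) * l"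
      by blast
    have "l = p * z2 powr (p - 1)" using z2 d[of z2] r by (auto intro: DERIV_unique)
    then have z2': "s powr p - r powr p = (s - r) * (p * z2 powr (p - 1))" using z2 by simp
    have "z2 powr (p - 1) < z1 powr (p - 1)"
      using z1 z2 r p by (intro powr_less_mono2) auto
    moreover have sr: "s - r = 1 - s" by (simp add: s_def field_simps)
    ultimately have "s powr p - r powr p < 1 - s powr p"
      unfolding z2' z1(2) sr using s p by simp
    then show ?thesis unfolding s_def by simp
  qed
  show ?thesis
  proof (cases "0 \<le> r")
    case True then show ?thesis using convex[of r] r by simp
  next
    case False
    show ?thesis
    \<comment> \<open>Replacing r by |r| loses strictness exactly at r = -1, where |r| = 1; there
      the left side is 0.\<close>
    proof (cases "r = -1")
      case True then show ?thesis by simp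
    next
      case r1: False
      have "\<bar>(1 + r) / 2\<bar> powr p \<le> ((1 + \<bar>r\<bar>) / 2) powr p"
        using False r p by (intro powr_mono2) auto
      also have "\<dots> < (1 + \<bar>r\<bar> powr p) / 2"
        using convex[of "\<bar>r\<bar>"] False r r1 by auto
      finally show ?thesis .
    qed
  qed
qed

text \<open>By homogeneity one may divide by the argument of larger modulus, which leaves a ratio in
  [-1,1].\<close>

lemma powr_midpoint_le:
  fixes p a b :: real
  assumes "1 < p"
  shows "\<bar>(a + b) / 2\<bar> powr p \<le> (\<bar>a\<bar> powr p + \<bar>b\<bar> powr p) / 2"
proof -
  have *: "\<bar>(a + b) / 2\<bar> powr p \<le> (\<bar>a\<bar> powr p + \<bar>b\<bar> powr p) / 2" if ab: "\<bar>b\<bar> \<le> \<bar>a\<bar>" "a \<noteq> 0" for a b :: real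
  proof -
    have r: "-1 \<le> b / a" "b / a \<le> 1" using ab by (auto simp: divide_simps)
    have "\<bar>(1 + b / a) / 2\<bar> powr p \<le> (1 + \<bar>b / a\<bar> powr p) / 2"
      using powr_midpoint_less[OF assms r(1)] r(2) by (cases "b / a = 1") auto
    then have "\<bar>a\<bar> powr p * \<bar>(1 + b / a) / 2\<bar> powr p \<le> \<bar>a\<bar> powr p * ((1 + \<bar>b / a\<bar> powr p) / 2)"
      by (intro mult_left_mono) auto
    moreover have "\<bar>a\<bar> powr p * \<bar>(1 + b / a) / 2\<bar> powr p = \<bar>(a + b) / 2\<bar> powr p"
    proof -
      have "a * ((1 + b / a) / 2) = (a + b) / 2" using ab by (simp add: field_simps)
      then show ?thesis by (simp flip: powr_mult abs_mult)
    qed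
    moreover have "\<bar>a\<bar> powr p * \<bar>b / a\<bar> powr p = \<bar>b\<bar> powr p"
      using ab by (simp add: abs_divide powr_divide)
    ultimately show ?thesis by (simp add: distrib_left)
  qed
  show ?thesis
  proof (cases "\<bar>b\<bar> \<le> \<bar>a\<bar>")
    case True then show ?thesis using *[of b a] by (cases "a = 0") auto
  next
    case False then show ?thesis using *[of a b] by (auto simp: add.commute)
  qed
qed

text \<open>Integrating this gives the uniform convexity of $L^p$ for all $p > 1$ at once.\<close>

lemma powr_uniform_convexity:
  fixes p \<eta> :: real
  assumes p: "1 < p" and \<eta>: "0 < \<eta>"
  obtains \<kappa> where "0 < \<kappa>"
    "\<And>a b::real. \<bar>a - b\<bar> powr p \<le> \<eta> * (\<bar>a\<bar> powr p + \<bar>b\<bar> powr p)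
       + \<kappa> * ((\<bar>a\<bar> powr p + \<bar>b\<bar> powr p) / 2 - \<bar>(a + b) / 2\<bar> powr p)"
proof -
  define d where "d r = (1 + \<bar>r\<bar> powr p) / 2 - \<bar>(1 + r) / 2\<bar> powr p" for r :: real
  \<comment> \<open>On [-1,1] the convexity gap \<open>d\<close> vanishes only at r = 1. The set
    \<open>S\<close> keeps away from 1 and is compact, so \<open>d\<close> has a positive minimum
    there; outside \<open>S\<close> the term with \<eta> suffices.\<close>
  define S where "S = {r. r \<in> {-1..1} \<and> \<eta> \<le> \<bar>1 - r\<bar> powr p}"
  have pc: "continuous_on A (\<lambda>r. \<bar>g r\<bar> powr p)" if "continuous_on A g" for A :: "real set" and g
    using p that by (intro continuous_on_powr') (auto intro!: continuous_intros)
  have "closed S" unfolding S_def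
    by (intro continuous_on_closed_Collect_le pc continuous_intros)
  then have "compact S"
    by (auto simp: compact_eq_bounded_closed S_def intro: bounded_subset[of "{-1..1}"])
  have dc: "continuous_on S d" unfolding d_def by (intro continuous_intros pc) auto
  have dpos: "0 < d r" if "r \<in> S" for r
  proof -
    have "r \<noteq> 1" using that \<eta> by (auto simp: S_def)
    then show ?thesis using powr_midpoint_less[OF p, of r] that by (auto simp: d_def S_def)
  qed
  obtain d0 where d0: "0 < d0" "\<And>r. r \<in> S \<Longrightarrow> d0 \<le> d r"
  proof (cases "S = {}")
    case True then show thesis using that[of 1] by auto
  next
    case False
    then obtain r0 where "r0 \<in> S" "\<forall>r\<in>S. d r0 \<le> d r"
      using continuous_attains_inf[OF \<open>compact S\<close> False dc] by blast
    then show thesis using dpos that by blast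
  qed
  \<comment> \<open>|1 - r|^p <= 2^p on [-1,1], and \<open>d\<close> is at least \<open>d0\<close>
    on \<open>S\<close>.\<close>
  define \<kappa> where "\<kappa> = 2 powr p / d0"
  have \<kappa>: "0 < \<kappa>" using d0 by (simp add: \<kappa>_def)
  have dnn: "0 \<le> d r" for r
    using powr_midpoint_le[OF p, of 1 r] by (simp add: d_def)
  have unit: "\<bar>1 - r\<bar> powr p \<le> \<eta> * (1 + \<bar>r\<bar> powr p) + \<kappa> * d r" if r: "-1 \<le> r" "r \<le> 1" for r
  proof (cases "r \<in> S")
    case True
    have "\<bar>1 - r\<bar> powr p \<le> 2 powr p" using r p by (intro powr_mono2) auto
    also have "\<dots> \<le> \<kappa> * d r" using d0(2)[OF True] d0(1) by (simp add: \<kappa>_def field_simps)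
    finally show ?thesis using \<eta> by (simp add: add_increasing)
  next
    case False
    then have "\<bar>1 - r\<bar> powr p \<le> \<eta>" using r by (auto simp: S_def)
    also have "\<dots> \<le> \<eta> * (1 + \<bar>r\<bar> powr p)" using \<eta> by (simp add: field_simps)
    finally show ?thesis using \<kappa> dnn[of r] by (simp add: add_increasing2)
  qed
  have *: "\<bar>a - b\<bar> powr p \<le> \<eta> * (\<bar>a\<bar> powr p + \<bar>b\<bar> powr p)
       + \<kappa> * ((\<bar>a\<bar> powr p + \<bar>b\<bar> powr p) / 2 - \<bar>(a + b) / 2\<bar> powr p)"
    if ab: "\<bar>b\<bar> \<le> \<bar>a\<bar>" "a \<noteq> 0" for a b :: real
  proof -
    have r: "-1 \<le> b / a" "b / a \<le> 1" using ab by (auto simp: divide_simps)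
    have "\<bar>a\<bar> powr p * \<bar>1 - b / a\<bar> powr p
        \<le> \<bar>a\<bar> powr p * (\<eta> * (1 + \<bar>b / a\<bar> powr p) + \<kappa> * d (b / a))"
      using unit[OF r] by (intro mult_left_mono) auto
    moreover have "\<bar>a\<bar> powr p * \<bar>1 - b / a\<bar> powr p = \<bar>a - b\<bar> powr p"
      using ab by (simp flip: powr_mult abs_mult add: right_diff_distrib)
    moreover have e1: "\<bar>a\<bar> powr p * \<bar>(1 + b / a) / 2\<bar> powr p = \<bar>(a + b) / 2\<bar> powr p"
    proof -
      have "a * ((1 + b / a) / 2) = (a + b) / 2" using ab by (simp add: field_simps)
      then show ?thesis by (simp flip: powr_mult abs_mult)
    qed
    moreover have e2: "\<bar>a\<bar> powr p * \<bar>b / a\<bar> powr p = \<bar>b\<bar> powr p"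
      using ab by (simp add: abs_divide powr_divide)
    moreover have "\<bar>a\<bar> powr p * (\<eta> * (1 + \<bar>b / a\<bar> powr p) + \<kappa> * d (b / a)) =
       \<eta> * (\<bar>a\<bar> powr p + \<bar>a\<bar> powr p * \<bar>b / a\<bar> powr p) +
       \<kappa> * ((\<bar>a\<bar> powr p + \<bar>a\<bar> powr p * \<bar>b / a\<bar> powr p) / 2 - \<bar>a\<bar> powr p * \<bar>(1 + b / a) / 2\<bar> powr p)"
      unfolding d_def by (simp add: algebra_simps add_divide_distrib)
    ultimately show ?thesis unfolding e1 e2 by linarith
  qed
  show thesis
  proof (rule that[OF \<kappa>])
    fix a b :: real
    show "\<bar>a - b\<bar> powr p \<le> \<eta> * (\<bar>a\<bar> powr p + \<bar>b\<bar> powr p)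
       + \<kappa> * ((\<bar>a\<bar> powr p + \<bar>b\<bar> powr p) / 2 - \<bar>(a + b) / 2\<bar> powr p)"
    proof (cases "\<bar>b\<bar> \<le> \<bar>a\<bar>")
      case True then show ?thesis using *[of b a] by (cases "a = 0") auto
    next
      case False then show ?thesis using *[of a b] by (auto simp: add.commute abs_minus_commute)
    qed
  qed
qed

text \<open>For |a| > \<delta> write |a| = |a|^(1-p) |a|^p and use 1 - p <= 0. This stands in for
  Hoelder's inequality when pairing with bounded integrable functions: first \<delta> is made small,
  then the integral of |a|^p.\<close>

lemma powr_split_le:
  fixes a p \<delta> :: real
  assumes "1 \<le> p" "0 < \<delta>"
  shows "\<bar>a\<bar> \<le> \<delta> + \<delta> powr (1 - p) * \<bar>a\<bar> powr p"
proof (cases "\<bar>a\<bar> \<le> \<delta>")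
  case False
  then have "\<bar>a\<bar> powr (1 - p) \<le> \<delta> powr (1 - p)" using assms by (intro powr_mono2') auto
  then have "\<bar>a\<bar> powr (1 - p) * \<bar>a\<bar> powr p \<le> \<delta> powr (1 - p) * \<bar>a\<bar> powr p"
    by (intro mult_right_mono) auto
  moreover have "\<bar>a\<bar> powr (1 - p) * \<bar>a\<bar> powr p = \<bar>a\<bar>"
    using False assms by (simp flip: powr_add)
  ultimately show ?thesis using assms by linarith
qed (use assms in \<open>simp add: add_increasing2\<close>)

text \<open>The difference of the $p$-th powers along a fast subsequence is summable even after
  multiplication by $2^{kp}$, so the subsequence is pointwise Cauchy almost everywhere.\<close>

lemma Lp_Cauchy_subseq:
  fixes w :: "nat \<Rightarrow> 'a \<Rightarrow> real"
  assumes p: "1 \<le> p" and m: "\<And>n. w n \<in> borel_measurable M"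
    and C: "\<And>e. 0 < e \<Longrightarrow> \<exists>N. \<forall>m\<ge>N. \<forall>n\<ge>N. (\<integral>\<^sup>+x. ennreal (\<bar>w m x - w n x\<bar> powr p) \<partial>M) \<le> ennreal e"
  obtains r g where "strict_mono r" "g \<in> borel_measurable M" "AE x in M. (\<lambda>k. w (r k) x) \<longlonglongrightarrow> g x"
proof -
  define e where "e k = 1 / 2 ^ k * 2 powr (- p * real k)" for k :: nat
  have epos: "0 < e k" for k by (simp add: e_def)
  obtain N where N: "\<And>k m n. m \<ge> N k \<Longrightarrow> n \<ge> N k \<Longrightarrow> (\<integral>\<^sup>+x. ennreal (\<bar>w m x - w n x\<bar> powr p) \<partial>M) \<le> ennreal (e k)"
    using C[OF epos] by metis
  \<comment> \<open>The maximum makes \<open>r\<close> strictly increasing and at the same time at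
    least \<open>N k\<close> at stage \<open>k\<close>.\<close>
  define r where "r = rec_nat (N 0) (\<lambda>k s. max (Suc s) (N (Suc k)))"
  have rS: "r (Suc k) = max (Suc (r k)) (N (Suc k))" for k by (simp add: r_def)
  have "strict_mono r" unfolding strict_mono_Suc_iff rS by auto
  have rN: "N k \<le> r k" for k by (cases k) (auto simp: r_def)
  have rS': "N k \<le> r (Suc k)" for k
    using rN[of k] by (simp add: rS)
  let ?d = "\<lambda>k x. ennreal (2 powr (p * real k) * \<bar>w (r (Suc k)) x - w (r k) x\<bar> powr p)"
  have dm: "?d k \<in> borel_measurable M" for k
    by (intro measurable_compose[OF _ measurable_ennreal] borel_measurable_times measurable_abs_powr borel_measurable_diff m) simp
  have "(\<integral>\<^sup>+x. (\<Sum>k. ?d k x) \<partial>M) = (\<Sum>k. \<integral>\<^sup>+x. ?d k x \<partial>M)"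
    by (rule nn_integral_suminf[OF dm])
  also have "\<dots> \<le> (\<Sum>k. ennreal ((1 / 2) ^ k))"
  proof (intro suminf_le summableI)
    fix k
    have "(\<integral>\<^sup>+x. ?d k x \<partial>M) = ennreal (2 powr (p * real k)) * (\<integral>\<^sup>+x. ennreal (\<bar>w (r (Suc k)) x - w (r k) x\<bar> powr p) \<partial>M)"
      by (subst nn_integral_cmult[symmetric])
        (auto simp: ennreal_mult intro!: measurable_compose[OF _ measurable_ennreal] measurable_abs_powr borel_measurable_diff m)
    also have "\<dots> \<le> ennreal (2 powr (p * real k)) * ennreal (e k)"
      by (intro mult_left_mono N rN rS') simp
    also have "\<dots> = ennreal ((1 / 2) ^ k)"
    proof -
      have "2 powr (p * real k) * e k = (1 / 2) ^ k"
        by (simp add: e_def powr_minus power_one_over)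
      then show ?thesis by (metis ennreal_mult' powr_ge_zero)
    qed
    finally show "(\<integral>\<^sup>+x. ?d k x \<partial>M) \<le> ennreal ((1 / 2) ^ k)" .
  qed
  also have "\<dots> < top"
    by (subst suminf_ennreal2) (auto intro: summable_geometric)
  finally have "(\<integral>\<^sup>+x. (\<Sum>k. ?d k x) \<partial>M) < top" .
  then have "AE x in M. (\<Sum>k. ?d k x) \<noteq> \<infinity>"
    by (intro nn_integral_PInf_AE borel_measurable_suminf_order dm) auto
  then have "AE x in M. Cauchy (\<lambda>k. w (r k) x)"
  proof eventually_elim
    case (elim x)
    have "summable (\<lambda>k. 2 powr (p * real k) * \<bar>w (r (Suc k)) x - w (r k) x\<bar> powr p)"
      using elim by (intro summable_suminf_not_top) auto
    then have "(\<lambda>k. 2 powr (p * real k) * \<bar>w (r (Suc k)) x - w (r k) x\<bar> powr p) \<longlonglongrightarrow> 0"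
      by (rule summable_LIMSEQ_zero)
    then have "\<forall>\<^sub>F k in sequentially. 2 powr (p * real k) * \<bar>w (r (Suc k)) x - w (r k) x\<bar> powr p < 1"
      by (rule order_tendstoD) simp
    then have "\<forall>\<^sub>F k in sequentially. norm (w (r (Suc k)) x - w (r k) x) \<le> (1 / 2) ^ k"
    proof eventually_elim
      case (elim k)
      have "2 powr (p * real k) * \<bar>w (r (Suc k)) x - w (r k) x\<bar> powr p = (2 ^ k * \<bar>w (r (Suc k)) x - w (r k) x\<bar>) powr p"
        by (simp add: powr_mult powr_powr mult.commute flip: powr_realpow)
      with elim have "(2 ^ k * \<bar>w (r (Suc k)) x - w (r k) x\<bar>) powr p < 1 powr p" by simp
      then have "2 ^ k * \<bar>w (r (Suc k)) x - w (r k) x\<bar> < 1"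
        using p powr_mono2[of p 1 "2 ^ k * \<bar>w (r (Suc k)) x - w (r k) x\<bar>"] by linarith
      then show ?case by (simp add: power_one_over field_simps)
    qed
    then have "summable (\<lambda>k. w (r (Suc k)) x - w (r k) x)"
      by (rule summable_comparison_test_ev) (rule summable_geometric, simp)
    then have "convergent (\<lambda>k. w (r k) x - w (r 0) x)"
      by (simp add: summable_iff_convergent sum_lessThan_telescope[of "\<lambda>k. w (r k) x"])
    then show ?case by (simp add: convergent_Cauchy convergent_diff_const_right_iff)
  qed
  then have ae: "AE x in M. (\<lambda>k. w (r k) x) \<longlonglongrightarrow> lim (\<lambda>k. w (r k) x)"
    by eventually_elim (simp add: Cauchy_convergent_iff convergent_LIMSEQ_iff)
  show thesis
    by (rule that[OF \<open>strict_mono r\<close> _ ae]) (intro borel_measurable_lim_metric m)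
qed

text \<open>The bound may vary with \<open>k\<close>, because almost minimal elements have energy
  bounded by K only up to an error that tends to 0.\<close>

lemma Fatou_powr:
  fixes u :: "nat \<Rightarrow> 'a \<Rightarrow> real"
  assumes p: "0 < p" and m: "\<And>k. u k \<in> borel_measurable M"
    and lim: "AE x in M. (\<lambda>k. u k x) \<longlonglongrightarrow> v x"
    and le: "\<forall>\<^sub>F k in sequentially. (\<integral>\<^sup>+x. ennreal (\<bar>u k x\<bar> powr p) \<partial>M) \<le> ennreal (c k)"
    and c: "c \<longlonglongrightarrow> C"
  shows "(\<integral>\<^sup>+x. ennreal (\<bar>v x\<bar> powr p) \<partial>M) \<le> ennreal C"
proof -
  have "(\<integral>\<^sup>+x. ennreal (\<bar>v x\<bar> powr p) \<partial>M) = (\<integral>\<^sup>+x. liminf (\<lambda>k. ennreal (\<bar>u k x\<bar> powr p)) \<partial>M)"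
  proof (rule nn_integral_cong_AE)
    show "AE x in M. ennreal (\<bar>v x\<bar> powr p) = liminf (\<lambda>k. ennreal (\<bar>u k x\<bar> powr p))"
      using lim
    proof eventually_elim
      case (elim x)
      have "(\<lambda>k. \<bar>u k x\<bar> powr p) \<longlonglongrightarrow> \<bar>v x\<bar> powr p"
        by (rule tendsto_powr2[OF tendsto_rabs[OF elim] tendsto_const]) (use p in auto)
      then have "(\<lambda>k. ennreal (\<bar>u k x\<bar> powr p)) \<longlonglongrightarrow> ennreal (\<bar>v x\<bar> powr p)"
        by (rule tendsto_ennrealI)
      then show ?case by (intro lim_imp_Liminf[symmetric]) auto
    qed
  qed
  also have "\<dots> \<le> liminf (\<lambda>k. \<integral>\<^sup>+x. ennreal (\<bar>u k x\<bar> powr p) \<partial>M)"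
    by (intro nn_integral_liminf measurable_compose[OF _ measurable_ennreal] measurable_abs_powr m)
  also have "\<dots> \<le> liminf (\<lambda>k. ennreal (c k))"
    by (rule Liminf_mono[OF le])
  also have "\<dots> = ennreal C"
    by (intro lim_imp_Liminf tendsto_ennrealI c) auto
  finally show ?thesis .
qed

text \<open>Integrate \<open>powr_split_le\<close> against |\<psi>|. Since \<delta> is free,
  convergence in $L^p$ implies convergence of the pairings.\<close>

lemma Lp_pairing_bound:
  fixes v \<psi> :: "'a \<Rightarrow> real"
  assumes p: "1 \<le> p" and \<delta>: "0 < \<delta>" and v: "v \<in> borel_measurable M" "integrable M (\<lambda>x. \<bar>v x\<bar> powr p)"
    and \<psi>: "integrable M \<psi>" "\<And>x. \<bar>\<psi> x\<bar> \<le> B"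
  shows "integrable M (\<lambda>x. v x * \<psi> x)"
    "\<bar>\<integral>x. v x * \<psi> x \<partial>M\<bar> \<le> \<delta> * (\<integral>x. \<bar>\<psi> x\<bar> \<partial>M) + \<delta> powr (1 - p) * B * (\<integral>x. \<bar>v x\<bar> powr p \<partial>M)"
proof -
  have le: "\<bar>v x * \<psi> x\<bar> \<le> \<delta> * \<bar>\<psi> x\<bar> + \<delta> powr (1 - p) * B * \<bar>v x\<bar> powr p" for x
  proof -
    have "\<bar>v x * \<psi> x\<bar> \<le> (\<delta> + \<delta> powr (1 - p) * \<bar>v x\<bar> powr p) * \<bar>\<psi> x\<bar>"
      unfolding abs_mult by (intro mult_right_mono powr_split_le p \<delta>) auto
    also have "\<dots> = \<delta> * \<bar>\<psi> x\<bar> + (\<delta> powr (1 - p) * \<bar>v x\<bar> powr p) * \<bar>\<psi> x\<bar>"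
      by (simp add: distrib_right)
    also have "\<dots> \<le> \<delta> * \<bar>\<psi> x\<bar> + (\<delta> powr (1 - p) * \<bar>v x\<bar> powr p) * B"
      by (intro add_left_mono mult_left_mono \<psi>) auto
    finally show ?thesis by (simp add: mult_ac)
  qed
  have i: "integrable M (\<lambda>x. \<delta> * \<bar>\<psi> x\<bar> + \<delta> powr (1 - p) * B * \<bar>v x\<bar> powr p)"
    using v \<psi> by auto
  then show vi: "integrable M (\<lambda>x. v x * \<psi> x)"
  proof (rule Bochner_Integration.integrable_bound)
    show "(\<lambda>x. v x * \<psi> x) \<in> borel_measurable M" using v \<psi>(1) by auto
    show "AE x in M. norm (v x * \<psi> x) \<le> norm (\<delta> * \<bar>\<psi> x\<bar> + \<delta> powr (1 - p) * B * \<bar>v x\<bar> powr p)"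
      using le by (intro AE_I2) (metis abs_ge_self order_trans real_norm_def)
  qed
  have "\<bar>\<integral>x. v x * \<psi> x \<partial>M\<bar> \<le> (\<integral>x. \<bar>v x * \<psi> x\<bar> \<partial>M)" by (rule integral_abs_bound)
  also have "\<dots> \<le> (\<integral>x. \<delta> * \<bar>\<psi> x\<bar> + \<delta> powr (1 - p) * B * \<bar>v x\<bar> powr p \<partial>M)"
    using vi by (intro integral_mono i le) auto
  also have "\<dots> = \<delta> * (\<integral>x. \<bar>\<psi> x\<bar> \<partial>M) + \<delta> powr (1 - p) * B * (\<integral>x. \<bar>v x\<bar> powr p \<partial>M)"
    using v \<psi>(1) by simp
  finally show "\<bar>\<integral>x. v x * \<psi> x \<partial>M\<bar> \<le> \<delta> * (\<integral>x. \<bar>\<psi> x\<bar> \<partial>M) + \<delta> powr (1 - p) * B * (\<integral>x. \<bar>v x\<bar> powr p \<partial>M)" .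
qed

lemma Lp_midpoint_integrable:
  fixes v w :: "'a \<Rightarrow> real"
  assumes p: "1 < p" and v: "v \<in> borel_measurable M" "integrable M (\<lambda>x. \<bar>v x\<bar> powr p)"
    and w: "w \<in> borel_measurable M" "integrable M (\<lambda>x. \<bar>w x\<bar> powr p)"
  shows "integrable M (\<lambda>x. \<bar>(v x + w x) / 2\<bar> powr p)"
proof (rule Bochner_Integration.integrable_bound)
  show "integrable M (\<lambda>x. (\<bar>v x\<bar> powr p + \<bar>w x\<bar> powr p) / 2)" using v w by simp
  show "(\<lambda>x. \<bar>(v x + w x) / 2\<bar> powr p) \<in> borel_measurable M" using v(1) w(1) by measurable
qed (use powr_midpoint_le[OF p] in \<open>auto intro!: AE_I2\<close>)

text \<open>This replaces weak compactness: the sets C n in the proof are convex, decreasing and contain the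
  tails of the sequence; by uniform convexity their almost minimal elements converge strongly.\<close>

lemma Lp_weak_limit:
  fixes v :: "nat \<Rightarrow> 'a \<Rightarrow> real" and \<Psi> :: "('a \<Rightarrow> real) set"
  assumes p: "1 < p" and v: "\<And>n. v n \<in> borel_measurable M"
    and K: "0 \<le> K" "\<And>n. (\<integral>\<^sup>+x. ennreal (\<bar>v n x\<bar> powr p) \<partial>M) \<le> ennreal K"
    and \<Psi>: "\<And>\<psi>. \<psi> \<in> \<Psi> \<Longrightarrow> integrable M \<psi>" "\<And>\<psi>. \<psi> \<in> \<Psi> \<Longrightarrow> \<exists>B. \<forall>x. \<bar>\<psi> x\<bar> \<le> B"
    and lim: "\<And>\<psi>. \<psi> \<in> \<Psi> \<Longrightarrow> (\<lambda>n. \<integral>x. v n x * \<psi> x \<partial>M) \<longlonglongrightarrow> T \<psi>"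
  obtains g where "g \<in> borel_measurable M" "(\<integral>\<^sup>+x. ennreal (\<bar>g x\<bar> powr p) \<partial>M) \<le> ennreal K"
    "\<And>\<psi>. \<psi> \<in> \<Psi> \<Longrightarrow> (\<integral>x. g x * \<psi> x \<partial>M) = T \<psi>"
proof -
  define X where "X = {u. u \<in> borel_measurable M \<and> integrable M (\<lambda>x. \<bar>u x\<bar> powr p)}"
  define J where "J u = (\<integral>x. \<bar>u x\<bar> powr p \<partial>M)" for u :: "'a \<Rightarrow> real"
  \<comment> \<open>A function belongs to \<open>C n\<close> if it inherits, for every \<psi>, each
    error bound valid for the tail from \<open>n\<close> on. Such conditions are convex, and any
    sequence with its \<open>n\<close>-th member in \<open>C n\<close> has pairings tending to
    \<open>T \<psi>\<close>.\<close>
  define C where "C n = {u \<in> X. \<forall>\<psi>\<in>\<Psi>. \<forall>\<alpha>. (\<forall>k\<ge>n. \<bar>(\<integral>x. v k x * \<psi> x \<partial>M) - T \<psi>\<bar> \<le> \<alpha>)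
      \<longrightarrow> \<bar>(\<integral>x. u x * \<psi> x \<partial>M) - T \<psi>\<bar> \<le> \<alpha>}" for n
  have nnJ: "(\<integral>\<^sup>+x. ennreal (\<bar>u x\<bar> powr p) \<partial>M) = ennreal (J u)" if "u \<in> X" for u
    using that unfolding J_def X_def by (intro nn_integral_eq_integral) auto
  have J0: "0 \<le> J u" for u by (simp add: J_def)
  have XI: "u \<in> X" if "u \<in> borel_measurable M" "(\<integral>\<^sup>+x. ennreal (\<bar>u x\<bar> powr p) \<partial>M) \<le> ennreal c" for u c
  proof -
    have "integrable M (\<lambda>x. \<bar>u x\<bar> powr p)"
    proof (rule integrableI_bounded)
      show "(\<lambda>x. \<bar>u x\<bar> powr p) \<in> borel_measurable M" by (rule measurable_abs_powr[OF that(1)])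
      show "(\<integral>\<^sup>+x. ennreal (norm (\<bar>u x\<bar> powr p)) \<partial>M) < \<infinity>"
        using that(2) by (simp add: le_less_trans[OF _ ennreal_less_top])
    qed
    then show ?thesis using that by (simp add: X_def)
  qed
  have vX: "v n \<in> X" for n using XI[OF v K(2)] .
  have vC: "v n \<in> C n" for n using vX by (auto simp: C_def)
  have JvK: "J (v n) \<le> K" for n
    using K(2)[of n] nnJ[OF vX[of n]] K(1) by (simp add: ennreal_le_iff)
  have Cmono: "C m \<subseteq> C n" if "n \<le> m" for m n
    unfolding C_def using that by (auto intro: order_trans)
  have pair: "integrable M (\<lambda>x. u x * \<psi> x)" if "u \<in> X" "\<psi> \<in> \<Psi>" for u \<psi>
    using Lp_pairing_bound(1)[of p 1 u M \<psi>] that \<Psi> p unfolding X_def by fastforce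
  have mid: "(\<lambda>x. (u x + w x) / 2) \<in> C n" if "u \<in> C n" "w \<in> C n" for u w n
  proof -
    have uw: "u \<in> X" "w \<in> X" using that by (auto simp: C_def)
    have "(\<lambda>x. (u x + w x) / 2) \<in> X"
      using uw Lp_midpoint_integrable[OF p, of u M w] by (auto simp: X_def)
    moreover have "\<bar>(\<integral>x. (u x + w x) / 2 * \<psi> x \<partial>M) - T \<psi>\<bar> \<le> \<alpha>"
      if "\<psi> \<in> \<Psi>" "\<forall>k\<ge>n. \<bar>(\<integral>x. v k x * \<psi> x \<partial>M) - T \<psi>\<bar> \<le> \<alpha>" for \<psi> \<alpha>
    proof -
      have "(\<integral>x. (u x + w x) / 2 * \<psi> x \<partial>M) = (\<integral>x. u x * \<psi> x / 2 + w x * \<psi> x / 2 \<partial>M)"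
        by (intro Bochner_Integration.integral_cong) (auto simp: field_simps)
      also have "\<dots> = (\<integral>x. u x * \<psi> x \<partial>M) / 2 + (\<integral>x. w x * \<psi> x \<partial>M) / 2"
        using pair uw that by simp
      finally have eq: "(\<integral>x. (u x + w x) / 2 * \<psi> x \<partial>M) = (\<integral>x. u x * \<psi> x \<partial>M) / 2 + (\<integral>x. w x * \<psi> x \<partial>M) / 2" .
      have "\<bar>(\<integral>x. u x * \<psi> x \<partial>M) - T \<psi>\<bar> \<le> \<alpha>" "\<bar>(\<integral>x. w x * \<psi> x \<partial>M) - T \<psi>\<bar> \<le> \<alpha>"
        using \<open>u \<in> C n\<close> \<open>w \<in> C n\<close> that unfolding C_def by auto
      then show ?thesis unfolding eq by linarith
    qed
    ultimately show ?thesis by (auto simp: C_def)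
  qed
  \<comment> \<open>The sets shrink, so their least energies \<open>d n\<close> increase; they stay
    below \<open>K\<close> because \<open>v n\<close> lies in \<open>C n\<close>. Convergence of
    \<open>d\<close> is what forces almost minimal elements to approach each other.\<close>
  define d where "d n = Inf (J ` C n)" for n
  have bdd: "bdd_below (J ` C n)" for n using J0 by (intro bdd_belowI[of _ 0]) auto
  have d_le: "d n \<le> J u" if "u \<in> C n" for u n
    unfolding d_def using that by (intro cInf_lower bdd) auto
  have dK: "d n \<le> K" for n using d_le[OF vC] JvK order_trans by blast
  have d_mono: "d n \<le> d m" if "n \<le> m" for n m
    unfolding d_def by (intro cInf_superset_mono bdd image_mono Cmono that) (use vC in auto)
  obtain D where D: "d \<longlonglongrightarrow> D" "\<And>n. d n \<le> D"
    using incseq_convergent[of d K] d_mono dK unfolding incseq_def by blast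
  have "\<exists>u\<in>C n. J u < d n + 1 / real (Suc n)" for n
    using cInf_lessD[of "J ` C n" "d n + 1 / real (Suc n)"] vC[of n] unfolding d_def by auto
  then obtain w where w: "\<And>n. w n \<in> C n" "\<And>n. J (w n) < d n + 1 / real (Suc n)" by metis
  have wX: "w n \<in> X" for n using w(1)[of n] by (simp add: C_def)
  have wm: "w n \<in> borel_measurable M" for n using wX by (simp add: X_def)
  have JwK: "J (w n) \<le> K + 1 / real (Suc n)" for n using w(2)[of n] dK[of n] by linarith
  have wlim: "(\<lambda>n. \<integral>x. w n x * \<psi> x \<partial>M) \<longlonglongrightarrow> T \<psi>" if \<psi>: "\<psi> \<in> \<Psi>" for \<psi>
  proof (rule LIMSEQ_I)
    fix e :: real assume "0 < e"
    then obtain N where N: "\<And>k. k \<ge> N \<Longrightarrow> \<bar>(\<integral>x. v k x * \<psi> x \<partial>M) - T \<psi>\<bar> \<le> e / 2"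
      using LIMSEQ_D[OF lim[OF \<psi>], of "e / 2"] unfolding real_norm_def by (metis half_gt_zero less_imp_le)
    have "\<bar>(\<integral>x. w n x * \<psi> x \<partial>M) - T \<psi>\<bar> \<le> e / 2" if "n \<ge> N" for n
    proof -
      have "\<forall>k\<ge>n. \<bar>(\<integral>x. v k x * \<psi> x \<partial>M) - T \<psi>\<bar> \<le> e / 2" using N that by (meson order_trans)
      then show ?thesis using w(1)[of n] \<psi> unfolding C_def by blast
    qed
    then show "\<exists>N. \<forall>n\<ge>N. norm ((\<integral>x. w n x * \<psi> x \<partial>M) - T \<psi>) < e"
      using \<open>0 < e\<close> by (intro exI[of _ N]) fastforce
  qed
  have Cauchy: "\<exists>N. \<forall>m\<ge>N. \<forall>n\<ge>N. (\<integral>\<^sup>+x. ennreal (\<bar>w m x - w n x\<bar> powr p) \<partial>M) \<le> ennreal e" if e: "0 < e" for e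
  proof -
    \<comment> \<open>Energies of the \<open>w n\<close> are at most K + 1, so the \<eta>-term is at
      most \<eta> times 2 (K + 1), which is e/2.\<close>
    define \<eta> where "\<eta> = e / (4 * (K + 1))"
    have \<eta>: "0 < \<eta>" using e K(1) by (simp add: \<eta>_def)
    obtain \<kappa> where \<kappa>: "0 < \<kappa>" "\<And>a b::real. \<bar>a - b\<bar> powr p \<le> \<eta> * (\<bar>a\<bar> powr p + \<bar>b\<bar> powr p)
       + \<kappa> * ((\<bar>a\<bar> powr p + \<bar>b\<bar> powr p) / 2 - \<bar>(a + b) / 2\<bar> powr p)"
      using powr_uniform_convexity[OF p \<eta>] by blast
    have "(\<lambda>n. \<kappa> * (D - d n + 1 / real (Suc n))) \<longlonglongrightarrow> \<kappa> * (D - D + 0)"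
      by (intro tendsto_intros D(1) LIMSEQ_Suc[OF lim_1_over_n])
    then have "\<forall>\<^sub>F n in sequentially. \<kappa> * (D - d n + 1 / real (Suc n)) < e / 2"
      using e by (intro order_tendstoD(2)) auto
    then obtain N where N: "\<kappa> * (D - d N + 1 / real (Suc N)) < e / 2"
      by (auto simp: eventually_sequentially)
    have "(\<integral>\<^sup>+x. ennreal (\<bar>w m x - w n x\<bar> powr p) \<partial>M) \<le> ennreal e" if mn: "m \<ge> N" "n \<ge> N" for m n
    proof -
      have CN: "w m \<in> C N" "w n \<in> C N" using w(1) Cmono mn by blast+
      have midX: "(\<lambda>x. (w m x + w n x) / 2) \<in> X" using mid[OF CN] by (simp add: C_def)
      \<comment> \<open>The midpoint stays in \<open>C N\<close>, so its energy is at least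
        \<open>d N\<close>, while both end points have energy at most D + 1/(N+1); the convexity
        defect is at most the difference.\<close>
      have dN: "d N \<le> J (\<lambda>x. (w m x + w n x) / 2)" by (rule d_le[OF mid[OF CN]])
      have Jw: "J (w k) \<le> D + 1 / real (Suc N)" "J (w k) \<le> K + 1" if "k \<ge> N" for k
      proof -
        have "1 / real (Suc k) \<le> 1 / real (Suc N)" "1 / real (Suc k) \<le> 1" using that by (auto simp: field_simps)
        then show "J (w k) \<le> D + 1 / real (Suc N)" "J (w k) \<le> K + 1"
          using w(2)[of k] D(2)[of k] JwK[of k] by linarith+
      qed
      let ?h = "\<lambda>x. \<eta> * (\<bar>w m x\<bar> powr p + \<bar>w n x\<bar> powr p)
         + \<kappa> * ((\<bar>w m x\<bar> powr p + \<bar>w n x\<bar> powr p) / 2 - \<bar>(w m x + w n x) / 2\<bar> powr p)"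
      have ints: "integrable M (\<lambda>x. \<bar>w m x\<bar> powr p)" "integrable M (\<lambda>x. \<bar>w n x\<bar> powr p)"
        "integrable M (\<lambda>x. \<bar>(w m x + w n x) / 2\<bar> powr p)"
        using wX midX by (auto simp: X_def)
      have hi: "integrable M ?h"
        by (intro Bochner_Integration.integrable_add Bochner_Integration.integrable_diff
            integrable_mult_right integrable_divide ints)
      have h0: "0 \<le> ?h x" for x
        using \<kappa>(2)[of "w m x" "w n x"] powr_ge_zero[of "\<bar>w m x - w n x\<bar>" p] by linarith
      have "(\<integral>\<^sup>+x. ennreal (\<bar>w m x - w n x\<bar> powr p) \<partial>M) \<le> (\<integral>\<^sup>+x. ennreal (?h x) \<partial>M)"
        by (intro nn_integral_mono ennreal_leI \<kappa>(2))
      also have "\<dots> = ennreal (\<integral>x. ?h x \<partial>M)"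
        by (rule nn_integral_eq_integral[OF hi]) (use h0 in auto)
      also have "(\<integral>x. ?h x \<partial>M) = \<eta> * (J (w m) + J (w n)) + \<kappa> * ((J (w m) + J (w n)) / 2 - J (\<lambda>x. (w m x + w n x) / 2))"
        unfolding J_def using ints
        by (subst Bochner_Integration.integral_add; (intro Bochner_Integration.integrable_add Bochner_Integration.integrable_diff
            integrable_mult_right integrable_divide ints)?) simp
      also have "\<dots> \<le> e"
      proof -
        have "\<eta> * (J (w m) + J (w n)) \<le> \<eta> * (2 * (K + 1))"
          using Jw(2)[OF mn(1)] Jw(2)[OF mn(2)] \<eta> by (intro mult_left_mono) auto
        also have "\<dots> = e / 2" using K(1) by (simp add: \<eta>_def field_simps)
        finally have 1: "\<eta> * (J (w m) + J (w n)) \<le> e / 2" .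
        have "\<kappa> * ((J (w m) + J (w n)) / 2 - J (\<lambda>x. (w m x + w n x) / 2)) \<le> \<kappa> * (D - d N + 1 / real (Suc N))"
        proof (rule mult_left_mono)
          show "(J (w m) + J (w n)) / 2 - J (\<lambda>x. (w m x + w n x) / 2) \<le> D - d N + 1 / real (Suc N)"
            using Jw(1)[OF mn(1)] Jw(1)[OF mn(2)] dN by argo
        qed (use \<kappa>(1) in simp)
        with N 1 show ?thesis by linarith
      qed
      finally show ?thesis using ennreal_leI by blast
    qed
    then show ?thesis by blast
  qed
  obtain r g where r: "strict_mono r" and gm: "g \<in> borel_measurable M"
    and ae: "AE x in M. (\<lambda>k. w (r k) x) \<longlonglongrightarrow> g x"
    by (rule Lp_Cauchy_subseq[of p w M, OF less_imp_le[OF p] wm Cauchy])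
  have "(\<integral>\<^sup>+x. ennreal (\<bar>g x\<bar> powr p) \<partial>M) \<le> ennreal K"
  proof (rule Fatou_powr[OF _ _ ae])
    show "\<forall>\<^sub>F k in sequentially. (\<integral>\<^sup>+x. ennreal (\<bar>w (r k) x\<bar> powr p) \<partial>M) \<le> ennreal (K + 1 / real (Suc (r k)))"
      unfolding nnJ[OF wX] by (intro always_eventually allI ennreal_leI JwK)
    have "(\<lambda>n. K + 1 / real (Suc n)) \<longlonglongrightarrow> K + 0"
      by (intro tendsto_intros LIMSEQ_Suc[OF lim_1_over_n])
    from LIMSEQ_subseq_LIMSEQ[OF this r]
    show "(\<lambda>k. K + 1 / real (Suc (r k))) \<longlonglongrightarrow> K" by (simp add: o_def)
  qed (use p wm in auto)
  moreover have "(\<integral>x. g x * \<psi> x \<partial>M) = T \<psi>" if \<psi>: "\<psi> \<in> \<Psi>" for \<psi>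
  proof -
    obtain B where B: "\<And>x. \<bar>\<psi> x\<bar> \<le> B" using \<Psi>(2)[OF \<psi>] by blast
    have gX: "g \<in> X" using XI[OF gm calculation] .
    have B0: "0 \<le> B" using B[of undefined] by linarith
    define I where "I = (\<integral>x. \<bar>\<psi> x\<bar> \<partial>M)"
    have I0: "0 \<le> I" by (simp add: I_def)
    have "(\<lambda>n. \<integral>x. w n x * \<psi> x \<partial>M) \<longlonglongrightarrow> (\<integral>x. g x * \<psi> x \<partial>M)"
    proof (rule LIMSEQ_I)
      fix \<epsilon> :: real assume \<epsilon>: "0 < \<epsilon>"
      \<comment> \<open>With \<open>e\<close> below, each of the two terms of
        \<open>Lp_pairing_bound\<close> is at most \<epsilon>/3. The added 1 in I + 1 and B + 1
        avoids division by zero.\<close>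
      define \<delta> where "\<delta> = \<epsilon> / (3 * (I + 1))"
      have \<delta>: "0 < \<delta>" using \<epsilon> I0 by (simp add: \<delta>_def)
      define e where "e = \<epsilon> / (3 * (\<delta> powr (1 - p) * (B + 1)))"
      have e: "0 < e" using \<epsilon> B0 \<delta> by (simp add: e_def)
      obtain N where N: "\<And>m n. m \<ge> N \<Longrightarrow> n \<ge> N \<Longrightarrow> (\<integral>\<^sup>+x. ennreal (\<bar>w m x - w n x\<bar> powr p) \<partial>M) \<le> ennreal e"
        using Cauchy[OF e] by blast
      have "norm ((\<integral>x. w n x * \<psi> x \<partial>M) - (\<integral>x. g x * \<psi> x \<partial>M)) < \<epsilon>" if n: "n \<ge> N" for n
      proof -
        have "(\<integral>\<^sup>+x. ennreal (\<bar>g x - w n x\<bar> powr p) \<partial>M) \<le> ennreal e"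
        \<comment> \<open>Almost everywhere convergence holds along \<open>r\<close> only; with
          \<open>n\<close> fixed, Fatou along \<open>r\<close> compares \<open>g\<close> with every
          late member of the full sequence.\<close>
        proof (rule Fatou_powr[where u = "\<lambda>k x. w (r k) x - w n x" and c = "\<lambda>_. e"])
          show "AE x in M. (\<lambda>k. w (r k) x - w n x) \<longlonglongrightarrow> g x - w n x"
            using ae by eventually_elim (intro tendsto_intros)
          show "\<forall>\<^sub>F k in sequentially. (\<integral>\<^sup>+x. ennreal (\<bar>w (r k) x - w n x\<bar> powr p) \<partial>M) \<le> ennreal e"
            using seq_suble[OF r] n by (intro eventually_sequentiallyI[of N] N) (auto intro: order_trans)
        qed (use p wm in auto)
        then have gw: "(\<lambda>x. g x - w n x) \<in> X" "J (\<lambda>x. g x - w n x) \<le> e"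
        proof -
          assume *: "(\<integral>\<^sup>+x. ennreal (\<bar>g x - w n x\<bar> powr p) \<partial>M) \<le> ennreal e"
          show X': "(\<lambda>x. g x - w n x) \<in> X" by (rule XI[OF _ *]) (use gm wm in auto)
          show "J (\<lambda>x. g x - w n x) \<le> e" using * nnJ[OF X'] e by (simp add: ennreal_le_iff)
        qed
        have "\<bar>\<integral>x. (g x - w n x) * \<psi> x \<partial>M\<bar> \<le> \<delta> * I + \<delta> powr (1 - p) * B * J (\<lambda>x. g x - w n x)"
          unfolding I_def J_def
          by (rule Lp_pairing_bound(2)) (use p \<delta> gw \<Psi>(1)[OF \<psi>] B in \<open>auto simp: X_def\<close>)
        also have "\<dots> \<le> \<delta> * I + \<delta> powr (1 - p) * (B + 1) * e"
          using gw B0 J0[of "\<lambda>x. g x - w n x"] by (intro add_left_mono mult_mono) auto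
        also have "\<delta> powr (1 - p) * (B + 1) * e = \<epsilon> / 3"
          using B0 \<delta> by (simp add: e_def)
        also have "\<delta> * I + \<epsilon> / 3 < \<epsilon>"
        proof -
          have "\<delta> * I \<le> \<epsilon> / 3" using \<epsilon> I0 by (simp add: \<delta>_def field_simps)
          then show ?thesis using \<epsilon> by linarith
        qed
        finally have "\<bar>\<integral>x. (g x - w n x) * \<psi> x \<partial>M\<bar> < \<epsilon>" .
        moreover have "(\<integral>x. (g x - w n x) * \<psi> x \<partial>M) = (\<integral>x. g x * \<psi> x \<partial>M) - (\<integral>x. w n x * \<psi> x \<partial>M)"
          using pair[OF gX \<psi>] pair[OF wX \<psi>] by (simp add: left_diff_distrib)
        ultimately show ?thesis by (simp add: abs_minus_commute)
      qed
      then show "\<exists>N. \<forall>n\<ge>N. norm ((\<integral>x. w n x * \<psi> x \<partial>M) - (\<integral>x. g x * \<psi> x \<partial>M)) < \<epsilon>" by blast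
    qed
    from LIMSEQ_unique[OF this wlim[OF \<psi>]] show ?thesis .
  qed
  ultimately show thesis using gm that by blast
qed

section \<open>Gradient bounds from difference quotients\<close>

text \<open>This is E(h) of the overview.\<close>

definition diff_energy :: "real \<Rightarrow> ('a::euclidean_space \<Rightarrow> real) \<Rightarrow> 'a \<Rightarrow> ennreal" where
  "diff_energy p f h = (\<integral>\<^sup>+x. ennreal (\<bar>f (x + h) - f x\<bar> powr p) \<partial>lebesgue)"

lemma ennreal_abs_powr_measurable:
  "u \<in> borel_measurable M \<Longrightarrow> (\<lambda>x. ennreal (\<bar>u x\<bar> powr p)) \<in> borel_measurable M"
  by (intro measurable_compose[OF _ measurable_ennreal] measurable_abs_powr)

lemma difference_measurable:
  "f \<in> borel_measurable lebesgue \<Longrightarrow> (\<lambda>x. f (x + h) - f (x + k) :: real) \<in> borel_measurable lebesgue"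
  by (intro borel_measurable_diff measurable_translate)

text \<open>Shifting the integration variable by \<open>k\<close> turns the difference into f(x+h) -
  f(x+k), which is split at f(x).\<close>

lemma diff_energy_diff_le:
  assumes f: "f \<in> borel_measurable lebesgue" and p: "0 \<le> p"
  shows "diff_energy p f (h - k) \<le> ennreal (2 powr p) * (diff_energy p f h + diff_energy p f k)"
proof -
  have m: "(\<lambda>x. f (x + h) - f x) \<in> borel_measurable lebesgue" for h
    using difference_measurable[OF f, of h 0] by simp
  have "diff_energy p f (h - k) = (\<integral>\<^sup>+x. ennreal (\<bar>f (x + k + (h - k)) - f (x + k)\<bar> powr p) \<partial>lebesgue)"
    unfolding diff_energy_def
    using nn_integral_translate[of "\<lambda>x. ennreal (\<bar>f (x + (h - k)) - f x\<bar> powr p)" k] m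
    by (simp add: ennreal_abs_powr_measurable)
  also have "\<dots> = (\<integral>\<^sup>+x. ennreal (\<bar>f (x + h) - f (x + k)\<bar> powr p) \<partial>lebesgue)"
    by (simp add: add.assoc)
  also have "\<dots> \<le> (\<integral>\<^sup>+x. ennreal (2 powr p) * (ennreal (\<bar>f (x + h) - f x\<bar> powr p) + ennreal (\<bar>f (x + k) - f x\<bar> powr p)) \<partial>lebesgue)"
  proof (rule nn_integral_mono)
    fix x
    have "\<bar>f (x + h) - f (x + k)\<bar> powr p \<le> 2 powr p * (\<bar>f (x + h) - f x\<bar> powr p + \<bar>f (x + k) - f x\<bar> powr p)"
      using powr_add_le[OF p, of "f (x + h) - f x" "f x - f (x + k)"] by (simp add: abs_minus_commute)
    then show "ennreal (\<bar>f (x + h) - f (x + k)\<bar> powr p) \<le>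
        ennreal (2 powr p) * (ennreal (\<bar>f (x + h) - f x\<bar> powr p) + ennreal (\<bar>f (x + k) - f x\<bar> powr p))"
      by (simp flip: ennreal_plus ennreal_mult add: ennreal_leI)
  qed
  also have "\<dots> = ennreal (2 powr p) * (diff_energy p f h + diff_energy p f k)"
    unfolding diff_energy_def using m
    by (simp add: nn_integral_cmult nn_integral_add ennreal_abs_powr_measurable)
  finally show ?thesis .
qed

text \<open>A vector minus its mirror image may be a negative multiple of b, while lower bounds for
  E are available for positive multiples only.\<close>

lemma diff_energy_uminus:
  assumes f: "f \<in> borel_measurable lebesgue"
  shows "diff_energy p f (- h) = diff_energy p f h"
proof -
  have "(\<lambda>x. f (x + - h) - f x) \<in> borel_measurable lebesgue"
    using difference_measurable[OF f, of "- h" 0] by simp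
  then have "diff_energy p f (- h) = (\<integral>\<^sup>+x. ennreal (\<bar>f (x + h + - h) - f (x + h)\<bar> powr p) \<partial>lebesgue)"
    unfolding diff_energy_def
    using nn_integral_translate[of "\<lambda>x. ennreal (\<bar>f (x + - h) - f x\<bar> powr p)" h]
      ennreal_abs_powr_measurable by metis
  then show ?thesis by (simp add: diff_energy_def abs_minus_commute)
qed

text \<open>For f merely Lebesgue measurable, joint measurability of (x,h) |-> f(x+h) is not
  immediate. A Borel representative changes no E(h), as translations preserve a.e. equality, and for
  it measurability in h is part of Tonelli's theorem.\<close>

lemma diff_energy_measurable:
  fixes f :: "'a::euclidean_space \<Rightarrow> real"
  assumes f: "f \<in> borel_measurable lebesgue"
  shows "diff_energy p f \<in> borel_measurable lebesgue"
proof -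
  obtain f' where f' [measurable]: "f' \<in> borel_measurable lborel" and ae: "AE x in lborel. f x = f' x"
    using completion_ex_borel_measurable_real[OF f] by blast
  have ae': "AE x in lebesgue. f x = f' x" using ae by (rule AE_completion)
  have f'm [measurable]: "f' \<in> borel_measurable borel" using f' by simp
  have "diff_energy p f h = (\<integral>\<^sup>+x. ennreal (\<bar>f' (x + h) - f' x\<bar> powr p) \<partial>lborel)" for h
  proof -
    have "AE x in lebesgue. f (x + h) = f' (x + h)" by (rule AE_translate[OF ae'])
    with ae' have "AE x in lebesgue. ennreal (\<bar>f (x + h) - f x\<bar> powr p) = ennreal (\<bar>f' (x + h) - f' x\<bar> powr p)"
      by eventually_elim simp
    then show ?thesis
      unfolding diff_energy_def by (subst nn_integral_completion[symmetric]) (rule nn_integral_cong_AE)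
  qed
  moreover have "(\<lambda>h. \<integral>\<^sup>+x. ennreal (\<bar>f' (x + h) - f' x\<bar> powr p) \<partial>lborel) \<in> borel_measurable borel"
    by (rule lborel.borel_measurable_nn_integral) measurable
  ultimately have "diff_energy p f \<in> borel_measurable borel" by presburger
  then show ?thesis by (intro measurable_completion) simp
qed

section \<open>Limits of difference quotients along a sequence of steps in one direction\<close>

context
  fixes p K :: real and f :: "'a::euclidean_space \<Rightarrow> real" and t :: "nat \<Rightarrow> real" and b :: 'a
  assumes p: "1 \<le> p" and f: "f \<in> Lp p" and t: "\<And>n. 0 < t n" "t \<longlonglongrightarrow> 0" and K: "0 \<le> K"
    and le: "\<And>n. diff_energy p f (t n *\<^sub>R b) \<le> ennreal (K * t n powr p)"
begin

lemma difference_quotient_norm: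
  "(\<integral>\<^sup>+x. ennreal (\<bar>(f (x + t n *\<^sub>R b) - f x) / t n\<bar> powr p) \<partial>lebesgue) \<le> ennreal K"
proof -
  have m: "(\<lambda>x. f (x + t n *\<^sub>R b) - f x) \<in> borel_measurable lebesgue"
    using Lp_difference[OF p f] by (simp add: Lp_def)
  have "(\<integral>\<^sup>+x. ennreal (\<bar>(f (x + t n *\<^sub>R b) - f x) / t n\<bar> powr p) \<partial>lebesgue) =
      (\<integral>\<^sup>+x. ennreal (1 / t n powr p) * ennreal (\<bar>f (x + t n *\<^sub>R b) - f x\<bar> powr p) \<partial>lebesgue)"
    using t(1)[of n] by (intro nn_integral_cong) (simp add: abs_divide powr_divide flip: ennreal_mult)
  also have "\<dots> = ennreal (1 / t n powr p) * diff_energy p f (t n *\<^sub>R b)"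
    unfolding diff_energy_def by (intro nn_integral_cmult ennreal_abs_powr_measurable m)
  also have "\<dots> \<le> ennreal (1 / t n powr p) * ennreal (K * t n powr p)"
    by (intro mult_left_mono le) simp
  also have "\<dots> = ennreal K" using t(1)[of n] K by (simp flip: ennreal_mult)
  finally show ?thesis .
qed

lemma difference_quotient_limit:
  assumes \<psi>: "\<psi> \<in> C1c"
  shows "(\<lambda>n. \<integral>x. (f (x + t n *\<^sub>R b) - f x) / t n * \<psi> x \<partial>lebesgue)
    \<longlonglongrightarrow> - (\<integral>x. f x * frechet_derivative \<psi> (at x) b \<partial>lebesgue)"
proof -
  have "filterlim t (at 0) sequentially"
    using t by (simp add: filterlim_at less_imp_neq[symmetric])
  from filterlim_compose[OF difference_quotient_pairing[OF p f \<psi>, of b] this]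
  have "(\<lambda>n. \<integral>x. f x * ((\<psi> (x - t n *\<^sub>R b) - \<psi> x) / t n) \<partial>lebesgue)
    \<longlonglongrightarrow> - (\<integral>x. f x * frechet_derivative \<psi> (at x) b \<partial>lebesgue)" .
  moreover have "(\<integral>x. f x * ((\<psi> (x - t n *\<^sub>R b) - \<psi> x) / t n) \<partial>lebesgue) =
      (\<integral>x. (f (x + t n *\<^sub>R b) - f x) / t n * \<psi> x \<partial>lebesgue)" for n
  proof -
    note i = C1c_integrable_mult(1)[OF p f C1c_translate(1)[OF \<psi>, of "t n *\<^sub>R b"]]
      C1c_integrable_mult(1)[OF p f \<psi>] C1c_integrable_mult(1)[OF p Lp_translate[OF f, of "t n *\<^sub>R b"] \<psi>]
    have "(\<integral>x. f x * ((\<psi> (x - t n *\<^sub>R b) - \<psi> x) / t n) \<partial>lebesgue) =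
        (\<integral>x. (f x * \<psi> (x - t n *\<^sub>R b) - f x * \<psi> x) / t n \<partial>lebesgue)"
      by (intro Bochner_Integration.integral_cong) (auto simp: right_diff_distrib)
    also have "\<dots> = ((\<integral>x. f x * \<psi> (x - t n *\<^sub>R b) \<partial>lebesgue) - (\<integral>x. f x * \<psi> x \<partial>lebesgue)) / t n"
      using i by simp
    also have "\<dots> = ((\<integral>x. f (x + t n *\<^sub>R b) * \<psi> x \<partial>lebesgue) - (\<integral>x. f x * \<psi> x \<partial>lebesgue)) / t n"
      by (simp add: translate_pairing[OF f \<psi>])
    also have "\<dots> = (\<integral>x. (f (x + t n *\<^sub>R b) * \<psi> x - f x * \<psi> x) / t n \<partial>lebesgue)"
      using i by simp
    also have "\<dots> = (\<integral>x. (f (x + t n *\<^sub>R b) - f x) / t n * \<psi> x \<partial>lebesgue)"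
      by (intro Bochner_Integration.integral_cong) (auto simp: left_diff_distrib)
    finally show ?thesis .
  qed
  ultimately show ?thesis by (simp only:)
qed

text \<open>The partial derivative is the weak limit of the difference quotients. Their pairings
  converge for every $C^1_c$ function already, so no subsequence has to be extracted for the
  distributional limit.\<close>

lemma weak_partial_derivative:
  assumes p1: "1 < p"
  obtains g where "g \<in> borel_measurable lebesgue" "(\<integral>\<^sup>+x. ennreal (\<bar>g x\<bar> powr p) \<partial>lebesgue) \<le> ennreal K"
    "\<And>\<psi>. \<psi> \<in> C1c \<Longrightarrow> (\<integral>x. f x * frechet_derivative \<psi> (at x) b \<partial>lebesgue) = - (\<integral>x. g x * \<psi> x \<partial>lebesgue)"
proof (rule Lp_weak_limit[OF p1, where v = "\<lambda>n x. (f (x + t n *\<^sub>R b) - f x) / t n" and \<Psi> = C1c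
      and T = "\<lambda>\<psi>. - (\<integral>x. f x * frechet_derivative \<psi> (at x) b \<partial>lebesgue)" and K = K and M = lebesgue])
  show "(\<lambda>x. (f (x + t n *\<^sub>R b) - f x) / t n) \<in> borel_measurable lebesgue" for n
    using Lp_difference[OF p f, of "t n *\<^sub>R b"] by (auto simp: Lp_def)
  show "integrable lebesgue \<psi>" if "\<psi> \<in> C1c" for \<psi> :: "'a \<Rightarrow> real"
  proof -
    have "integrable lebesgue (\<lambda>x. \<bar>\<psi> x\<bar> powr 1)" by (rule C1c_powr_integrable[OF that zero_less_one])
    then have "integrable lebesgue (\<lambda>x. \<bar>\<psi> x\<bar>)" by simp
    then show ?thesis using integrable_abs_cancel[OF _ C1c_measurable(1)[OF that]] by blast
  qed
  show "\<exists>B. \<forall>x. \<bar>\<psi> x\<bar> \<le> B" if "\<psi> \<in> C1c" for \<psi> :: "'a \<Rightarrow> real"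
    using C1c_bounded[OF that] by (metis real_norm_def)
qed (use K difference_quotient_norm difference_quotient_limit that in auto)

text \<open>For p = 1 there need not be a limit function, but none is required: total variation is
  itself defined by testing, so the bound passes to the limit for each \<psi>.\<close>

lemma directional_variation_le:
  assumes p1: "p = 1" and \<psi>: "\<psi> \<in> C1c" and \<psi>1: "\<And>x. \<bar>\<psi> x\<bar> \<le> 1"
  shows "\<bar>\<integral>x. f x * frechet_derivative \<psi> (at x) b \<partial>lebesgue\<bar> \<le> K"
proof -
  have "\<bar>\<integral>x. (f (x + t n *\<^sub>R b) - f x) / t n * \<psi> x \<partial>lebesgue\<bar> \<le> K" for n
  proof -
    let ?v = "\<lambda>x. (f (x + t n *\<^sub>R b) - f x) / t n"
    have vL: "?v \<in> Lp p" using Lp_cmult[OF Lp_difference[OF p f, of "t n *\<^sub>R b"], of "1 / t n"] by simp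
    have "\<bar>\<integral>x. ?v x * \<psi> x \<partial>lebesgue\<bar> \<le> (\<integral>x. \<bar>?v x * \<psi> x\<bar> \<partial>lebesgue)" by (rule integral_abs_bound)
    also have "\<dots> \<le> (\<integral>x. \<bar>?v x\<bar> powr p \<partial>lebesgue)"
    proof (rule integral_mono)
      show "integrable lebesgue (\<lambda>x. \<bar>?v x * \<psi> x\<bar>)"
        by (rule integrable_abs[OF C1c_integrable_mult(1)[OF p vL \<psi>]])
      show "integrable lebesgue (\<lambda>x. \<bar>?v x\<bar> powr p)" using vL by (simp add: Lp_def)
      show "\<bar>?v x * \<psi> x\<bar> \<le> \<bar>?v x\<bar> powr p" for x
        using mult_left_mono[OF \<psi>1[of x], of "\<bar>?v x\<bar>"] p1 by (simp add: abs_mult)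
    qed
    also have "\<dots> \<le> K"
      using difference_quotient_norm[of n] nn_integral_eq_integral_abs_powr[OF vL] K by (simp add: ennreal_le_iff)
    finally show ?thesis .
  qed
  then have "\<bar>- (\<integral>x. f x * frechet_derivative \<psi> (at x) b \<partial>lebesgue)\<bar> \<le> K"
    by (intro LIMSEQ_le_const2[OF tendsto_rabs[OF difference_quotient_limit[OF \<psi>]]]) auto
  then show ?thesis by simp
qed

end

lemma C1c_component:
  fixes \<phi> :: "'a::euclidean_space \<Rightarrow> 'a"
  assumes \<phi>: "\<phi> \<in> C1c"
  shows "(\<lambda>x. \<phi> x \<bullet> b) \<in> C1c"
    "frechet_derivative (\<lambda>x. \<phi> x \<bullet> b) (at x) v = frechet_derivative \<phi> (at x) v \<bullet> b"
proof -
  have d: "((\<lambda>x. \<phi> x \<bullet> b) has_derivative (\<lambda>v. frechet_derivative \<phi> (at x) v \<bullet> b)) (at x)" for x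
    by (intro has_derivative_inner_left C1c_has_derivative \<phi>)
  have c: "continuous_on UNIV (\<lambda>x. frechet_derivative \<phi> (at x) v \<bullet> b)" for v
    using \<phi> by (intro continuous_on_inner) (auto simp: C1c_def)
  have "bounded {x. \<phi> x \<noteq> 0}" using \<phi> by (simp add: C1c_def)
  then have bd: "bounded {x. \<phi> x \<bullet> b \<noteq> 0}" by (rule bounded_subset) auto
  show "(\<lambda>x. \<phi> x \<bullet> b) \<in> C1c" using C1cI(1)[OF d c bd] .
  show "frechet_derivative (\<lambda>x. \<phi> x \<bullet> b) (at x) v = frechet_derivative \<phi> (at x) v \<bullet> b"
    using C1cI(2)[OF d c bd, of x] by simp
qed

text \<open>With N the dimension, the norm is at most N times the largest coordinate, whose p-th
  power is one summand.\<close>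

lemma norm_powr_le_sum:
  fixes y :: "'a::euclidean_space"
  assumes p: "1 \<le> p"
  shows "norm y powr p \<le> real DIM('a) powr p * (\<Sum>b\<in>Basis. \<bar>y \<bullet> b\<bar> powr p)"
proof -
  define m where "m = Max ((\<lambda>b. \<bar>y \<bullet> b\<bar>) ` Basis)"
  have m: "\<bar>y \<bullet> b\<bar> \<le> m" if "b \<in> Basis" for b unfolding m_def using that by (intro Max_ge) auto
  have "m \<in> (\<lambda>b. \<bar>y \<bullet> b\<bar>) ` Basis" unfolding m_def by (intro Max_in) auto
  then obtain b0 where b0: "b0 \<in> Basis" "m = \<bar>y \<bullet> b0\<bar>" by auto
  have "norm y \<le> (\<Sum>b\<in>Basis. \<bar>y \<bullet> b\<bar>)" by (rule norm_le_l1)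
  also have "\<dots> \<le> real DIM('a) * m" using sum_bounded_above[of Basis "\<lambda>b. \<bar>y \<bullet> b\<bar>" m] m by simp
  finally have "norm y powr p \<le> (real DIM('a) * m) powr p" using p by (intro powr_mono2) auto
  also have "\<dots> = real DIM('a) powr p * \<bar>y \<bullet> b0\<bar> powr p" by (simp add: b0 powr_mult)
  also have "\<dots> \<le> real DIM('a) powr p * (\<Sum>b\<in>Basis. \<bar>y \<bullet> b\<bar> powr p)"
    using b0(1) by (intro mult_left_mono member_le_sum) auto
  finally show ?thesis .
qed

text \<open>Each basis vector may have its own sequence. With N the dimension, N^p comes from
  comparing the norm with coordinates and one more factor N from adding N partial derivatives. For p
  = 1 the bound N K is weakened to the same form.\<close>

lemma grad_pow_le_difference_quotients:
  fixes f :: "'a::euclidean_space \<Rightarrow> real"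
  assumes p: "1 \<le> p" and f: "f \<in> Lp p" and K: "0 \<le> K"
    and le: "\<And>b. b \<in> Basis \<Longrightarrow> \<exists>t. (\<forall>n. 0 < t n) \<and> t \<longlonglongrightarrow> 0 \<and>
      (\<forall>n. diff_energy p f (t n *\<^sub>R b) \<le> ennreal (K * t n powr p))"
  shows "grad_pow p f \<le> ennreal (real DIM('a) powr (p + 1) * K)"
proof -
  obtain t where t: "\<And>b n. b \<in> Basis \<Longrightarrow> 0 < t b n" "\<And>b. b \<in> Basis \<Longrightarrow> t b \<longlonglongrightarrow> 0"
    "\<And>b n. b \<in> Basis \<Longrightarrow> diff_energy p f (t b n *\<^sub>R b) \<le> ennreal (K * t b n powr p)"
    using le by metis
  show ?thesis
  proof (cases "p = 1")
    case True
    have "BV_seminorm f \<le> ennreal (real DIM('a) * K)"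
      unfolding BV_seminorm_def
    proof (intro SUP_least ennreal_leI)
      fix \<phi> :: "'a \<Rightarrow> 'a" assume "\<phi> \<in> {\<phi> \<in> C1c. \<forall>x. norm (\<phi> x) \<le> 1}"
      then have \<phi>: "\<phi> \<in> C1c" "\<And>x. norm (\<phi> x) \<le> 1" by auto
      note \<phi>b = C1c_component[OF \<phi>(1)]
      have "(\<integral>x. f x * div_field \<phi> x \<partial>lebesgue) =
          (\<integral>x. (\<Sum>b\<in>Basis. f x * frechet_derivative (\<lambda>x. \<phi> x \<bullet> b) (at x) b) \<partial>lebesgue)"
        unfolding div_field_def \<phi>b(2) by (simp add: sum_distrib_left)
      also have "\<dots> = (\<Sum>b\<in>Basis. \<integral>x. f x * frechet_derivative (\<lambda>x. \<phi> x \<bullet> b) (at x) b \<partial>lebesgue)"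
        by (intro Bochner_Integration.integral_sum C1c_integrable_mult(2)[OF p f] \<phi>b(1))
      also have "\<dots> \<le> (\<Sum>b\<in>(Basis::'a set). K)"
      proof (rule sum_mono)
        fix b :: 'a assume b: "b \<in> Basis"
        have "\<bar>\<phi> x \<bullet> b\<bar> \<le> 1" for x using \<phi>(2)[of x] Basis_le_norm[OF b, of "\<phi> x"] by linarith
        then have "\<bar>\<integral>x. f x * frechet_derivative (\<lambda>x. \<phi> x \<bullet> b) (at x) b \<partial>lebesgue\<bar> \<le> K"
          using directional_variation_le[OF p f t(1)[OF b] t(2)[OF b] K t(3)[OF b] True \<phi>b(1)[of b]] by blast
        then show "(\<integral>x. f x * frechet_derivative (\<lambda>x. \<phi> x \<bullet> b) (at x) b \<partial>lebesgue) \<le> K" by linarith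
      qed
      finally show "(\<integral>x. f x * div_field \<phi> x \<partial>lebesgue) \<le> real DIM('a) * K" by simp
    qed
    also have "\<dots> \<le> ennreal (real DIM('a) powr (p + 1) * K)"
    proof (intro ennreal_leI mult_right_mono K)
      have "real DIM('a) powr 1 \<le> real DIM('a) powr (p + 1)"
        using p by (intro powr_mono) (auto simp: Suc_le_eq)
      then show "real DIM('a) \<le> real DIM('a) powr (p + 1)" by simp
    qed
    finally show ?thesis using True by (simp add: grad_pow_def)
  next
    case False
    then have p1: "1 < p" using p by simp
    define Q where "Q b g \<longleftrightarrow> g \<in> borel_measurable lebesgue \<and> (\<integral>\<^sup>+x. ennreal (\<bar>g x\<bar> powr p) \<partial>lebesgue) \<le> ennreal K \<and>
      (\<forall>\<psi>\<in>C1c. (\<integral>x. f x * frechet_derivative \<psi> (at x) b \<partial>lebesgue) = - (\<integral>x. g x * \<psi> x \<partial>lebesgue))" for b g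
    have "\<exists>g. Q b g" if b: "b \<in> Basis" for b
      unfolding Q_def by (rule weak_partial_derivative[OF p f t(1)[OF b] t(2)[OF b] K t(3)[OF b] p1]) blast
    then have "\<forall>b\<in>Basis. \<exists>g. Q b g" by blast
    then obtain g where "\<forall>b\<in>Basis. Q b (g b)" using bchoice[of Basis Q] by blast
    then have g: "\<And>b. b \<in> Basis \<Longrightarrow> g b \<in> borel_measurable lebesgue"
      "\<And>b. b \<in> Basis \<Longrightarrow> (\<integral>\<^sup>+x. ennreal (\<bar>g b x\<bar> powr p) \<partial>lebesgue) \<le> ennreal K"
      "\<And>b \<psi>. b \<in> Basis \<Longrightarrow> \<psi> \<in> C1c \<Longrightarrow>
        (\<integral>x. f x * frechet_derivative \<psi> (at x) b \<partial>lebesgue) = - (\<integral>x. g b x * \<psi> x \<partial>lebesgue)"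
      by (auto simp: Q_def)
    define G where "G x = (\<Sum>b\<in>Basis. g b x *\<^sub>R b)" for x
    have Gb: "G x \<bullet> b = g b x" if "b \<in> Basis" for x b
      using that by (simp add: G_def)
    have "weak_grad f G"
      unfolding weak_grad_def
    proof (intro conjI ballI)
      show "G \<in> borel_measurable lebesgue"
        unfolding G_def by (intro borel_measurable_sum borel_measurable_scaleR g borel_measurable_const)
    qed (simp add: Gb g)
    then have "grad_pow p f \<le> (\<integral>\<^sup>+x. ennreal (norm (G x) powr p) \<partial>lebesgue)"
      unfolding grad_pow_def using False by (auto intro: INF_lower)
    also have "\<dots> \<le> (\<integral>\<^sup>+x. ennreal (real DIM('a) powr p) * (\<Sum>b\<in>Basis. ennreal (\<bar>g b x\<bar> powr p)) \<partial>lebesgue)"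
    proof (rule nn_integral_mono)
      fix x
      have "ennreal (norm (G x) powr p) \<le> ennreal (real DIM('a) powr p * (\<Sum>b\<in>Basis. \<bar>g b x\<bar> powr p))"
        using norm_powr_le_sum[OF p, of "G x"] by (intro ennreal_leI) (simp add: Gb)
      also have "\<dots> = ennreal (real DIM('a) powr p) * (\<Sum>b\<in>Basis. ennreal (\<bar>g b x\<bar> powr p))"
        by (simp add: ennreal_mult sum_nonneg sum_ennreal)
      finally show "ennreal (norm (G x) powr p) \<le> ennreal (real DIM('a) powr p) * (\<Sum>b\<in>Basis. ennreal (\<bar>g b x\<bar> powr p))" .
    qed
    also have "\<dots> = ennreal (real DIM('a) powr p) * (\<Sum>b\<in>Basis. \<integral>\<^sup>+x. ennreal (\<bar>g b x\<bar> powr p) \<partial>lebesgue)"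
      by (subst nn_integral_cmult, intro borel_measurable_sum ennreal_abs_powr_measurable g, assumption)
        (subst nn_integral_sum, intro ennreal_abs_powr_measurable g, assumption, rule refl)
    also have "\<dots> \<le> ennreal (real DIM('a) powr p) * (\<Sum>b\<in>(Basis::'a set). ennreal K)"
      by (intro mult_left_mono sum_mono g) auto
    also have "\<dots> = ennreal (real DIM('a) powr (p + 1) * K)"
      using K by (simp add: powr_add ennreal_mult ennreal_of_nat_eq_real_of_nat mult_ac)
    finally show ?thesis .
  qed
qed

section \<open>Mollified energies\<close>

text \<open>Rough subadditivity with equal arguments is a doubling condition, \<omega>(2t) <= 2A
  \<omega>(t); it is iterated until the power of 2 exceeds \<open>a\<close>.\<close>

lemma C_inc_plus_scale:
  assumes w: "w \<in> C_inc_plus" and a: "0 \<le> a"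
  obtains L where "0 < L" "\<And>t. 0 \<le> t \<Longrightarrow> w (a * t) \<le> L * w t"
proof -
  obtain A where A: "0 < A" "\<And>t1 t2. 0 \<le> t1 \<Longrightarrow> 0 \<le> t2 \<Longrightarrow> w (t1 + t2) \<le> A * (w t1 + w t2)"
    and mono: "mono_on {0..} w"
    using w unfolding C_inc_plus_def C_inc_def by auto
  have pow: "w (2 ^ k * t) \<le> (2 * A) ^ k * w t" if "0 \<le> t" for k t
  proof (induction k)
    case (Suc k)
    have "w (2 ^ Suc k * t) = w (2 ^ k * t + 2 ^ k * t)" by (simp add: algebra_simps)
    also have "\<dots> \<le> A * (w (2 ^ k * t) + w (2 ^ k * t))" using that by (intro A(2)) auto
    also have "\<dots> \<le> A * ((2 * A) ^ k * w t + (2 * A) ^ k * w t)"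
      by (intro mult_left_mono add_mono Suc.IH) (use A(1) in simp)
    finally show ?case by (simp add: algebra_simps)
  qed simp
  obtain k where k: "a < 2 ^ k" using real_arch_pow[of 2 a] by auto
  show thesis
  proof (rule that[of "(2 * A) ^ k"])
    fix t :: real assume t: "0 \<le> t"
    have "w (a * t) \<le> w (2 ^ k * t)"
      using k t a by (intro mono_onD[OF mono] mult_right_mono) auto
    with pow[OF t, of k] show "w (a * t) \<le> (2 * A) ^ k * w t" by linarith
  qed (use A in simp)
qed

text \<open>Used in contraposition: if a sum of two terms is at least 2 s, one term is at least
  s.\<close>

lemma ennreal_add_less_double:
  assumes "x < ennreal s" "y < ennreal s"
  shows "x + y < ennreal (2 * s)"
proof -
  obtain a b where ab: "0 \<le> a" "x = ennreal a" "0 \<le> b" "y = ennreal b"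
    using assms by (metis ennreal_cases ennreal_less_top less_trans order_less_irrefl)
  then have "a < s" "b < s" using assms by (simp_all add: ennreal_less_iff)
  moreover have "x + y = ennreal (a + b)" using ab by simp
  ultimately show ?thesis using ab by (simp add: ennreal_less_iff del: ennreal_plus)
qed

lemma omega_ext_mono:
  assumes w: "w \<in> C_inc" and le: "x \<le> y"
  shows "omega_ext w x \<le> omega_ext w y"
proof (cases "y = top")
  case False
  then have "y < top" by (simp add: less_top)
  then have "x < top" "y < top" using le by (auto intro: le_less_trans)
  moreover from this have "w (enn2real x) \<le> w (enn2real y)"
    using w le by (intro mono_onD[of "{0..}" w]) (auto simp: C_inc_def enn2real_mono)
  ultimately show ?thesis by (auto simp: omega_ext_def intro: ennreal_leI)
qed (simp add: omega_ext_def)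

lemma omega_ext_ennreal: "0 \<le> t \<Longrightarrow> omega_ext w (ennreal t) = ennreal (w t)"
  by (simp add: omega_ext_def)

lemma omega_ext_measurable:
  assumes w: "w \<in> C_inc"
  shows "omega_ext w \<in> borel_measurable borel"
proof -
  \<comment> \<open>Nothing is known about \<open>w\<close> on negative numbers, so it is extended
    by its value at 0.\<close>
  have "continuous_on UNIV (\<lambda>t. w (max 0 t))"
  proof (rule continuous_on_compose2[of "{0..}" w UNIV "max 0"])
    show "continuous_on {0..} w" using w by (simp add: C_inc_def)
    show "continuous_on UNIV (max (0::real))" by (intro continuous_intros)
  qed auto
  then have [measurable]: "(\<lambda>t. w (max 0 t)) \<in> borel_measurable borel"
    by (rule borel_measurable_continuous_onI)
  have "omega_ext w = (\<lambda>x. if x = top then top else ennreal (w (max 0 (enn2real x))))"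
    by (auto simp: omega_ext_def fun_eq_iff max_def)
  also have "\<dots> \<in> borel_measurable borel" by measurable
  finally show ?thesis .
qed

text \<open>The factor \<epsilon>^(-N) in \<open>rho_eps\<close> is the Jacobian of h |->
  h/\<epsilon>, so the mass of the mollifier on a rescaled set does not depend on
  \<epsilon>.\<close>

lemma nn_integral_rho_eps_scale:
  fixes \<rho> :: "'a::euclidean_space \<Rightarrow> real" and u :: "'a \<Rightarrow> ennreal"
  assumes \<rho>: "\<rho> \<in> borel_measurable lebesgue" and u: "u \<in> borel_measurable lebesgue" and \<epsilon>: "0 < \<epsilon>"
  shows "(\<integral>\<^sup>+h. ennreal (rho_eps \<rho> \<epsilon> h) * u (h /\<^sub>R \<epsilon>) \<partial>lebesgue) = (\<integral>\<^sup>+h. ennreal (\<rho> h) * u h \<partial>lebesgue)"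
    "rho_eps \<rho> \<epsilon> \<in> borel_measurable lebesgue"
proof -
  have T: "0 + (\<Sum>j\<in>Basis. (1 / \<epsilon> * (h \<bullet> j)) *\<^sub>R j) = h /\<^sub>R \<epsilon>" for h :: 'a
  proof -
    have "(\<Sum>j\<in>Basis. (1 / \<epsilon> * (h \<bullet> j)) *\<^sub>R j) = (1 / \<epsilon>) *\<^sub>R (\<Sum>j\<in>Basis. (h \<bullet> j) *\<^sub>R j)"
      by (simp add: scaleR_sum_right)
    then show ?thesis by (simp add: euclidean_representation divide_inverse)
  qed
  have c: "(\<Prod>j\<in>(Basis::'a set). \<bar>1 / \<epsilon>\<bar>) = \<epsilon> powr (- real DIM('a))"
    using \<epsilon> by (simp add: powr_minus powr_realpow power_one_over divide_inverse power_inverse)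
  have \<rho>u: "(\<lambda>h. ennreal (\<rho> h) * u h) \<in> borel_measurable lebesgue"
    by (intro borel_measurable_times_ennreal measurable_compose[OF \<rho> measurable_ennreal] u)
  have S: "(\<lambda>h. h /\<^sub>R \<epsilon>) \<in> (lebesgue :: 'a measure) \<rightarrow>\<^sub>M lebesgue"
    using lebesgue_affine_measurable[of "\<lambda>_. 1 / \<epsilon>" "0::'a"] \<epsilon> unfolding T by auto
  have "(\<integral>\<^sup>+h. ennreal (\<rho> h) * u h \<partial>lebesgue) =
      ennreal (\<epsilon> powr (- real DIM('a))) * (\<integral>\<^sup>+h. ennreal (\<rho> (h /\<^sub>R \<epsilon>)) * u (h /\<^sub>R \<epsilon>) \<partial>lebesgue)"
    using lebesgue_diagonal_affine[OF _ \<rho>u, of "\<lambda>_. 1 / \<epsilon>" 0] \<epsilon> unfolding T c by auto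
  also have "\<dots> = (\<integral>\<^sup>+h. ennreal (\<epsilon> powr (- real DIM('a))) * (ennreal (\<rho> (h /\<^sub>R \<epsilon>)) * u (h /\<^sub>R \<epsilon>)) \<partial>lebesgue)"
    by (rule nn_integral_cmult[symmetric]) (rule measurable_compose[OF S \<rho>u])
  also have "\<dots> = (\<integral>\<^sup>+h. ennreal (rho_eps \<rho> \<epsilon> h) * u (h /\<^sub>R \<epsilon>) \<partial>lebesgue)"
    unfolding rho_eps_def by (simp add: ennreal_mult' mult.assoc)
  finally show "(\<integral>\<^sup>+h. ennreal (rho_eps \<rho> \<epsilon> h) * u (h /\<^sub>R \<epsilon>) \<partial>lebesgue) = (\<integral>\<^sup>+h. ennreal (\<rho> h) * u h \<partial>lebesgue)" by simp
  show "rho_eps \<rho> \<epsilon> \<in> borel_measurable lebesgue"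
    unfolding rho_eps_def[abs_def]
    by (intro borel_measurable_times borel_measurable_const measurable_compose[OF S \<rho>])
qed

section \<open>Reflections and cones around a coordinate axis\<close>

definition reflect :: "'a::euclidean_space \<Rightarrow> 'a \<Rightarrow> 'a" where
  "reflect b h = h - (2 * (h \<bullet> b)) *\<^sub>R b"

lemma norm_reflect:
  assumes "b \<in> Basis"
  shows "norm (reflect b h) = norm h"
proof -
  have "b \<bullet> b = 1" using assms by simp
  then have "reflect b h \<bullet> reflect b h = h \<bullet> h"
    unfolding reflect_def by (simp add: inner_diff inner_commute algebra_simps)
  then show ?thesis by (simp add: norm_eq_sqrt_inner)
qed

text \<open>For a basis vector the reflection flips one coordinate, so it is diagonal with entries
  of modulus 1.\<close>

lemma nn_integral_reflect:
  fixes u :: "'a::euclidean_space \<Rightarrow> ennreal"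
  assumes b: "b \<in> Basis" and u: "u \<in> borel_measurable lebesgue"
  shows "(\<integral>\<^sup>+h. u (reflect b h) \<partial>lebesgue) = (\<integral>\<^sup>+h. u h \<partial>lebesgue)"
    "(\<lambda>h. u (reflect b h)) \<in> borel_measurable lebesgue"
proof -
  define c where "c j = (if j = b then - 1 else 1 :: real)" for j :: 'a
  have T: "(\<lambda>h. 0 + (\<Sum>j\<in>Basis. (c j * (h \<bullet> j)) *\<^sub>R j)) = reflect b"
  proof
    fix h
    show "0 + (\<Sum>j\<in>Basis. (c j * (h \<bullet> j)) *\<^sub>R j) = reflect b h"
      by (rule euclidean_eqI) (use b in \<open>auto simp: reflect_def c_def inner_diff_left inner_Basis\<close>)
  qed
  have c: "\<And>j. c j \<noteq> 0" "(\<Prod>j\<in>Basis. \<bar>c j\<bar>) = 1"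
    by (auto simp: c_def intro!: prod.neutral)
  have "reflect b \<in> lebesgue \<rightarrow>\<^sub>M lebesgue"
    using lebesgue_affine_measurable[of c "0::'a"] c(1) unfolding T by auto
  then show "(\<lambda>h. u (reflect b h)) \<in> borel_measurable lebesgue" using u by (rule measurable_compose)
  show "(\<integral>\<^sup>+h. u (reflect b h) \<partial>lebesgue) = (\<integral>\<^sup>+h. u h \<partial>lebesgue)"
    using lebesgue_diagonal_affine[where c = c and t = 0, OF c(1) u] unfolding fun_cong[OF T] c(2) by simp
qed

text \<open>These are the \<open>k\<close> not almost orthogonal to \<open>b\<close>. The bound
  \<open>R\<close> lets a small \<epsilon> bring the rescaled cone into a prescribed ball, and the
  origin is left out because of the division by |k|.\<close>

definition axis_cone :: "'a::euclidean_space \<Rightarrow> real \<Rightarrow> real \<Rightarrow> 'a set" where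
  "axis_cone b \<delta> R = {k. k \<noteq> 0 \<and> \<delta> * norm k \<le> \<bar>k \<bullet> b\<bar> \<and> norm k \<le> R}"

lemma axis_cone_borel: "axis_cone b \<delta> R \<in> sets borel"
proof -
  have "axis_cone b \<delta> R = - {0} \<inter> {k. \<delta> * norm k \<le> \<bar>k \<bullet> b\<bar>} \<inter> cball 0 R"
    by (auto simp: axis_cone_def)
  moreover have "closed {k. \<delta> * norm k \<le> \<bar>k \<bullet> b\<bar>}"
    by (intro closed_Collect_le continuous_intros)
  ultimately show ?thesis by (auto intro: borel_closed)
qed

lemma axis_cone_measurable: "axis_cone b \<delta> R \<in> sets lebesgue"
  by (rule sets_completionI_sets) (simp add: axis_cone_borel)

text \<open>As the slope tends to 0 and the radius to infinity, the cones exhaust everything off the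
  null hyperplane orthogonal to \<open>b\<close>, so their mass tends to 1. The basis is finite,
  hence one stage serves all directions, and it depends on \<rho> only.\<close>

lemma mollifier_cone_mass:
  fixes \<rho> :: "'a::euclidean_space \<Rightarrow> real"
  assumes i: "integrable lebesgue \<rho>" and nn: "\<And>h. 0 \<le> \<rho> h" and 1: "(\<integral>h. \<rho> h \<partial>lebesgue) = 1"
  obtains \<delta> R where "0 < \<delta>" "0 < R"
    "\<And>b. b \<in> Basis \<Longrightarrow> ennreal (1 / 2) \<le> (\<integral>\<^sup>+h. ennreal (\<rho> h) * indicator (axis_cone b \<delta> R) h \<partial>lebesgue)"
proof -
  define S where "S b n = axis_cone b (1 / real (Suc n)) (real n)" for b :: 'a and n
  have Sm: "S b n \<in> sets lebesgue" for b n by (simp add: S_def axis_cone_measurable)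
  have im: "integrable lebesgue (\<lambda>h. \<rho> h * indicator (S b n) h)" for b n
    using integrable_real_mult_indicator[OF Sm i] .
  have "(\<lambda>n. \<integral>h. \<rho> h * indicator (S b n) h \<partial>lebesgue) \<longlonglongrightarrow> (\<integral>h. \<rho> h \<partial>lebesgue)" if b: "b \<in> Basis" for b
  proof (rule integral_dominated_convergence[OF _ _ i])
    have "negligible {h. h \<bullet> b = 0}" by (rule negligible_standard_hyperplane[OF b])
    then have "AE h in lebesgue. h \<notin> {h. h \<bullet> b = 0}"
      unfolding negligible_iff_null_sets by (rule AE_not_in)
    then show "AE h in lebesgue. (\<lambda>n. \<rho> h * indicator (S b n) h) \<longlonglongrightarrow> \<rho> h"
    proof eventually_elim
      case (elim h)
      have "\<forall>\<^sub>F n in sequentially. \<rho> h * indicator (S b n) h = \<rho> h"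
      proof (rule eventually_sequentiallyI)
        fix n assume "nat \<lceil>max (norm h) (norm h / \<bar>h \<bullet> b\<bar>)\<rceil> \<le> n"
        then have "max (norm h) (norm h / \<bar>h \<bullet> b\<bar>) \<le> real n" by linarith
        then have "norm h \<le> real n" "norm h / \<bar>h \<bullet> b\<bar> \<le> real (Suc n)" by auto
        then have "h \<in> S b n" using elim by (auto simp: S_def axis_cone_def field_simps)
        then show "\<rho> h * indicator (S b n) h = \<rho> h" by simp
      qed
      then show ?case by (rule tendsto_eventually)
    qed
    show "AE h in lebesgue. norm (\<rho> h * indicator (S b n) h) \<le> \<rho> h" for n
      using nn by (auto simp: indicator_def)
  qed (use i im in auto)
  then have "\<forall>\<^sub>F n in sequentially. 1 / 2 < (\<integral>h. \<rho> h * indicator (S b n) h \<partial>lebesgue)" if "b \<in> Basis" for b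
    using that 1 by (intro order_tendstoD(1)[where y = 1]) auto
  then have "\<forall>\<^sub>F n in sequentially. \<forall>b\<in>Basis. 1 / 2 < (\<integral>h. \<rho> h * indicator (S b n) h \<partial>lebesgue)"
    by (intro eventually_ball_finite) auto
  then have "\<forall>\<^sub>F n in sequentially. (\<forall>b\<in>Basis. 1 / 2 < (\<integral>h. \<rho> h * indicator (S b n) h \<partial>lebesgue)) \<and> 0 < n"
    using eventually_gt_at_top[of "0::nat"] by eventually_elim auto
  then obtain n where n: "\<And>b. b \<in> Basis \<Longrightarrow> 1 / 2 < (\<integral>h. \<rho> h * indicator (S b n) h \<partial>lebesgue)" "0 < n"
    using eventually_happens'[OF sequentially_bot] by blast
  show thesis
  proof (rule that[of "1 / real (Suc n)" "real n"])
    fix b :: 'a assume b: "b \<in> Basis"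
    have "(\<integral>\<^sup>+h. ennreal (\<rho> h) * indicator (S b n) h \<partial>lebesgue) = (\<integral>\<^sup>+h. ennreal (\<rho> h * indicator (S b n) h) \<partial>lebesgue)"
      by (intro nn_integral_cong) (auto simp: indicator_def)
    also have "\<dots> = ennreal (\<integral>h. \<rho> h * indicator (S b n) h \<partial>lebesgue)"
      using nn by (intro nn_integral_eq_integral im) auto
    finally show "ennreal (1 / 2) \<le> (\<integral>\<^sup>+h. ennreal (\<rho> h) * indicator (axis_cone b (1 / real (Suc n)) (real n)) h \<partial>lebesgue)"
      using ennreal_leI[OF less_imp_le[OF n(1)[OF b]]] unfolding S_def[symmetric] by simp
  qed (use n(2) in auto)
qed

section \<open>Two-sided bounds for the energy of a fixed function\<close>

context
  fixes p m1 m2 :: real and \<omega> \<Omega> :: "real \<Rightarrow> real" and \<rho> f :: "'a::euclidean_space \<Rightarrow> real"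
  assumes p: "1 \<le> p" and \<omega>: "\<omega> \<in> C_inc_plus"
    and m: "0 < m1" "m1 \<le> m2" and \<Omega>: "\<And>t. 0 \<le> t \<Longrightarrow> m1 * t powr p \<le> \<Omega> t \<and> \<Omega> t \<le> m2 * t powr p"
    and \<rho>i: "integrable lebesgue \<rho>" and \<rho>nn: "\<And>h. 0 \<le> \<rho> h" and \<rho>1: "(\<integral>h. \<rho> h \<partial>lebesgue) = 1"
    and \<rho>rad: "\<And>x y. norm x = norm y \<Longrightarrow> \<rho> x = \<rho> y"
    and f: "f \<in> Lp p"
begin

lemma \<omega>_inc: "\<omega> \<in> C_inc" using \<omega> by (simp add: C_inc_plus_def)

lemma \<omega>_mono: "0 \<le> s \<Longrightarrow> s \<le> t \<Longrightarrow> \<omega> s \<le> \<omega> t"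
  using \<omega>_inc mono_onD[of "{0..}" \<omega> s t] by (simp add: C_inc_def)

lemma \<omega>_nonneg: "0 \<le> t \<Longrightarrow> 0 \<le> \<omega> t"
  using \<omega>_inc unfolding C_inc_def by blast

lemma f_measurable: "f \<in> borel_measurable lebesgue" using f by (simp add: Lp_def)

lemma nn_integral_scaled_difference:
  assumes "0 \<le> a"
  shows "(\<integral>\<^sup>+x. ennreal (a * (\<bar>f (x + h) - f x\<bar> / norm h) powr p) \<partial>lebesgue)
    = ennreal (a / norm h powr p) * diff_energy p f h"
proof -
  have "(\<integral>\<^sup>+x. ennreal (a * (\<bar>f (x + h) - f x\<bar> / norm h) powr p) \<partial>lebesgue)
      = (\<integral>\<^sup>+x. ennreal (a / norm h powr p) * ennreal (\<bar>f (x + h) - f x\<bar> powr p) \<partial>lebesgue)"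
    using assms by (intro nn_integral_cong) (simp add: powr_divide flip: ennreal_mult)
  also have "\<dots> = ennreal (a / norm h powr p) * diff_energy p f h"
    unfolding diff_energy_def using difference_measurable[OF f_measurable, of h 0]
    by (intro nn_integral_cmult ennreal_abs_powr_measurable) simp
  finally show ?thesis .
qed

lemma inner_energy_upper:
  "(\<integral>\<^sup>+x. ennreal (\<Omega> (\<bar>f (x + h) - f x\<bar> / norm h)) \<partial>lebesgue) \<le> ennreal m2 * grad_pow p f"
proof -
  have m2: "0 \<le> m2" using m by simp
  have "(\<integral>\<^sup>+x. ennreal (\<Omega> (\<bar>f (x + h) - f x\<bar> / norm h)) \<partial>lebesgue)
      \<le> (\<integral>\<^sup>+x. ennreal (m2 * (\<bar>f (x + h) - f x\<bar> / norm h) powr p) \<partial>lebesgue)"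
    using \<Omega> by (intro nn_integral_mono ennreal_leI) auto
  also have "\<dots> = ennreal (m2 / norm h powr p) * diff_energy p f h"
    by (rule nn_integral_scaled_difference[OF m2])
  also have "\<dots> \<le> ennreal (m2 / norm h powr p) * (ennreal (norm h powr p) * grad_pow p f)"
    unfolding diff_energy_def by (intro mult_left_mono translation_estimate p f) simp
  also have "\<dots> = ennreal (m2 / norm h powr p * norm h powr p) * grad_pow p f"
    by (simp only: ennreal_mult[OF divide_nonneg_nonneg[OF m2 powr_ge_zero] powr_ge_zero] mult.assoc)
  also have "\<dots> \<le> ennreal m2 * grad_pow p f"
    \<comment> \<open>Equality for h nonzero; at h = 0 division by zero makes the left factor
      0.\<close>
    using m2 by (intro mult_right_mono ennreal_leI) (cases "h = 0", auto)
  finally show ?thesis .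
qed

lemma nn_integral_rho_eps:
  assumes "0 < \<epsilon>"
  shows "(\<integral>\<^sup>+h. ennreal (rho_eps \<rho> \<epsilon> h) \<partial>lebesgue) = 1"
proof -
  have "(\<integral>\<^sup>+h. ennreal (rho_eps \<rho> \<epsilon> h) \<partial>lebesgue) = (\<integral>\<^sup>+h. ennreal (\<rho> h) \<partial>lebesgue)"
    using nn_integral_rho_eps_scale(1)[of \<rho> "\<lambda>_. 1" \<epsilon>] \<rho>i assms by auto
  also have "\<dots> = 1" using nn_integral_eq_integral[OF \<rho>i] \<rho>nn \<rho>1 by simp
  finally show ?thesis .
qed

text \<open>The inner integral is bounded uniformly in \<open>h\<close>, so only the unit mass of
  the mollifier remains; the bound holds for each \<epsilon>, not just in the limit.\<close>

lemma nonlocal_energy_upper: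
  assumes L: "0 < L" "\<And>t. 0 \<le> t \<Longrightarrow> \<omega> (m2 * t) \<le> L * \<omega> t" and \<epsilon>: "0 < \<epsilon>"
  shows "nonlocal_energy \<omega> \<Omega> \<rho> \<epsilon> f \<le> ennreal L * omega_ext \<omega> (grad_pow p f)"
proof -
  have m2: "0 < m2" using m by simp
  have bound: "omega_ext \<omega> (ennreal m2 * grad_pow p f) \<le> ennreal L * omega_ext \<omega> (grad_pow p f)"
  proof (cases "grad_pow p f")
    case (real G)
    then have "ennreal m2 * grad_pow p f = ennreal (m2 * G)" using m2 by (simp add: ennreal_mult)
    then show ?thesis using real m2 L by (simp add: omega_ext_ennreal \<omega>_nonneg ennreal_leI flip: ennreal_mult)
  next
    case top
    then show ?thesis using L by (simp add: omega_ext_def ennreal_mult_top)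
  qed
  have "nonlocal_energy \<omega> \<Omega> \<rho> \<epsilon> f \<le> (\<integral>\<^sup>+h. ennreal (rho_eps \<rho> \<epsilon> h) * (ennreal L * omega_ext \<omega> (grad_pow p f)) \<partial>lebesgue)"
    unfolding nonlocal_energy_def
    by (intro nn_integral_mono mult_left_mono order_trans[OF omega_ext_mono[OF \<omega>_inc inner_energy_upper] bound]) simp
  also have "\<dots> = (\<integral>\<^sup>+h. ennreal (rho_eps \<rho> \<epsilon> h) \<partial>lebesgue) * (ennreal L * omega_ext \<omega> (grad_pow p f))"
    using nn_integral_rho_eps_scale(2)[of \<rho> "\<lambda>_. 1" \<epsilon>] \<rho>i \<epsilon>
    by (intro nn_integral_multc measurable_compose[OF _ measurable_ennreal]) auto
  finally show ?thesis by (simp add: nn_integral_rho_eps[OF \<epsilon>])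
qed

text \<open>Adding and reflecting integrals over \<open>h\<close> needs measurability in
  \<open>h\<close>, which is available for E. The energy with \<Omega> enters through the pointwise
  comparison \<open>lower_density_le\<close>.\<close>

definition lower_density :: "'a \<Rightarrow> ennreal" where
  "lower_density h = omega_ext \<omega> (ennreal (m1 / norm h powr p) * diff_energy p f h)"

lemma lower_density_measurable: "lower_density \<in> borel_measurable lebesgue"
proof -
  have "(\<lambda>h::'a. m1 / norm h powr p) \<in> borel_measurable borel" by measurable
  then have "(\<lambda>h::'a. m1 / norm h powr p) \<in> borel_measurable lebesgue"
    by (intro measurable_completion) simp
  then have "(\<lambda>h. ennreal (m1 / norm h powr p) * diff_energy p f h) \<in> borel_measurable lebesgue"
    by (intro borel_measurable_times_ennreal measurable_compose[OF _ measurable_ennreal]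
        diff_energy_measurable f_measurable)
  then show ?thesis
    unfolding lower_density_def[abs_def] by (rule measurable_compose[OF _ omega_ext_measurable[OF \<omega>_inc]])
qed

lemma lower_density_le:
  "lower_density h \<le> omega_ext \<omega> (\<integral>\<^sup>+x. ennreal (\<Omega> (\<bar>f (x + h) - f x\<bar> / norm h)) \<partial>lebesgue)"
proof -
  have "ennreal (m1 / norm h powr p) * diff_energy p f h = (\<integral>\<^sup>+x. ennreal (m1 * (\<bar>f (x + h) - f x\<bar> / norm h) powr p) \<partial>lebesgue)"
    using m by (intro nn_integral_scaled_difference[symmetric]) simp
  also have "\<dots> \<le> (\<integral>\<^sup>+x. ennreal (\<Omega> (\<bar>f (x + h) - f x\<bar> / norm h)) \<partial>lebesgue)"
    using \<Omega> by (intro nn_integral_mono ennreal_leI) auto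
  finally show ?thesis unfolding lower_density_def by (rule omega_ext_mono[OF \<omega>_inc])
qed

text \<open>Of a vector and its mirror image at least one sees a fixed fraction of the difference quotient
  in the direction b, since their difference is parallel to b.\<close>

lemma lower_density_reflect:
  assumes b: "b \<in> Basis" and \<delta>: "0 < \<delta>" and K: "0 \<le> K"
    and E: "\<And>t. 0 < t \<Longrightarrow> t < t0 \<Longrightarrow> ennreal (K * t powr p) \<le> diff_energy p f (t *\<^sub>R b)"
    and h: "h \<noteq> 0" "\<delta> * norm h \<le> \<bar>h \<bullet> b\<bar>" "2 * norm h < t0"
  shows "ennreal (\<omega> (m1 * \<delta> powr p * K / 2)) \<le> lower_density h + lower_density (reflect b h)"
proof -
  \<comment> \<open>The length of \<open>h - reflect b h\<close>, which is a multiple of the unit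
    vector \<open>b\<close>.\<close>
  define t where "t = 2 * \<bar>h \<bullet> b\<bar>"
  have hb: "0 < \<bar>h \<bullet> b\<bar>"
    using h(1,2) \<delta> by (smt (verit) mult_pos_pos zero_less_norm_iff)
  then have t: "0 < t" "t < t0" using h(3) Basis_le_norm[OF b, of h] by (auto simp: t_def)
  \<comment> \<open>Chosen so that 2^p times 2 s equals K (2 \<delta> |h|)^p, which is at most K t^p
    on the cone. After division by |h|^p the remaining bound K \<delta>^p / 2 no longer depends on
    \<open>h\<close>.\<close>
  define s where "s = K * \<delta> powr p * norm h powr p / 2"
  have "ennreal (2 powr p) * ennreal (2 * s) = ennreal (K * (2 * \<delta> * norm h) powr p)"
    using \<delta> K by (simp add: s_def powr_mult mult_ac flip: ennreal_mult)
  also have "\<dots> \<le> ennreal (K * t powr p)"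
    using h(2) \<delta> K p by (intro ennreal_leI mult_left_mono powr_mono2) (auto simp: t_def)
  also have "\<dots> \<le> diff_energy p f (t *\<^sub>R b)" by (rule E[OF t])
  also have "\<dots> = diff_energy p f (h - reflect b h)"
  proof -
    have "h - reflect b h = (2 * (h \<bullet> b)) *\<^sub>R b" by (simp add: reflect_def)
    then show ?thesis
      using diff_energy_uminus[OF f_measurable, of p "t *\<^sub>R b"]
      by (cases "0 \<le> h \<bullet> b") (auto simp: t_def)
  qed
  also have "\<dots> \<le> ennreal (2 powr p) * (diff_energy p f h + diff_energy p f (reflect b h))"
    using p by (intro diff_energy_diff_le f_measurable) simp
  finally have "ennreal (1 / 2 powr p) * (ennreal (2 powr p) * ennreal (2 * s)) \<le>
      ennreal (1 / 2 powr p) * (ennreal (2 powr p) * (diff_energy p f h + diff_energy p f (reflect b h)))"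
    by (rule mult_left_mono) simp
  then have sum: "ennreal (2 * s) \<le> diff_energy p f h + diff_energy p f (reflect b h)"
    by (simp flip: mult.assoc ennreal_mult)
  have s0: "0 \<le> s" using K by (simp add: s_def)
  have "\<exists>k\<in>{h, reflect b h}. ennreal s \<le> diff_energy p f k"
  proof (rule ccontr)
    assume "\<not> ?thesis"
    then have "diff_energy p f h < ennreal s" "diff_energy p f (reflect b h) < ennreal s" by auto
    then have "diff_energy p f h + diff_energy p f (reflect b h) < ennreal (2 * s)"
      by (rule ennreal_add_less_double)
    then show False using sum by simp
  qed
  then obtain k where k: "k = h \<or> k = reflect b h" "ennreal s \<le> diff_energy p f k" by auto
  have nk: "norm k = norm h" using k(1) norm_reflect[OF b] by auto
  have "ennreal (m1 * \<delta> powr p * K / 2) = ennreal (m1 / norm k powr p) * ennreal s"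
    using h(1) m(1) s0 by (simp add: nk s_def mult_ac flip: ennreal_mult)
  also have "\<dots> \<le> ennreal (m1 / norm k powr p) * diff_energy p f k"
    by (intro mult_left_mono k) simp
  finally have "omega_ext \<omega> (ennreal (m1 * \<delta> powr p * K / 2)) \<le> lower_density k"
    unfolding lower_density_def by (rule omega_ext_mono[OF \<omega>_inc])
  moreover have "lower_density k \<le> lower_density h + lower_density (reflect b h)"
    using k(1) by auto
  moreover have "0 \<le> m1 * \<delta> powr p * K / 2" using m K by simp
  ultimately show ?thesis by (simp add: omega_ext_ennreal)
qed

text \<open>The pointwise bound for a mirror pair is integrated over the rescaled cone. The cone has
  mass at least 1/2, and the two mirror terms have equal integrals, so twice the energy dominates
  half of the value of \<omega>; this gives the 4.\<close>

lemma nonlocal_energy_lower: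
  assumes b: "b \<in> Basis" and \<delta>: "0 < \<delta>" and R: "0 < R" and K: "0 \<le> K" and t0: "0 < t0"
    and E: "\<And>t. 0 < t \<Longrightarrow> t < t0 \<Longrightarrow> ennreal (K * t powr p) \<le> diff_energy p f (t *\<^sub>R b)"
    and mass: "ennreal (1 / 2) \<le> (\<integral>\<^sup>+h. ennreal (\<rho> h) * indicator (axis_cone b \<delta> R) h \<partial>lebesgue)"
    and \<epsilon>: "0 < \<epsilon>" "\<epsilon> < t0 / (2 * R)"
  shows "ennreal (\<omega> (m1 * \<delta> powr p * K / 2) / 4) \<le> nonlocal_energy \<omega> \<Omega> \<rho> \<epsilon> f"
proof -
  define u where "u h = ennreal (rho_eps \<rho> \<epsilon> h) * lower_density h" for h
  define w0 where "w0 = \<omega> (m1 * \<delta> powr p * K / 2)"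
  have w0: "0 \<le> w0" unfolding w0_def using m K by (intro \<omega>_nonneg) simp
  have \<rho>m: "\<rho> \<in> borel_measurable lebesgue" using \<rho>i by simp
  have ind: "indicator (axis_cone b \<delta> R) \<in> borel_measurable lebesgue"
    by (intro borel_measurable_indicator axis_cone_measurable)
  note rm = measurable_compose[OF nn_integral_rho_eps_scale(2)[OF \<rho>m ind \<epsilon>(1)] measurable_ennreal]
  have um: "u \<in> borel_measurable lebesgue"
    unfolding u_def[abs_def] by (intro borel_measurable_times_ennreal rm lower_density_measurable)
  \<comment> \<open>Radial symmetry enters here: both members of a mirror pair carry the same
    weight.\<close>
  have rr: "rho_eps \<rho> \<epsilon> (reflect b h) = rho_eps \<rho> \<epsilon> h" for h
    unfolding rho_eps_def using norm_reflect[OF b, of h] by (intro arg_cong[where f = "(*) _"] \<rho>rad) simp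
  have "ennreal (w0 / 2) = ennreal (1 / 2) * ennreal w0"
    using w0 by (subst ennreal_mult[symmetric]) auto
  also have "\<dots> \<le> (\<integral>\<^sup>+h. ennreal (rho_eps \<rho> \<epsilon> h) * indicator (axis_cone b \<delta> R) (h /\<^sub>R \<epsilon>) \<partial>lebesgue) * ennreal w0"
    unfolding nn_integral_rho_eps_scale(1)[OF \<rho>m ind \<epsilon>(1)] by (intro mult_right_mono mass) simp
  also have "\<dots> \<le> (\<integral>\<^sup>+h. ennreal (rho_eps \<rho> \<epsilon> h) * indicator (axis_cone b \<delta> R) (h /\<^sub>R \<epsilon>) * ennreal w0 \<partial>lebesgue)"
  proof -
    have "(\<lambda>h. ennreal (rho_eps \<rho> \<epsilon> h) * indicator (axis_cone b \<delta> R) (h /\<^sub>R \<epsilon>)) \<in> borel_measurable lebesgue"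
    proof (intro borel_measurable_times_ennreal rm)
      have "(\<lambda>h::'a. h /\<^sub>R \<epsilon>) \<in> borel_measurable borel"
        by (intro borel_measurable_continuous_onI continuous_intros)
      then have "(\<lambda>h. indicator (axis_cone b \<delta> R) (h /\<^sub>R \<epsilon>) :: ennreal) \<in> borel_measurable borel"
        by (rule measurable_compose) (intro borel_measurable_indicator axis_cone_borel)
      then show "(\<lambda>h. indicator (axis_cone b \<delta> R) (h /\<^sub>R \<epsilon>) :: ennreal) \<in> borel_measurable lebesgue"
        by (intro measurable_completion) simp
    qed
    then show ?thesis by (simp add: nn_integral_multc)
  qed
  also have "\<dots> \<le> (\<integral>\<^sup>+h. u h + u (reflect b h) \<partial>lebesgue)"
  proof (rule nn_integral_mono)
    fix h
    show "ennreal (rho_eps \<rho> \<epsilon> h) * indicator (axis_cone b \<delta> R) (h /\<^sub>R \<epsilon>) * ennreal w0 \<le> u h + u (reflect b h)"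
    proof (cases "h /\<^sub>R \<epsilon> \<in> axis_cone b \<delta> R")
      case True
      then have h: "h \<noteq> 0" "\<delta> * norm h / \<epsilon> \<le> \<bar>h \<bullet> b\<bar> / \<epsilon>" "norm h / \<epsilon> \<le> R"
        using \<epsilon>(1) by (auto simp: axis_cone_def divide_inverse_commute abs_mult mult_ac)
      then have "\<delta> * norm h \<le> \<bar>h \<bullet> b\<bar>" using \<epsilon>(1) by (simp add: divide_le_cancel)
      moreover have "2 * norm h < t0"
      proof -
        \<comment> \<open>On the rescaled cone |h| <= R \<epsilon>, and \<epsilon> is below t0 / (2
          R).\<close>
        have "2 * norm h \<le> 2 * (R * \<epsilon>)" using h(3) \<epsilon>(1) by (simp add: pos_divide_le_eq)
        also have "\<dots> < t0" using \<epsilon>(2) R by (simp add: pos_less_divide_eq mult_ac)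
        finally show ?thesis .
      qed
      ultimately have "ennreal w0 \<le> lower_density h + lower_density (reflect b h)"
        unfolding w0_def using lower_density_reflect[OF b \<delta> K E h(1)] by blast
      then have "ennreal (rho_eps \<rho> \<epsilon> h) * ennreal w0 \<le> ennreal (rho_eps \<rho> \<epsilon> h) * (lower_density h + lower_density (reflect b h))"
        by (rule mult_left_mono) simp
      then show ?thesis using True by (simp add: u_def rr distrib_left)
    qed simp
  qed
  also have "\<dots> = (\<integral>\<^sup>+h. u h \<partial>lebesgue) + (\<integral>\<^sup>+h. u h \<partial>lebesgue)"
    using nn_integral_reflect[OF b um] um by (simp add: nn_integral_add)
  also have "\<dots> \<le> nonlocal_energy \<omega> \<Omega> \<rho> \<epsilon> f + nonlocal_energy \<omega> \<Omega> \<rho> \<epsilon> f"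
    unfolding nonlocal_energy_def u_def
    by (intro add_mono nn_integral_mono mult_left_mono lower_density_le) auto
  finally have "ennreal (w0 / 2) \<le> nonlocal_energy \<omega> \<Omega> \<rho> \<epsilon> f + nonlocal_energy \<omega> \<Omega> \<rho> \<epsilon> f" .
  moreover have "x + x < ennreal (w0 / 2)" if "x < ennreal (w0 / 4)" for x
    using ennreal_add_less_double[OF that that] by simp
  ultimately show ?thesis unfolding w0_def[symmetric] using not_le by blast
qed

text \<open>If every direction had arbitrarily small t with E(t b) <= K t^p, then
  \<open>grad_pow_le_difference_quotients\<close> would contradict \<open>G\<close>. So one
  direction is good for all small t, and the energy bound holds for all small \<epsilon>, hence even
  for the lower limit.\<close>

lemma Limsup_lower:
  assumes \<delta>: "0 < \<delta>" and R: "0 < R" and K: "0 \<le> K"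
    and mass: "\<And>b. b \<in> Basis \<Longrightarrow> ennreal (1 / 2) \<le> (\<integral>\<^sup>+h. ennreal (\<rho> h) * indicator (axis_cone b \<delta> R) h \<partial>lebesgue)"
    and G: "ennreal (real DIM('a) powr (p + 1) * K) < grad_pow p f"
  shows "ennreal (\<omega> (m1 * \<delta> powr p * K / 2) / 4) \<le> Limsup (at_right 0) (\<lambda>\<epsilon>. nonlocal_energy \<omega> \<Omega> \<rho> \<epsilon> f)"
proof -
  have "\<exists>b\<in>Basis. \<exists>t0>0. \<forall>t. 0 < t \<longrightarrow> t < t0 \<longrightarrow> ennreal (K * t powr p) \<le> diff_energy p f (t *\<^sub>R b)"
  proof (rule ccontr)
    assume "\<not> ?thesis"
    then have N: "\<exists>t. 0 < t \<and> t < t0 \<and> diff_energy p f (t *\<^sub>R b) \<le> ennreal (K * t powr p)"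
      if "b \<in> Basis" "0 < t0" for b t0
      using that by (meson linear)
    have "grad_pow p f \<le> ennreal (real DIM('a) powr (p + 1) * K)"
    proof (rule grad_pow_le_difference_quotients[OF p f K])
      fix b :: 'a assume b: "b \<in> Basis"
      have "\<forall>n. \<exists>t. 0 < t \<and> t < 1 / real (Suc n) \<and> diff_energy p f (t *\<^sub>R b) \<le> ennreal (K * t powr p)"
        using N[OF b] by simp
      then obtain t where t: "\<And>n. 0 < t n \<and> t n < 1 / real (Suc n) \<and> diff_energy p f (t n *\<^sub>R b) \<le> ennreal (K * t n powr p)"
        by metis
      have "t \<longlonglongrightarrow> 0"
        by (rule tendsto_sandwich[OF _ _ tendsto_const LIMSEQ_Suc[OF lim_1_over_n]])
          (use t in \<open>auto intro!: always_eventually less_imp_le\<close>)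
      then show "\<exists>t. (\<forall>n. 0 < t n) \<and> t \<longlonglongrightarrow> 0 \<and> (\<forall>n. diff_energy p f (t n *\<^sub>R b) \<le> ennreal (K * t n powr p))"
        using t by blast
    qed
    with G show False by simp
  qed
  then obtain b t0 where b: "b \<in> Basis" and t0: "0 < t0"
    and E: "\<And>t. 0 < t \<Longrightarrow> t < t0 \<Longrightarrow> ennreal (K * t powr p) \<le> diff_energy p f (t *\<^sub>R b)" by blast
  have "\<forall>\<^sub>F \<epsilon> in at_right 0. ennreal (\<omega> (m1 * \<delta> powr p * K / 2) / 4) \<le> nonlocal_energy \<omega> \<Omega> \<rho> \<epsilon> f"
  proof (rule eventually_at_rightI[of 0 "t0 / (2 * R)"])
    show "ennreal (\<omega> (m1 * \<delta> powr p * K / 2) / 4) \<le> nonlocal_energy \<omega> \<Omega> \<rho> \<epsilon> f" if "\<epsilon> \<in> {0<..<t0 / (2 * R)}" for \<epsilon>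
      using that by (intro nonlocal_energy_lower[OF b \<delta> R K t0 E mass[OF b]]) auto
  qed (use t0 R in simp)
  then have "ennreal (\<omega> (m1 * \<delta> powr p * K / 2) / 4) \<le> Liminf (at_right 0) (\<lambda>\<epsilon>. nonlocal_energy \<omega> \<Omega> \<rho> \<epsilon> f)"
    by (rule Liminf_bounded)
  also have "\<dots> \<le> Limsup (at_right 0) (\<lambda>\<epsilon>. nonlocal_energy \<omega> \<Omega> \<rho> \<epsilon> f)"
    by (rule Liminf_le_Limsup) simp
  finally show ?thesis .
qed

text \<open>The level K is pushed up to a fixed fraction of the gradient energy, and the constants
  inside \<omega> are pulled out by the scaling property with factor \<open>L\<close>.\<close>

lemma omega_grad_le_Limsup:
  assumes \<delta>: "0 < \<delta>" and R: "0 < R"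
    and mass: "\<And>b. b \<in> Basis \<Longrightarrow> ennreal (1 / 2) \<le> (\<integral>\<^sup>+h. ennreal (\<rho> h) * indicator (axis_cone b \<delta> R) h \<partial>lebesgue)"
    and L: "0 < L" "\<And>t. 0 \<le> t \<Longrightarrow> \<omega> (4 * real DIM('a) powr (p + 1) / (m1 * \<delta> powr p) * t) \<le> L * \<omega> t"
  shows "ennreal (1 / (4 * L)) * omega_ext \<omega> (grad_pow p f)
    \<le> Limsup (at_right 0) (\<lambda>\<epsilon>. nonlocal_energy \<omega> \<Omega> \<rho> \<epsilon> f)"
proof -
  define N where "N = real DIM('a) powr (p + 1)"
  define \<theta> where "\<theta> = m1 * \<delta> powr p / 2"
  have N: "0 < N" by (simp add: N_def)
  have \<theta>: "0 < \<theta>" using m \<delta> by (simp add: \<theta>_def)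
  let ?l = "Limsup (at_right 0) (\<lambda>\<epsilon>. nonlocal_energy \<omega> \<Omega> \<rho> \<epsilon> f)"
  have low: "ennreal (\<omega> (\<theta> * K) / 4) \<le> ?l" if "0 \<le> K" "ennreal (N * K) < grad_pow p f" for K
    using Limsup_lower[OF \<delta> R that(1) mass] that(2) by (simp add: N_def \<theta>_def)
  show ?thesis
  proof (cases "grad_pow p f")
    case (real G)
    show ?thesis
    proof (cases "G = 0")
      case True
      have "\<omega> 0 = 0" using \<omega>_inc by (simp add: C_inc_def)
      then show ?thesis using real True omega_ext_ennreal[of 0 \<omega>] by simp
    next
      case False
      then have G: "0 < G" using real by simp
      \<comment> \<open>\<open>Limsup_lower\<close> needs N K strictly below G; half of the critical
        value is taken, and then the scaling factor in \<open>L\<close> maps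
        \<open>\<theta> * K\<close> exactly to G.\<close>
      define K where "K = G / (2 * N)"
      have K: "0 \<le> K" "N * K < G" using G N by (auto simp: K_def)
      have "\<omega> G = \<omega> (4 * real DIM('a) powr (p + 1) / (m1 * \<delta> powr p) * (\<theta> * K))"
        using N m \<delta> by (simp add: K_def \<theta>_def N_def[symmetric])
      also have "\<dots> \<le> L * \<omega> (\<theta> * K)" using \<theta> K by (intro L(2)) simp
      finally have "1 / (4 * L) * \<omega> G \<le> \<omega> (\<theta> * K) / 4" using L(1) by (simp add: field_simps)
      then have "ennreal (1 / (4 * L) * \<omega> G) \<le> ennreal (\<omega> (\<theta> * K) / 4)" by (rule ennreal_leI)
      also have "\<dots> \<le> ?l" using K real N by (intro low) (simp_all add: ennreal_less_iff)
      also have "ennreal (1 / (4 * L) * \<omega> G) = ennreal (1 / (4 * L)) * ennreal (\<omega> G)"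
        using real(1) L(1) \<omega>_nonneg by (intro ennreal_mult) auto
      finally show ?thesis using real by (simp only: omega_ext_ennreal)
    qed
  next
    case top
    \<comment> \<open>Now every K is admissible, so a finite upper limit would bound \<omega>,
      against \<omega> tending to infinity.\<close>
    have "?l = top"
    proof (rule ccontr)
      assume "?l \<noteq> top"
      then obtain l where l: "0 \<le> l" "?l = ennreal l" by (cases ?l) auto
      have "\<omega> t \<le> 4 * l" if "0 \<le> t" for t
      proof -
        have "ennreal (\<omega> (\<theta> * (t / \<theta>)) / 4) \<le> ?l" using that \<theta> top by (intro low) auto
        then show ?thesis using l \<theta> by (simp add: ennreal_le_iff)
      qed
      moreover have "\<forall>\<^sub>F t in at_top. 4 * l < \<omega> t \<and> 0 \<le> t"
        using \<omega>_inc by (intro eventually_conj eventually_ge_at_top)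
          (auto simp: C_inc_def filterlim_at_top_dense)
      moreover have "(at_top :: real filter) \<noteq> bot" by simp
      ultimately obtain t where "4 * l < \<omega> t" "0 \<le> t" using eventually_happens' by blast
      then show False using \<open>\<And>t. 0 \<le> t \<Longrightarrow> \<omega> t \<le> 4 * l\<close>[of t] by simp
    qed
    then show ?thesis by simp
  qed
qed

end

text \<open>\<open>W1p\<close> asks for each component of the gradient in $L^p$,
  \<open>grad_pow\<close> for the Euclidean norm; \<open>norm_powr_le_sum\<close> and Cauchy-Schwarz
  pass between them.\<close>

lemma grad_pow_finite_iff:
  fixes f :: "'a::euclidean_space \<Rightarrow> real"
  assumes p: "1 \<le> p" and f: "f \<in> Lp p"
  shows "(if p = 1 then f \<in> BV else f \<in> W1p p) \<longleftrightarrow> grad_pow p f < top"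
proof (cases "p = 1")
  case True
  then show ?thesis using f by (simp add: BV_def grad_pow_def)
next
  case False
  have "f \<in> W1p p \<longleftrightarrow> grad_pow p f < top"
  proof
    assume "f \<in> W1p p"
    then obtain g where g: "weak_grad f g" "\<And>b. b \<in> Basis \<Longrightarrow> (\<lambda>x. g x \<bullet> b) \<in> Lp p"
      by (auto simp: W1p_def)
    have i: "integrable lebesgue (\<lambda>x. real DIM('a) powr p * (\<Sum>b\<in>Basis. \<bar>g x \<bullet> b\<bar> powr p))"
      using g(2) by (auto simp: Lp_def)
    have "grad_pow p f \<le> (\<integral>\<^sup>+x. ennreal (norm (g x) powr p) \<partial>lebesgue)"
      using g(1) False by (auto simp: grad_pow_def intro: INF_lower)
    also have "\<dots> \<le> (\<integral>\<^sup>+x. ennreal (real DIM('a) powr p * (\<Sum>b\<in>Basis. \<bar>g x \<bullet> b\<bar> powr p)) \<partial>lebesgue)"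
      by (intro nn_integral_mono ennreal_leI norm_powr_le_sum p)
    also have "\<dots> < top"
      by (subst nn_integral_eq_integral[OF i]) (auto intro!: AE_I2 mult_nonneg_nonneg sum_nonneg)
    finally show "grad_pow p f < top" .
  next
    assume "grad_pow p f < top"
    then obtain g where g: "weak_grad f g" "(\<integral>\<^sup>+x. ennreal (norm (g x) powr p) \<partial>lebesgue) < top"
      using False by (auto simp: grad_pow_def INF_less_iff)
    then show "f \<in> W1p p"
      using weak_grad_integrable_powr(2)[OF g p] f by (auto simp: W1p_def)
  qed
  then show ?thesis using False by simp
qed

theorem theorem2p6:
  fixes p m1 m2 :: real
    and \<omega> \<Omega> :: "real \<Rightarrow> real"
    and \<rho> :: "'a::euclidean_space \<Rightarrow> real"
  assumes "1 \<le> p"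
    and "\<omega> \<in> C_inc_plus"
    and "\<Omega> \<in> C_inc"
    and "0 < m1" and "m1 \<le> m2"
    and "\<forall>t\<ge>0. m1 * t powr p \<le> \<Omega> t \<and> \<Omega> t \<le> m2 * t powr p"
    and "integrable lebesgue \<rho>"
    and "\<forall>h. 0 \<le> \<rho> h"
    and "(\<integral>h. \<rho> h \<partial>lebesgue) = 1"
    and "\<forall>x y. norm x = norm y \<longrightarrow> \<rho> x = \<rho> y"
  shows "\<exists>c C. 0 < c \<and> c \<le> C \<and>
    (\<forall>f \<in> Lp p.
       ((if p = 1 then f \<in> BV else f \<in> W1p p)
          \<longleftrightarrow> Limsup (at_right 0) (\<lambda>\<epsilon>. nonlocal_energy \<omega> \<Omega> \<rho> \<epsilon> f) < top)
     \<and> ennreal c * omega_ext \<omega> (grad_pow p f)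
          \<le> Limsup (at_right 0) (\<lambda>\<epsilon>. nonlocal_energy \<omega> \<Omega> \<rho> \<epsilon> f)
     \<and> Limsup (at_right 0) (\<lambda>\<epsilon>. nonlocal_energy \<omega> \<Omega> \<rho> \<epsilon> f)
          \<le> ennreal C * omega_ext \<omega> (grad_pow p f))"
proof -
  have \<Omega>': "m1 * t powr p \<le> \<Omega> t \<and> \<Omega> t \<le> m2 * t powr p" if "0 \<le> t" for t
    using assms(6) that by blast
  have \<rho>nn: "\<And>h. 0 \<le> \<rho> h" using assms(8) by blast
  have \<rho>rad: "\<And>x y. norm x = norm y \<Longrightarrow> \<rho> x = \<rho> y" using assms(10) by blast
  \<comment> \<open>These and the constants \<open>L1\<close>, \<open>L2\<close> below are fixed
    before f is introduced, which makes \<open>c\<close> and \<open>C\<close> independent of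
    f.\<close>
  obtain \<delta> R where \<delta>: "0 < \<delta>" and R: "0 < R"
    and mass: "\<And>b. b \<in> Basis \<Longrightarrow> ennreal (1 / 2) \<le> (\<integral>\<^sup>+h. ennreal (\<rho> h) * indicator (axis_cone b \<delta> R) h \<partial>lebesgue)"
    by (rule mollifier_cone_mass[OF assms(7) \<rho>nn assms(9)]) blast
  have a: "0 \<le> 4 * real DIM('a) powr (p + 1) / (m1 * \<delta> powr p)" using assms(4) by simp
  obtain L1 where L1: "0 < L1" "\<And>t. 0 \<le> t \<Longrightarrow> \<omega> (4 * real DIM('a) powr (p + 1) / (m1 * \<delta> powr p) * t) \<le> L1 * \<omega> t"
    using C_inc_plus_scale[OF assms(2) a] by blast
  obtain L2 where L2: "0 < L2" "\<And>t. 0 \<le> t \<Longrightarrow> \<omega> (m2 * t) \<le> L2 * \<omega> t"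
    using C_inc_plus_scale[OF assms(2), of m2] assms(4,5) by auto
  define c where "c = 1 / (4 * L1)"
  \<comment> \<open>The upper estimate only needs \<open>L2\<close>; the maximum guarantees
    \<open>c \<le> C\<close>.\<close>
  define C where "C = max c L2"
  have c: "0 < c" "c \<le> C" using L1 by (auto simp: c_def C_def)
  have "((if p = 1 then f \<in> BV else f \<in> W1p p)
          \<longleftrightarrow> Limsup (at_right 0) (\<lambda>\<epsilon>. nonlocal_energy \<omega> \<Omega> \<rho> \<epsilon> f) < top)
     \<and> ennreal c * omega_ext \<omega> (grad_pow p f)
          \<le> Limsup (at_right 0) (\<lambda>\<epsilon>. nonlocal_energy \<omega> \<Omega> \<rho> \<epsilon> f)
     \<and> Limsup (at_right 0) (\<lambda>\<epsilon>. nonlocal_energy \<omega> \<Omega> \<rho> \<epsilon> f)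
          \<le> ennreal C * omega_ext \<omega> (grad_pow p f)" if f: "f \<in> Lp p" for f
  proof -
    let ?l = "Limsup (at_right 0) (\<lambda>\<epsilon>. nonlocal_energy \<omega> \<Omega> \<rho> \<epsilon> f)"
    have low: "ennreal c * omega_ext \<omega> (grad_pow p f) \<le> ?l"
      unfolding c_def
      by (rule omega_grad_le_Limsup[OF assms(1,2,4,5) \<Omega>' assms(7) \<rho>nn assms(9) \<rho>rad f \<delta> R mass L1])
    have "\<forall>\<^sub>F \<epsilon> in at_right 0. nonlocal_energy \<omega> \<Omega> \<rho> \<epsilon> f \<le> ennreal L2 * omega_ext \<omega> (grad_pow p f)"
    proof (rule eventually_at_rightI[of 0 1])
      show "nonlocal_energy \<omega> \<Omega> \<rho> \<epsilon> f \<le> ennreal L2 * omega_ext \<omega> (grad_pow p f)" if "\<epsilon> \<in> {0<..<1}" for \<epsilon>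
        by (rule nonlocal_energy_upper[OF assms(1,2,4,5) \<Omega>' assms(7) \<rho>nn assms(9) \<rho>rad f L2]) (use that in auto)
    qed simp
    then have "?l \<le> ennreal L2 * omega_ext \<omega> (grad_pow p f)" by (rule Limsup_bounded)
    also have "\<dots> \<le> ennreal C * omega_ext \<omega> (grad_pow p f)"
      by (intro mult_right_mono ennreal_leI) (auto simp: C_def)
    finally have up: "?l \<le> ennreal C * omega_ext \<omega> (grad_pow p f)" .
    \<comment> \<open>Both directions follow from the two-sided estimate, because \<omega> is finite
      at finite arguments and \<open>omega_ext\<close> sends \<open>top\<close> to
      \<open>top\<close>.\<close>
    have "?l < top \<longleftrightarrow> grad_pow p f < top"
    proof
      assume "?l < top"
      with low have "ennreal c * omega_ext \<omega> (grad_pow p f) < top" by (rule le_less_trans)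
      moreover have "ennreal c * omega_ext \<omega> top = top"
        using c(1) by (simp add: omega_ext_def ennreal_mult_top)
      ultimately have "grad_pow p f \<noteq> top" by auto
      then show "grad_pow p f < top" using less_top by blast
    next
      assume "grad_pow p f < top"
      then have "ennreal C * omega_ext \<omega> (grad_pow p f) < top"
        by (simp add: omega_ext_def ennreal_mult_less_top)
      with up show "?l < top" by (rule le_less_trans)
    qed
    then show ?thesis using grad_pow_finite_iff[OF assms(1) f] low up by simp
  qed
  with c show ?thesis by blast
qed

end
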